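(* Let $\alpha\in(-1/2,0)\cup(0,1/2)$ and let $L:[0,\infty)\to\mathbb{R}$ satisfy: (1) $L$ is twice continuously differentiable on $[0,\infty)$, $L(0)\neq 0$ and $\int_0^\infty |L(s)s^\alpha|^2\,ds<\infty$; (2) there is $\zeta_0>\alpha+3/2$ such that, as $s\uparrow\infty$, $L'(s)=O(s^{-\zeta_0})$ and $L''(s)=O(s^{-(\zeta_0+1)})$. Let $\sigma=(\sigma_t)_{t\in\mathbb{R}}$ be an adapted stationary càglàd process with $\sup_{t}\mathbb{E}(\sigma_t^2)<\infty$, and put $$Y_t=\int_{-\infty}^t L(t-s)(t-s)^\alpha\sigma_s\,dB_s,\qquad X_t=\int_{-\infty}^t\left[(t-s)_+^\alpha-(-s)_+^\alpha\right]\sigma_s\,dB_s,\qquad t\in\mathbb{R}.$$ Then for every $t\in\mathbb{R}$ the function $s\mapsto L(t-s)$, $s\le t$, is integrable with respect to $X$ (that is, it belongs to $\mathcal{H}_t^K$). Moreover, if $$Y_t^X:=\int_{-\infty}^t L(t-s)\,dX_s,\qquad t\in\mathbb{R},$$ then the process $V_t:=Y_t^X-Y_t$, $t\geq 0$, has absolutely continuous paths almost surely.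
   Context: $(\Omega,\mathcal{F},(\mathcal{F}_t)_{t\in\mathbb{R}},\mathbb{P})$ is a filtered probability space satisfying the usual conditions. $B=(B_t)_{t\in\mathbb{R}}$ is a two-sided Brownian motion on it: a continuous centered Gaussian process with $B_0=0$ such that for all $t\ge 0$, $s\in\mathbb{R}$, $B_{t+s}-B_s$ has variance $t$, is $\mathcal{F}_{t+s}$-measurable and is independent of $\mathcal{F}_s$. Càglàd means left-continuous with right limits. Notation: $(x)_+=\max\{0,x\}$, with the convention that $(x)_+^\alpha=0$ for $x\le 0$. For predictable $\phi$, $\int_{\mathbb{R}}\phi_s\,dB_s$ is the Itô integral, which exists iff $\int_{\mathbb{R}}\phi_s^2\,ds<\infty$ a.s. Wiener-type integral with respect to $X$: let $K(t,s)=\{(t-s)_+^\alpha-(-s)_+^\alpha\}\mathbf{1}_{\{t>s\}}$, so that $X_t=\int_{-\infty}^tK(t,s)\sigma_s\,dB_s$. For measurable $f$ and $s<t$ put $$\mathcal{K}_Kf(t,s):=f(s)K(t,s)+\int_s^t[f(u)-f(s)]\frac{\partial}{\partial u}K(u,s)\,du,$$ $$\mathcal{H}_t^K:=\{f\text{ measurable}:\ \mathcal{K}_Kf(t,\cdot)\in\mathcal{L}^2((-\infty,t])\}.$$ For $f\in\mathcal{H}_t^K$ define $\int_{-\infty}^tf(s)\,dX_s:=\int_{-\infty}^t\mathcal{K}_Kf(t,s)\,\sigma_s\,dB_s$. The function $f$ is called integrable with respect to $X$ (on $(-\infty,t]$) if $f\in\mathcal{H}_t^K$. In $Y_t^X$,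 the integrand for given $t$ is $s\mapsto L(t-s)$ on $(-\infty,t]$. *)

theory Defs
  imports "HOL-Probability.Probability" "HOL-Library.Landau_Symbols"
begin

section \<open>Filtered probability spaces and two-sided Brownian motion\<close>

locale usual_filtered_prob_space = prob_space M + filtration "space M" F
  for M :: "'a measure" and F :: "real \<Rightarrow> 'a measure" +
  assumes sets_F_subset: "\<And>t. sets (F t) \<subseteq> sets M"
    and null_sets_F: "\<And>t N A. N \<in> null_sets M \<Longrightarrow> A \<subseteq> N \<Longrightarrow> A \<in> sets (F t)"
    and right_continuous_F: "\<And>t. sets (F t) = (\<Inter>s\<in>{t<..}. sets (F s))"

text \<open>The law of a centered Gaussian variable may be the point mass at 0, which is not covered by
  \<^const>\<open>normal_density\<close>.\<close>

definition centered_gaussian :: "'a measure \<Rightarrow> ('a \<Rightarrow> real) \<Rightarrow> bool" where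
  "centered_gaussian M Z \<longleftrightarrow> Z \<in> borel_measurable M \<and>
     ((AE \<omega> in M. Z \<omega> = 0) \<or> (\<exists>v>0. distributed M lborel Z (normal_density 0 v)))"

definition centered_gaussian_process :: "'a measure \<Rightarrow> ('t \<Rightarrow> 'a \<Rightarrow> real) \<Rightarrow> bool" where
  "centered_gaussian_process M Z \<longleftrightarrow>
     (\<forall>J c. finite J \<longrightarrow> centered_gaussian M (\<lambda>\<omega>. \<Sum>t\<in>J. c t * Z t \<omega>))"

text \<open>Only the increments are adapted: \<open>B s\<close> itself need not be measurable for \<open>F s\<close> when \<open>s < 0\<close>.\<close>

locale two_sided_brownian_motion = usual_filtered_prob_space M F
  for M :: "'a measure" and F :: "real \<Rightarrow> 'a measure" +
  fixes B :: "real \<Rightarrow> 'a \<Rightarrow> real"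
  assumes continuous_paths: "\<And>\<omega>. \<omega> \<in> space M \<Longrightarrow> continuous_on UNIV (\<lambda>t. B t \<omega>)"
    and gaussian: "centered_gaussian_process M B"
    and zero: "\<And>\<omega>. \<omega> \<in> space M \<Longrightarrow> B 0 \<omega> = 0"
    and variance_increment: "\<And>s t. 0 \<le> t \<Longrightarrow> variance (\<lambda>\<omega>. B (t + s) \<omega> - B s \<omega>) = t"
    and measurable_increment:
      "\<And>s t. 0 \<le> t \<Longrightarrow> (\<lambda>\<omega>. B (t + s) \<omega> - B s \<omega>) \<in> borel_measurable (F (t + s))"
    and indep_increment: "\<And>s t. 0 \<le> t \<Longrightarrow>
      indep_set {(\<lambda>\<omega>. B (t + s) \<omega> - B s \<omega>) -` A \<inter> space M | A. A \<in> sets borel} (sets (F s))"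

section \<open>Path and distributional properties of processes\<close>

definition adapted_process :: "(real \<Rightarrow> 'a measure) \<Rightarrow> (real \<Rightarrow> 'a \<Rightarrow> real) \<Rightarrow> bool" where
  "adapted_process F Z \<longleftrightarrow> (\<forall>t. Z t \<in> borel_measurable (F t))"

definition caglad_process :: "'a measure \<Rightarrow> (real \<Rightarrow> 'a \<Rightarrow> real) \<Rightarrow> bool" where
  "caglad_process M Z \<longleftrightarrow> (\<forall>\<omega>\<in>space M. \<forall>t.
     continuous (at_left t) (\<lambda>s. Z s \<omega>) \<and> (\<exists>l. ((\<lambda>s. Z s \<omega>) \<longlongrightarrow> l) (at_right t)))"

definition stationary_process :: "'a measure \<Rightarrow> (real \<Rightarrow> 'a \<Rightarrow> real) \<Rightarrow> bool" where
  "stationary_process M Z \<longleftrightarrow> (\<forall>h J. finite J \<longrightarrow>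
     distr M (Pi\<^sub>M J (\<lambda>_. borel)) (\<lambda>\<omega>. \<lambda>t\<in>J. Z (t + h) \<omega>) =
     distr M (Pi\<^sub>M J (\<lambda>_. borel)) (\<lambda>\<omega>. \<lambda>t\<in>J. Z t \<omega>))"

definition absolutely_continuous_on_interval :: "real \<Rightarrow> real \<Rightarrow> (real \<Rightarrow> real) \<Rightarrow> bool" where
  "absolutely_continuous_on_interval u v f \<longleftrightarrow>
     (\<forall>\<epsilon>>0. \<exists>\<delta>>0. \<forall>(n::nat) a b.
        (\<forall>i<n. u \<le> a i \<and> a i \<le> b i \<and> b i \<le> v) \<and>
        disjoint_family_on (\<lambda>i. {a i<..<b i}) {..<n} \<and>
        (\<Sum>i<n. b i - a i) < \<delta> \<longrightarrow>
        (\<Sum>i<n. \<bar>f (b i) - f (a i)\<bar>) < \<epsilon>)"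

section \<open>The It\^o integral over the real line\<close>

definition predictable_sigma :: "'a measure \<Rightarrow> (real \<Rightarrow> 'a measure) \<Rightarrow> (real \<times> 'a) measure" where
  "predictable_sigma M F = sigma (UNIV \<times> space M) {{a<..b} \<times> A | a b A. a \<le> b \<and> A \<in> sets (F a)}"

definition predictable_process ::
  "'a measure \<Rightarrow> (real \<Rightarrow> 'a measure) \<Rightarrow> (real \<Rightarrow> 'a \<Rightarrow> real) \<Rightarrow> bool" where
  "predictable_process M F \<phi> \<longleftrightarrow> (\<lambda>(s, \<omega>). \<phi> s \<omega>) \<in> borel_measurable (predictable_sigma M F)"

text \<open>A list of triples \<open>(a, b, \<xi>)\<close> stands for the sum of the integrands \<open>\<xi> \<one>\<^bsub>(a, b]\<^esub>\<close>, with \<open>\<xi>\<close> bounded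
  and measurable for \<open>F a\<close>.\<close>

definition simple_predictable ::
  "'a measure \<Rightarrow> (real \<Rightarrow> 'a measure) \<Rightarrow> (real \<times> real \<times> ('a \<Rightarrow> real)) list \<Rightarrow> bool" where
  "simple_predictable M F H \<longleftrightarrow> (\<forall>(a, b, \<xi>)\<in>set H.
     a \<le> b \<and> \<xi> \<in> borel_measurable (F a) \<and> (\<exists>C. \<forall>\<omega>\<in>space M. \<bar>\<xi> \<omega>\<bar> \<le> C))"

definition simple_process :: "(real \<times> real \<times> ('a \<Rightarrow> real)) list \<Rightarrow> real \<Rightarrow> 'a \<Rightarrow> real" where
  "simple_process H s \<omega> = (\<Sum>(a, b, \<xi>)\<leftarrow>H. \<xi> \<omega> * indicator {a<..b} s)"

definition simple_ito_sum ::
  "(real \<Rightarrow> 'a \<Rightarrow> real) \<Rightarrow> (real \<times> real \<times> ('a \<Rightarrow> real)) list \<Rightarrow> 'a \<Rightarrow> real" where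
  "simple_ito_sum B H \<omega> = (\<Sum>(a, b, \<xi>)\<leftarrow>H. \<xi> \<omega> * (B b \<omega> - B a \<omega>))"

text \<open>\<open>I\<close> is a version of the integral of the predictable process \<open>\<phi>\<close>: it is the limit in probability
  of the sums for simple integrands \<open>H n\<close> whose squared \<open>L\<^sup>2(ds)\<close>-distance to \<open>\<phi>\<close> tends to 0 in
  probability. This determines \<open>I\<close> up to a null set.\<close>

definition has_ito_integral ::
  "'a measure \<Rightarrow> (real \<Rightarrow> 'a measure) \<Rightarrow> (real \<Rightarrow> 'a \<Rightarrow> real) \<Rightarrow>
   (real \<Rightarrow> 'a \<Rightarrow> real) \<Rightarrow> ('a \<Rightarrow> real) \<Rightarrow> bool" where
  "has_ito_integral M F B \<phi> I \<longleftrightarrow>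
     predictable_process M F \<phi> \<and>
     (AE \<omega> in M. (\<integral>\<^sup>+s. ennreal ((\<phi> s \<omega>)\<^sup>2) \<partial>lborel) < \<infinity>) \<and>
     I \<in> borel_measurable M \<and>
     (\<exists>H. (\<forall>n::nat. simple_predictable M F (H n)) \<and>
       (\<forall>\<epsilon>>0. (\<lambda>n. measure M {\<omega>\<in>space M.
          ennreal \<epsilon> < (\<integral>\<^sup>+s. ennreal ((simple_process (H n) s \<omega> - \<phi> s \<omega>)\<^sup>2) \<partial>lborel)})
          \<longlonglongrightarrow> 0) \<and>
       (\<forall>\<epsilon>>0. (\<lambda>n. measure M {\<omega>\<in>space M. \<epsilon> < \<bar>simple_ito_sum B (H n) \<omega> - I \<omega>\<bar>})
          \<longlonglongrightarrow> 0))"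

definition ito_integral ::
  "'a measure \<Rightarrow> (real \<Rightarrow> 'a measure) \<Rightarrow> (real \<Rightarrow> 'a \<Rightarrow> real) \<Rightarrow>
   (real \<Rightarrow> 'a \<Rightarrow> real) \<Rightarrow> 'a \<Rightarrow> real" where
  "ito_integral M F B \<phi> = (SOME I. has_ito_integral M F B \<phi> I)"

definition has_ito_integral_upto ::
  "'a measure \<Rightarrow> (real \<Rightarrow> 'a measure) \<Rightarrow> (real \<Rightarrow> 'a \<Rightarrow> real) \<Rightarrow> real \<Rightarrow>
   (real \<Rightarrow> 'a \<Rightarrow> real) \<Rightarrow> ('a \<Rightarrow> real) \<Rightarrow> bool" where
  "has_ito_integral_upto M F B t \<phi> I \<longleftrightarrow>
     has_ito_integral M F B (\<lambda>s \<omega>. indicator {..t} s * \<phi> s \<omega>) I"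

definition ito_integral_upto ::
  "'a measure \<Rightarrow> (real \<Rightarrow> 'a measure) \<Rightarrow> (real \<Rightarrow> 'a \<Rightarrow> real) \<Rightarrow> real \<Rightarrow>
   (real \<Rightarrow> 'a \<Rightarrow> real) \<Rightarrow> 'a \<Rightarrow> real" where
  "ito_integral_upto M F B t \<phi> = ito_integral M F B (\<lambda>s \<omega>. indicator {..t} s * \<phi> s \<omega>)"

section \<open>Wiener-type integrals with respect to \<open>X\<close>\<close>

text \<open>Since \<open>0 powr \<alpha> = 0\<close>, the convention that \<open>(x)\<^sub>+\<close> to the power \<open>\<alpha>\<close> vanishes for \<open>x \<le> 0\<close> holds also
  when \<open>\<alpha> < 0\<close>.\<close>

definition pos_powr :: "real \<Rightarrow> real \<Rightarrow> real" where
  "pos_powr x \<alpha> = max 0 x powr \<alpha>"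

definition frac_kernel :: "real \<Rightarrow> real \<Rightarrow> real \<Rightarrow> real" where
  "frac_kernel \<alpha> t s = (pos_powr (t - s) \<alpha> - pos_powr (- s) \<alpha>) * indicator {s<..} t"

definition kernel_increment_integrand ::
  "(real \<Rightarrow> real \<Rightarrow> real) \<Rightarrow> (real \<Rightarrow> real) \<Rightarrow> real \<Rightarrow> real \<Rightarrow> real" where
  "kernel_increment_integrand K f s u = (f u - f s) * deriv (\<lambda>v. K v s) u"

definition kernel_transform ::
  "(real \<Rightarrow> real \<Rightarrow> real) \<Rightarrow> (real \<Rightarrow> real) \<Rightarrow> real \<Rightarrow> real \<Rightarrow> real" where
  "kernel_transform K f t s =
     f s * K t s + set_lebesgue_integral lborel {s..t} (kernel_increment_integrand K f s)"

text \<open>The clause on \<^const>\<open>set_integrable\<close> makes explicit that \<^const>\<open>kernel_transform\<close> is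
  well defined; otherwise the integral would silently be 0. Values of \<open>f\<close> outside \<open>{..t}\<close>
  are irrelevant.\<close>

definition wiener_integrands :: "(real \<Rightarrow> real \<Rightarrow> real) \<Rightarrow> real \<Rightarrow> (real \<Rightarrow> real) set" where
  "wiener_integrands K t = {f.
     set_borel_measurable borel {..t} f \<and>
     (AE s in lborel. s < t \<longrightarrow> set_integrable lborel {s..t} (kernel_increment_integrand K f s)) \<and>
     set_borel_measurable borel {..t} (kernel_transform K f t) \<and>
     set_integrable lborel {..t} (\<lambda>s. (kernel_transform K f t s)\<^sup>2)}"

definition wiener_integral ::
  "'a measure \<Rightarrow> (real \<Rightarrow> 'a measure) \<Rightarrow> (real \<Rightarrow> 'a \<Rightarrow> real) \<Rightarrow>
   (real \<Rightarrow> real \<Rightarrow> real) \<Rightarrow> (real \<Rightarrow> 'a \<Rightarrow> real) \<Rightarrow> real \<Rightarrow> (real \<Rightarrow> real) \<Rightarrow> 'a \<Rightarrow> real" where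
  "wiener_integral M F B K \<sigma> t f =
     ito_integral_upto M F B t (\<lambda>s \<omega>. kernel_transform K f t s * \<sigma> s \<omega>)"

end

theory Submission
  imports Defs
begin

text \<open>
  The difference \<open>Y\<^sup>X - Y\<close> is again a stochastic integral, and its kernel is more regular than that
  of either term. Substituting \<open>u = s + v\<close>, the integral term of \<^const>\<open>kernel_transform\<close> for
  \<open>f = L (t - \<cdot>)\<close> depends on \<open>r = t - s\<close> only; it is
  \<open>G r = \<integral>\<^sub>0\<^sup>r (L (r - v) - L r) \<alpha> v\<^sup>\<alpha>\<^sup>-\<^sup>1 dv\<close>, with \<open>G r = 0\<close> for \<open>r \<le> 0\<close>. In the other term,
  \<open>L (t - s) ((t - s)\<^sup>\<alpha> - (-s)\<^sub>+\<^sup>\<alpha>)\<close>, the first summand is the kernel of \<open>Y\<close>. So for \<open>t \<ge> 0\<close>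
  \<open>Y\<^sup>X - Y\<close> has the kernel \<open>D t s = G (t - s) - L (t - s) (-s)\<^sub>+\<^sup>\<alpha>\<close>.

  The power \<open>(t - s)\<^sup>\<alpha>\<close>, whose behaviour at \<open>s = t\<close> makes the paths of \<open>Y\<close> rough, has disappeared; near
  0 the function \<open>G\<close> is only of order \<open>r\<^sup>\<alpha>\<^sup>+\<^sup>1\<close>. The gain is quantified as follows: \<open>t \<mapsto> D t \<cdot>\<close> is
  Lipschitz on bounded subsets of \<open>[0, \<infinity>)\<close> as a map into \<open>L\<^sup>2(\<real>)\<close>
  (\<open>difference_kernel_lipschitz\<close>). Since \<open>\<sigma>\<close> has bounded second moments, the isometry of the stochastic
  integral turns this into \<open>E (V\<^sub>t - V\<^sub>u)\<^sup>2 \<le> K (t - u)\<^sup>2\<close>.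

  A process that is Lipschitz in mean square has an absolutely continuous modification
  (\<open>absolutely_continuous_modification\<close>): the energies of its piecewise linear interpolations along
  the dyadic grids increase with the level and have bounded expectations, so almost every path has
  finite energy, and the Cauchy-Schwarz inequality bounds its variation over small sets. This takes
  the place of a stochastic Fubini theorem, by which \<open>V\<close> would be differentiated under the integral.

  All integrals exist by \<open>square_integrable_ito_exists\<close>: predictable square-integrable processes are
  limits of simple ones, for which the isometry holds. As the integral is defined through limits in
  probability, that two versions agree almost surely rests on \<open>simple_ito_tail\<close>, which bounds the
  probability of a large integral by that of a large \<open>L\<^sup>2(ds)\<close>-norm of the integrand.
\<close>

section \<open>Increments of Brownian motion\<close>

context two_sided_brownian_motion
begin

lemma measurable_F_imp_M: "f \<in> borel_measurable (F t) \<Longrightarrow> f \<in> borel_measurable M"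
  using measurable_mono[OF order_refl refl sets_F_subset[of t]] by (auto simp: space_F)

lemma measurable_F_mono:
  assumes "s \<le> t" "f \<in> borel_measurable (F s)"
  shows "f \<in> borel_measurable (F t)"
  using assms(2) measurable_mono[OF order_refl refl sets_F_mono[OF assms(1)]] by (auto simp: space_F)

lemma increment_measurable:
  "s \<le> t \<Longrightarrow> (\<lambda>\<omega>. B t \<omega> - B s \<omega>) \<in> borel_measurable (F t)"
  using measurable_increment[of "t - s" s] by simp

lemma increment_measurable_M [measurable]: "(\<lambda>\<omega>. B t \<omega> - B s \<omega>) \<in> borel_measurable M"
proof (cases "s \<le> t")
  case True
  then show ?thesis by (metis increment_measurable measurable_F_imp_M)
next
  case False
  then have "(\<lambda>\<omega>. - (B s \<omega> - B t \<omega>)) \<in> borel_measurable M"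
    by (intro borel_measurable_uminus measurable_F_imp_M[OF increment_measurable]) simp
  then show ?thesis by simp
qed

text \<open>An increment is a linear combination of two values of a Gaussian process, hence centered Gaussian; its
second moment is then the given variance.\<close>

lemma increment_moments:
  assumes "s \<le> t"
  shows "integrable M (\<lambda>\<omega>. B t \<omega> - B s \<omega>)" "expectation (\<lambda>\<omega>. B t \<omega> - B s \<omega>) = 0"
    "integrable M (\<lambda>\<omega>. (B t \<omega> - B s \<omega>)\<^sup>2)" "expectation (\<lambda>\<omega>. (B t \<omega> - B s \<omega>)\<^sup>2) = t - s"
proof -
  let ?D = "\<lambda>\<omega>. B t \<omega> - B s \<omega>"
  have g: "centered_gaussian M ?D"
  proof (cases "s = t")
    case True
    then show ?thesis by (simp add: centered_gaussian_def)
  next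
    case False
    then have "(\<lambda>\<omega>. \<Sum>u\<in>{s, t}. (if u = t then 1 else -1) * B u \<omega>) = ?D"
      by (auto simp: fun_eq_iff)
    moreover have "centered_gaussian M (\<lambda>\<omega>. \<Sum>u\<in>{s, t}. (if u = t then 1 else -1) * B u \<omega>)"
      by (rule gaussian[unfolded centered_gaussian_process_def, rule_format]) simp
    ultimately show ?thesis by simp
  qed
  have *: "integrable M ?D \<and> expectation ?D = 0 \<and> integrable M (\<lambda>\<omega>. (?D \<omega>)\<^sup>2)"
    using g unfolding centered_gaussian_def
  proof (elim conjE disjE)
    assume "AE \<omega> in M. ?D \<omega> = 0"
    then have 1: "AE \<omega> in M. ?D \<omega> = (\<lambda>_. 0) \<omega>" and 2: "AE \<omega> in M. (?D \<omega>)\<^sup>2 = (\<lambda>_. 0) \<omega>" by auto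
    then show ?thesis
      using integrable_cong_AE[OF _ _ 1] integral_cong_AE[OF _ _ 1] integrable_cong_AE[OF _ _ 2]
      by simp
  next
    assume "\<exists>v>0. distributed M lborel ?D (normal_density 0 v)"
    then obtain v where v: "v > 0" and D: "distributed M lborel ?D (normal_density 0 v)" by blast
    have "integrable M (\<lambda>\<omega>. (?D \<omega>)^k)" for k
      using distributed_integrable[OF D, of "\<lambda>x. x^k"] integrable_normal_moment[OF v, of 0 k]
      by (simp add: normal_density_nonneg)
    from this[of 1] this[of 2] show ?thesis
      using distributed_integral[OF D, of "\<lambda>x. x"] integral_normal_moment_nz_1[OF v, of 0]
      by (simp add: normal_density_nonneg)
  qed
  then show "integrable M ?D" "expectation ?D = 0" "integrable M (\<lambda>\<omega>. (?D \<omega>)\<^sup>2)" by auto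
  show "expectation (\<lambda>\<omega>. (?D \<omega>)\<^sup>2) = t - s"
    using variance_increment[of "t - s" s] * assms by simp
qed

lemma indep_var_increment:
  assumes "s \<le> t" "\<eta> \<in> borel_measurable (F s)"
  shows "indep_var borel \<eta> borel (\<lambda>\<omega>. B t \<omega> - B s \<omega>)"
proof -
  let ?D = "\<lambda>\<omega>. B t \<omega> - B s \<omega>"
  have i: "indep_set {?D -` A \<inter> space M | A. A \<in> sets borel} (sets (F s))"
    using indep_increment[of "t - s" s] assms by simp
  have st: "Int_stable {?D -` A \<inter> space M | A. A \<in> sets borel}"
  proof (rule Int_stableI, clarsimp)
    fix A A' :: "real set"
    assume "A \<in> sets borel" "A' \<in> sets borel"
    then show "\<exists>C. ?D -` A \<inter> space M \<inter> (?D -` A' \<inter> space M) = ?D -` C \<inter> space M \<and> C \<in> sets borel"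
      by (intro exI[of _ "A \<inter> A'"]) auto
  qed
  have "sets (F s) = sigma_sets (space M) (sets (F s))"
    using sets.sigma_sets_eq[of "F s"] by (simp add: space_F)
  moreover have "Int_stable (sets (F s))" by (auto simp: Int_stable_def)
  ultimately have I: "indep_set (sigma_sets (space M) {?D -` A \<inter> space M | A. A \<in> sets borel}) (sets (F s))"
    using indep_set_sigma_sets[OF i st] by simp
  have sub: "sigma_sets (space M) {\<eta> -` A \<inter> space M | A. A \<in> sets borel} \<subseteq> sets (F s)"
  proof (rule sets.sigma_sets_subset[of _ "F s", unfolded space_F])
    show "{\<eta> -` A \<inter> space M | A. A \<in> sets borel} \<subseteq> sets (F s)"
      using measurable_sets[OF assms(2)] by (auto simp: space_F)
  qed
  have "indep_set (sigma_sets (space M) {\<eta> -` A \<inter> space M | A. A \<in> sets borel})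
      (sigma_sets (space M) {?D -` A \<inter> space M | A. A \<in> sets borel})"
    unfolding indep_sets2_eq
  proof (intro conjI ballI)
    fix a b
    assume "a \<in> sigma_sets (space M) {\<eta> -` A \<inter> space M | A. A \<in> sets borel}"
      and "b \<in> sigma_sets (space M) {?D -` A \<inter> space M | A. A \<in> sets borel}"
    then have "prob (b \<inter> a) = prob b * prob a"
      using I sub unfolding indep_sets2_eq by blast
    then show "prob (a \<inter> b) = prob a * prob b" by (simp only: Int_commute mult.commute)
  qed (use I sub in \<open>auto simp: indep_sets2_eq\<close>)
  then show ?thesis
    unfolding indep_var_eq using measurable_F_imp_M[OF assms(2)] by auto
qed

text \<open>These moments are all that the isometry uses: an increment is orthogonal to the past, and its square
contributes the length of the interval independently of the past. The factor \<open>\<eta>\<close> is only integrable,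
because it will contain earlier, unbounded increments.\<close>

lemma expectation_mult_increment:
  assumes "s \<le> t" "\<eta> \<in> borel_measurable (F s)" "integrable M \<eta>"
  shows "integrable M (\<lambda>\<omega>. \<eta> \<omega> * (B t \<omega> - B s \<omega>))"
    "expectation (\<lambda>\<omega>. \<eta> \<omega> * (B t \<omega> - B s \<omega>)) = 0"
    "integrable M (\<lambda>\<omega>. \<eta> \<omega> * (B t \<omega> - B s \<omega>)\<^sup>2)"
    "expectation (\<lambda>\<omega>. \<eta> \<omega> * (B t \<omega> - B s \<omega>)\<^sup>2) = expectation \<eta> * (t - s)"
proof -
  let ?D = "\<lambda>\<omega>. B t \<omega> - B s \<omega>"
  note i = indep_var_increment[OF assms(1,2)]
  note m = increment_moments[OF assms(1)]
  show "integrable M (\<lambda>\<omega>. \<eta> \<omega> * ?D \<omega>)" "expectation (\<lambda>\<omega>. \<eta> \<omega> * ?D \<omega>) = 0"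
    using indep_var_lebesgue_integral[OF i assms(3) m(1)] indep_var_integrable[OF i assms(3) m(1)] m
    by auto
  have "indep_var borel (id \<circ> \<eta>) borel ((\<lambda>x::real. x\<^sup>2) \<circ> ?D)"
    by (rule indep_var_compose[OF i]) auto
  then have i2: "indep_var borel \<eta> borel (\<lambda>\<omega>. (?D \<omega>)\<^sup>2)" by (simp add: comp_def)
  show "integrable M (\<lambda>\<omega>. \<eta> \<omega> * (?D \<omega>)\<^sup>2)"
    "expectation (\<lambda>\<omega>. \<eta> \<omega> * (?D \<omega>)\<^sup>2) = expectation \<eta> * (t - s)"
    using indep_var_lebesgue_integral[OF i2 assms(3) m(3)] indep_var_integrable[OF i2 assms(3) m(3)] m
    by auto
qed

end

section \<open>Isometry and tail estimate for simple integrands\<close>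

text \<open>For a general \<open>g\<close>, since it is used both with the paths of \<open>B\<close> and with the step functions
\<open>b \<mapsto> indicator {s..} b\<close>, whose differences are the indicators of half-open intervals.\<close>

lemma sum_partition_telescope:
  fixes p :: "nat \<Rightarrow> 'b::linorder" and g :: "'b \<Rightarrow> 'c::ab_group_add"
  assumes sm: "strict_mono_on {..n} p" and k: "k \<le> l" "l \<le> n"
  shows "(\<Sum>i<n. if p k \<le> p i \<and> p i < p l then g (p (Suc i)) - g (p i) else 0) = g (p l) - g (p k)"
proof -
  have "p k \<le> p i \<longleftrightarrow> k \<le> i" "p i < p l \<longleftrightarrow> i < l" if "i < n" for i
    using strict_mono_on_less_eq[OF sm] strict_mono_on_less[OF sm] that k by simp_all
  then have "(\<Sum>i<n. if p k \<le> p i \<and> p i < p l then g (p (Suc i)) - g (p i) else 0)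
      = (\<Sum>i<n. if i \<in> {k..<l} then g (p (Suc i)) - g (p i) else 0)"
    by (intro sum.cong) auto
  also have "\<dots> = (\<Sum>i\<in>{..<n} \<inter> {k..<l}. g (p (Suc i)) - g (p i))"
    by (simp add: sum.inter_restrict)
  also have "{..<n} \<inter> {k..<l} = {k..<l}" using k by auto
  finally show ?thesis using sum_Suc_diff'[OF k(1), of "\<lambda>i. g (p i)"] by simp
qed

lemma square_sum_disjoint_intervals:
  fixes p :: "nat \<Rightarrow> real" and y :: "nat \<Rightarrow> real"
  assumes "mono p"
  shows "(\<Sum>i<n. y i * indicator {p i<..p (Suc i)} s)\<^sup>2
    = (\<Sum>i<n. (y i)\<^sup>2 * indicator {p i<..p (Suc i)} s)"
proof (induction n)
  case (Suc n)
  have sq: "(a + b)\<^sup>2 = a\<^sup>2 + b\<^sup>2" if "b * a = 0" for a b :: real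
    using that by (auto simp: power2_sum)
  have z: "y n * indicator {p n<..p (Suc n)} s * (\<Sum>i<n. y i * indicator {p i<..p (Suc i)} s) = 0"
  proof (cases "p n < s")
    case True
    then have "s \<notin> {p i<..p (Suc i)}" if "i < n" for i
      using monoD[OF assms, of "Suc i" n] that by auto
    then show ?thesis by simp
  qed simp
  have e: "(y n * indicator {p n<..p (Suc n)} s)\<^sup>2 = (y n)\<^sup>2 * indicator {p n<..p (Suc n)} s"
    by (simp add: indicator_def)
  show ?case unfolding sum.lessThan_Suc sq[OF z] Suc e ..
qed simp

lemma nn_integral_square_step:
  fixes p :: "nat \<Rightarrow> real" and y :: "nat \<Rightarrow> real"
  assumes "mono p"
  shows "(\<integral>\<^sup>+s. ennreal ((\<Sum>i<n. y i * indicator {p i<..p (Suc i)} s)\<^sup>2) \<partial>lborel)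
    = ennreal (\<Sum>i<n. (y i)\<^sup>2 * (p (Suc i) - p i))"
proof -
  have le: "p i \<le> p (Suc i)" for i using assms by (simp add: monoD)
  have "(\<integral>\<^sup>+s. ennreal ((\<Sum>i<n. y i * indicator {p i<..p (Suc i)} s)\<^sup>2) \<partial>lborel)
      = (\<integral>\<^sup>+s. (\<Sum>i<n. ennreal ((y i)\<^sup>2) * indicator {p i<..p (Suc i)} s) \<partial>lborel)"
    unfolding square_sum_disjoint_intervals[OF assms]
    by (intro nn_integral_cong, subst sum_ennreal[symmetric])
      (auto simp: ennreal_mult' ennreal_indicator intro!: sum.cong)
  also have "\<dots> = (\<Sum>i<n. ennreal ((y i)\<^sup>2 * (p (Suc i) - p i)))"
    by (subst nn_integral_sum, simp) (auto simp: nn_integral_cmult le ennreal_mult' intro!: sum.cong)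
  also have "\<dots> = ennreal (\<Sum>i<n. (y i)\<^sup>2 * (p (Suc i) - p i))"
    using le by (intro sum_ennreal) simp
  finally show ?thesis .
qed

context two_sided_brownian_motion
begin

text \<open>Simple integrands with consecutive intervals \<open>(p i, p (i + 1)]\<close>, only finitely many of which will be
used at a time. The isometry and the truncation in \<open>simple_ito_tail\<close> need disjoint intervals in
increasing order, whereas those of \<^const>\<open>simple_process\<close> may overlap.\<close>

definition adapted_grid :: "(nat \<Rightarrow> real) \<Rightarrow> (nat \<Rightarrow> 'a \<Rightarrow> real) \<Rightarrow> bool" where
  "adapted_grid p x \<longleftrightarrow> mono p \<and>
     (\<forall>i. x i \<in> borel_measurable (F (p i)) \<and> (\<exists>C. \<forall>\<omega>\<in>space M. \<bar>x i \<omega>\<bar> \<le> C))"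

text \<open>The grid consists of all endpoints; a value \<open>\<xi>\<close> on \<open>(a, b]\<close> is used on every cell of the grid inside
\<open>(a, b]\<close>, where it is still measurable for the left endpoint because that does not lie to the left of \<open>a\<close>.\<close>

lemma simple_predictable_grid:
  assumes H: "simple_predictable M F H"
  obtains n p x where "adapted_grid p x"
    "\<And>s \<omega>. simple_process H s \<omega> = (\<Sum>i<n. x i \<omega> * indicator {p i<..p (Suc i)} s)"
    "\<And>\<omega>. simple_ito_sum B H \<omega> = (\<Sum>i<n. x i \<omega> * (B (p (Suc i)) \<omega> - B (p i) \<omega>))"
proof -
  \<comment> \<open>The point 0 is added so that the grid is nonempty also for the empty list \<open>H\<close>.\<close>
  define P where "P = insert 0 (fst ` set H \<union> (fst \<circ> snd) ` set H)"
  have P: "finite P" "P \<noteq> {}" by (auto simp: P_def)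
  define ps where "ps = sorted_list_of_set P"
  define n where "n = length ps - 1"
  have ps: "sorted_wrt (<) ps" "set ps = P" using P by (auto simp: ps_def)
  have "ps \<noteq> []" using ps P by auto
  then have len: "length ps = Suc n" by (simp add: n_def)
  \<comment> \<open>Constant beyond the last point, so that \<open>p\<close> is monotone on all natural numbers.\<close>
  define p where "p i = ps ! min i n" for i
  have sm: "strict_mono_on {..n} p"
    using sorted_wrt_nth_less[OF ps(1)] len by (auto intro!: strict_mono_onI simp: p_def)
  have mono: "mono p"
  proof (rule monoI)
    fix i j :: nat assume "i \<le> j"
    then have "min i n \<le> min j n" by simp
    moreover have "p i = p (min i n)" "p j = p (min j n)" by (simp_all add: p_def)
    ultimately show "p i \<le> p j"
      using strict_mono_on_less_eq[OF sm, of "min i n" "min j n"] by simp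
  qed
  have ex: "\<exists>k\<le>n. c = p k" if c: "c \<in> P" for c
  proof -
    obtain k where "k < length ps" "ps ! k = c"
      using c unfolding ps(2)[symmetric] in_set_conv_nth by blast
    then show ?thesis by (intro exI[of _ k]) (simp add: p_def len)
  qed
  define w where "w h i \<omega> = (case h of (a, b, \<xi>) \<Rightarrow> if a \<le> p i \<and> p i < b then \<xi> \<omega> else 0)"
    for h :: "real \<times> real \<times> ('a \<Rightarrow> real)" and i \<omega>
  define x where "x i \<omega> = (\<Sum>h\<leftarrow>H. w h i \<omega>)" for i \<omega>
  have tel: "(\<Sum>i<n. w (a, b, \<xi>) i \<omega> * (g (p (Suc i)) - g (p i))) = \<xi> \<omega> * (g b - g a)"
    if "(a, b, \<xi>) \<in> set H" for a b \<xi> \<omega> and g :: "real \<Rightarrow> real"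
  proof -
    have "a \<in> P" "b \<in> P" using that by (force simp: P_def)+
    then obtain k l where kl: "k \<le> n" "a = p k" "l \<le> n" "b = p l" using ex by meson
    moreover have "a \<le> b" using H that by (auto simp: simple_predictable_def)
    ultimately have "k \<le> l" using strict_mono_on_less_eq[OF sm, of k l] by simp
    have "(\<Sum>i<n. w (a, b, \<xi>) i \<omega> * (g (p (Suc i)) - g (p i)))
        = \<xi> \<omega> * (\<Sum>i<n. if p k \<le> p i \<and> p i < p l then g (p (Suc i)) - g (p i) else 0)"
      by (auto simp: sum_distrib_left w_def kl intro!: sum.cong)
    then show ?thesis using sum_partition_telescope[OF sm \<open>k \<le> l\<close> kl(3), of g] kl by simp
  qed
  have main: "(\<Sum>i<n. x i \<omega> * (g (p (Suc i)) - g (p i))) = (\<Sum>(a, b, \<xi>)\<leftarrow>H. \<xi> \<omega> * (g b - g a))"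
    for \<omega> and g :: "real \<Rightarrow> real"
  proof -
    have "(\<Sum>i<n. (\<Sum>h\<leftarrow>G. w h i \<omega>) * (g (p (Suc i)) - g (p i))) = (\<Sum>(a, b, \<xi>)\<leftarrow>G. \<xi> \<omega> * (g b - g a))"
      if "set G \<subseteq> set H" for G
      using that
    proof (induction G)
      case (Cons h G)
      obtain a b \<xi> where h: "h = (a, b, \<xi>)" by (cases h)
      show ?case using Cons tel[of a b \<xi> \<omega> g] by (simp add: h distrib_right sum.distrib)
    qed simp
    then show ?thesis by (simp add: x_def)
  qed
  have ind: "indicator {a<..b} s = (indicator {s..} b - indicator {s..} a :: real)" if "a \<le> b" for a b s :: real
    using that by (auto simp: indicator_def)
  have "adapted_grid p x"
    unfolding adapted_grid_def
  proof (intro conjI allI mono)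
    fix i
    have wm: "w h i \<in> borel_measurable (F (p i))" if "h \<in> set H" for h
    proof -
      obtain a b \<xi> where h: "h = (a, b, \<xi>)" by (cases h)
      then have "\<xi> \<in> borel_measurable (F a)" using H that by (auto simp: simple_predictable_def)
      have "w h i = (if a \<le> p i \<and> p i < b then \<xi> else (\<lambda>_. 0))"
        by (auto simp: fun_eq_iff w_def h)
      then show ?thesis using measurable_F_mono[OF _ \<open>\<xi> \<in> borel_measurable (F a)\<close>, of "p i"] by simp
    qed
    have "(\<lambda>\<omega>. \<Sum>h\<leftarrow>G. w h i \<omega>) \<in> borel_measurable (F (p i))" if "set G \<subseteq> set H" for G
      using that by (induction G) (auto intro!: borel_measurable_add wm)
    then show "x i \<in> borel_measurable (F (p i))" unfolding x_def by simp
    have wb: "\<exists>C. \<forall>\<omega>\<in>space M. \<bar>w h i \<omega>\<bar> \<le> C" if hH: "h \<in> set H" for h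
    proof -
      obtain a b \<xi> where h: "h = (a, b, \<xi>)" by (cases h)
      then obtain C where "\<forall>\<omega>\<in>space M. \<bar>\<xi> \<omega>\<bar> \<le> C"
        using H hH by (auto simp: simple_predictable_def)
      then show ?thesis unfolding w_def h by (intro exI[of _ "max C 0"]) (auto simp: le_max_iff_disj)
    qed
    have "\<exists>C. \<forall>\<omega>\<in>space M. \<bar>\<Sum>h\<leftarrow>G. w h i \<omega>\<bar> \<le> C" if "set G \<subseteq> set H" for G
      using that
    proof (induction G)
      case (Cons h G)
      then obtain C D where "\<forall>\<omega>\<in>space M. \<bar>\<Sum>h\<leftarrow>G. w h i \<omega>\<bar> \<le> C" "\<forall>\<omega>\<in>space M. \<bar>w h i \<omega>\<bar> \<le> D"
        using wb[of h] by auto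
      then show ?case by (intro exI[of _ "D + C"]) (auto intro: order_trans[OF abs_triangle_ineq add_mono])
    qed auto
    then show "\<exists>C. \<forall>\<omega>\<in>space M. \<bar>x i \<omega>\<bar> \<le> C" unfolding x_def by simp
  qed
  moreover have "simple_process H s \<omega> = (\<Sum>i<n. x i \<omega> * indicator {p i<..p (Suc i)} s)" for s \<omega>
  proof -
    have "simple_process H s \<omega> = (\<Sum>(a, b, \<xi>)\<leftarrow>H. \<xi> \<omega> * (indicator {s..} b - indicator {s..} a))"
      unfolding simple_process_def using H
      by (intro arg_cong[where f=sum_list] map_cong) (auto simp: simple_predictable_def ind)
    also have "\<dots> = (\<Sum>i<n. x i \<omega> * (indicator {s..} (p (Suc i)) - indicator {s..} (p i)))"
      by (simp add: main)
    also have "\<dots> = (\<Sum>i<n. x i \<omega> * indicator {p i<..p (Suc i)} s)"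
      using mono by (intro sum.cong refl) (simp add: ind monoD)
    finally show ?thesis .
  qed
  moreover have "simple_ito_sum B H \<omega> = (\<Sum>i<n. x i \<omega> * (B (p (Suc i)) \<omega> - B (p i) \<omega>))" for \<omega>
    using main[of \<omega> "\<lambda>s. B s \<omega>"] by (simp add: simple_ito_sum_def)
  ultimately show ?thesis by (rule that)
qed

lemma adapted_grid_mono: "adapted_grid p x \<Longrightarrow> i \<le> j \<Longrightarrow> p i \<le> p j"
  by (simp add: adapted_grid_def monoD)

lemma adapted_grid_measurable: "adapted_grid p x \<Longrightarrow> i \<le> j \<Longrightarrow> x i \<in> borel_measurable (F (p j))"
  by (meson adapted_grid_def adapted_grid_mono measurable_F_mono)

lemma grid_sum_measurable:
  assumes "adapted_grid p x"
  shows "(\<lambda>\<omega>. \<Sum>i<n. x i \<omega> * (B (p (Suc i)) \<omega> - B (p i) \<omega>)) \<in> borel_measurable (F (p n))"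
proof (intro borel_measurable_sum borel_measurable_times)
  fix i assume "i \<in> {..<n}"
  then have i: "i < n" by simp
  show "x i \<in> borel_measurable (F (p n))" using i by (intro adapted_grid_measurable[OF assms]) simp
  show "(\<lambda>\<omega>. B (p (Suc i)) \<omega> - B (p i) \<omega>) \<in> borel_measurable (F (p n))"
    using i adapted_grid_mono[OF assms]
    by (intro measurable_F_mono[OF _ increment_measurable, of "p (Suc i)"]) auto
qed

text \<open>Adding one interval adds a term orthogonal to the previous sum, because that sum times the new
coefficient is measurable for the left endpoint.\<close>

lemma grid_isometry:
  assumes x: "adapted_grid p x"
  shows "integrable M (\<lambda>\<omega>. (\<Sum>i<n. x i \<omega> * (B (p (Suc i)) \<omega> - B (p i) \<omega>))\<^sup>2) \<and>
    expectation (\<lambda>\<omega>. (\<Sum>i<n. x i \<omega> * (B (p (Suc i)) \<omega> - B (p i) \<omega>))\<^sup>2)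
      = expectation (\<lambda>\<omega>. \<Sum>i<n. (x i \<omega>)\<^sup>2 * (p (Suc i) - p i))"
proof (induction n)
  case (Suc n)
  define S where "S \<omega> = (\<Sum>i<n. x i \<omega> * (B (p (Suc i)) \<omega> - B (p i) \<omega>))" for \<omega>
  define D where "D \<omega> = B (p (Suc n)) \<omega> - B (p n) \<omega>" for \<omega>
  have S: "S \<in> borel_measurable (F (p n))" unfolding S_def by (rule grid_sum_measurable[OF x])
  note SM = measurable_F_imp_M[OF S]
  have xn: "x n \<in> borel_measurable (F (p n))" by (rule adapted_grid_measurable[OF x order_refl])
  have xM: "x i \<in> borel_measurable M" for i
    by (rule measurable_F_imp_M[OF adapted_grid_measurable[OF x order_refl]])
  obtain C where C: "\<And>\<omega>. \<omega> \<in> space M \<Longrightarrow> \<bar>x n \<omega>\<bar> \<le> C" using x unfolding adapted_grid_def by blast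
  have le: "p n \<le> p (Suc n)" by (rule adapted_grid_mono[OF x]) simp
  have IH: "integrable M (\<lambda>\<omega>. (S \<omega>)\<^sup>2)"
    "expectation (\<lambda>\<omega>. (S \<omega>)\<^sup>2) = expectation (\<lambda>\<omega>. \<Sum>i<n. (x i \<omega>)\<^sup>2 * (p (Suc i) - p i))"
    using Suc by (auto simp: S_def)
  have Si: "integrable M S" by (rule square_integrable_imp_integrable[OF SM IH(1)])
  have x2: "integrable M (\<lambda>\<omega>. (x i \<omega>)\<^sup>2)" for i
  proof -
    obtain K where K: "\<And>\<omega>. \<omega> \<in> space M \<Longrightarrow> \<bar>x i \<omega>\<bar> \<le> K" using x unfolding adapted_grid_def by blast
    have "\<bar>x i \<omega>\<bar>\<^sup>2 \<le> K\<^sup>2" if "\<omega> \<in> space M" for \<omega>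
      by (intro power_mono K that) simp
    then show ?thesis
      using xM[of i] by (intro integrable_const_bound[of _ "K\<^sup>2"]) auto
  qed
  have xS: "integrable M (\<lambda>\<omega>. x n \<omega> * S \<omega>)"
  proof (rule Bochner_Integration.integrable_bound)
    show "integrable M (\<lambda>\<omega>. C * S \<omega>)" using Si by simp
    show "AE \<omega> in M. norm (x n \<omega> * S \<omega>) \<le> norm (C * S \<omega>)"
      using C by (intro AE_I2) (auto simp: abs_mult intro!: mult_right_mono order_trans[OF C abs_ge_self])
  qed (use xM SM in simp)
  note 1 = expectation_mult_increment(1,2)[OF le _ xS, folded D_def]
  note 2 = expectation_mult_increment(3,4)[OF le _ x2[of n], folded D_def]
  have m: "(\<lambda>\<omega>. x n \<omega> * S \<omega>) \<in> borel_measurable (F (p n))" "(\<lambda>\<omega>. (x n \<omega>)\<^sup>2) \<in> borel_measurable (F (p n))"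
    using xn S by auto
  have eq: "(\<Sum>i<Suc n. x i \<omega> * (B (p (Suc i)) \<omega> - B (p i) \<omega>))\<^sup>2
      = ((S \<omega>)\<^sup>2 + 2 * (x n \<omega> * S \<omega> * D \<omega>)) + (x n \<omega>)\<^sup>2 * (D \<omega>)\<^sup>2" for \<omega>
  proof -
    have "(\<Sum>i<Suc n. x i \<omega> * (B (p (Suc i)) \<omega> - B (p i) \<omega>)) = S \<omega> + x n \<omega> * D \<omega>"
      by (simp add: S_def D_def)
    then show ?thesis by (simp add: power2_eq_square algebra_simps)
  qed
  show ?case
    unfolding eq using 1[OF m(1)] 2[OF m(2)] IH x2 by simp
qed simp

lemma simple_ito_sum_measurable:
  assumes "simple_predictable M F H"
  shows "simple_ito_sum B H \<in> borel_measurable M"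
proof -
  obtain n p x where g: "adapted_grid p x"
    "\<And>s \<omega>. simple_process H s \<omega> = (\<Sum>i<n. x i \<omega> * indicator {p i<..p (Suc i)} s)"
    "\<And>\<omega>. simple_ito_sum B H \<omega> = (\<Sum>i<n. x i \<omega> * (B (p (Suc i)) \<omega> - B (p i) \<omega>))"
    by (rule simple_predictable_grid[OF assms], rule that, assumption+)
  have "simple_ito_sum B H = (\<lambda>\<omega>. \<Sum>i<n. x i \<omega> * (B (p (Suc i)) \<omega> - B (p i) \<omega>))"
    using g(3) by (simp add: fun_eq_iff)
  then show ?thesis using measurable_F_imp_M[OF grid_sum_measurable[OF g(1)]] by simp
qed

lemma grid_energy_integrable:
  assumes x: "adapted_grid p x"
  shows "integrable M (\<lambda>\<omega>. \<Sum>i<n. (x i \<omega>)\<^sup>2 * (p (Suc i) - p i))"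
proof (intro Bochner_Integration.integrable_sum integrable_mult_left)
  fix i
  obtain K where K: "\<And>\<omega>. \<omega> \<in> space M \<Longrightarrow> \<bar>x i \<omega>\<bar> \<le> K" using x unfolding adapted_grid_def by blast
  have "\<bar>x i \<omega>\<bar>\<^sup>2 \<le> K\<^sup>2" if "\<omega> \<in> space M" for \<omega>
    by (intro power_mono K that) simp
  then show "integrable M (\<lambda>\<omega>. (x i \<omega>)\<^sup>2)"
    using measurable_F_imp_M[OF adapted_grid_measurable[OF x order_refl, of i]]
    by (intro integrable_const_bound[of _ "K\<^sup>2"]) auto
qed

lemma grid_isometry_nn:
  assumes x: "adapted_grid p x"
  shows "(\<integral>\<^sup>+\<omega>. ennreal ((\<Sum>i<n. x i \<omega> * (B (p (Suc i)) \<omega> - B (p i) \<omega>))\<^sup>2) \<partial>M)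
    = (\<integral>\<^sup>+\<omega>. ennreal (\<Sum>i<n. (x i \<omega>)\<^sup>2 * (p (Suc i) - p i)) \<partial>M)"
proof -
  have "(\<Sum>i<n. (x i \<omega>)\<^sup>2 * (p (Suc i) - p i)) \<ge> 0" for \<omega>
    using adapted_grid_mono[OF x] by (intro sum_nonneg) simp
  then show ?thesis
    using grid_isometry[OF x, of n]
      nn_integral_eq_integral[OF grid_energy_integrable[OF x, of n]]
      nn_integral_eq_integral[OF conjunct1[OF grid_isometry[OF x, of n]]]
    by simp
qed

lemma simple_ito_isometry:
  assumes "simple_predictable M F H"
  shows "(\<integral>\<^sup>+\<omega>. ennreal ((simple_ito_sum B H \<omega>)\<^sup>2) \<partial>M)
    = (\<integral>\<^sup>+\<omega>. (\<integral>\<^sup>+s. ennreal ((simple_process H s \<omega>)\<^sup>2) \<partial>lborel) \<partial>M)"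
proof -
  obtain n p x where g: "adapted_grid p x"
    "\<And>s \<omega>. simple_process H s \<omega> = (\<Sum>i<n. x i \<omega> * indicator {p i<..p (Suc i)} s)"
    "\<And>\<omega>. simple_ito_sum B H \<omega> = (\<Sum>i<n. x i \<omega> * (B (p (Suc i)) \<omega> - B (p i) \<omega>))"
    by (rule simple_predictable_grid[OF assms], rule that, assumption+)
  have "mono p" using g(1) by (simp add: adapted_grid_def)
  from nn_integral_square_step[OF this] show ?thesis
    unfolding g(2,3) by (simp add: grid_isometry_nn[OF g(1)])
qed

text \<open>Coefficients are set to 0 from the moment when the accumulated energy would exceed \<open>\<delta>\<close>. The truncated
sum has second moment at most \<open>\<delta>\<close> by the isometry, so Chebyshev's inequality applies; it agrees with
the original sum wherever the total energy is at most \<open>\<delta>\<close>.\<close>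

lemma simple_ito_tail:
  assumes H: "simple_predictable M F H" and \<epsilon>: "\<epsilon> > 0" and \<delta>: "\<delta> \<ge> 0"
  shows "measure M {\<omega>\<in>space M. \<epsilon> < \<bar>simple_ito_sum B H \<omega>\<bar>}
    \<le> \<delta> / \<epsilon>\<^sup>2 + measure M {\<omega>\<in>space M. ennreal \<delta> < (\<integral>\<^sup>+s. ennreal ((simple_process H s \<omega>)\<^sup>2) \<partial>lborel)}"
proof -
  obtain n p x where g: "adapted_grid p x"
    "\<And>s \<omega>. simple_process H s \<omega> = (\<Sum>i<n. x i \<omega> * indicator {p i<..p (Suc i)} s)"
    "\<And>\<omega>. simple_ito_sum B H \<omega> = (\<Sum>i<n. x i \<omega> * (B (p (Suc i)) \<omega> - B (p i) \<omega>))"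
    by (rule simple_predictable_grid[OF H], rule that, assumption+)
  have "mono p" using g(1) by (simp add: adapted_grid_def)
  define Q where "Q j \<omega> = (\<Sum>i<j. (x i \<omega>)\<^sup>2 * (p (Suc i) - p i))" for j \<omega>
  have Qmono: "Q i \<omega> \<le> Q j \<omega>" if "i \<le> j" for i j \<omega>
    unfolding Q_def using that adapted_grid_mono[OF g(1)] by (intro sum_mono2) auto
  \<comment> \<open>\<open>Q (Suc i)\<close> includes the energy of the cell \<open>i\<close> itself, and is still measurable for its left endpoint;
    so the truncation is adapted and the truncated energy never exceeds \<open>\<delta>\<close>.\<close>
  define y where "y i \<omega> = (if Q (Suc i) \<omega> \<le> \<delta> then x i \<omega> else 0)" for i \<omega>
  have xm: "x i \<in> borel_measurable (F (p j))" if "i \<le> j" for i j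
    by (rule adapted_grid_measurable[OF g(1) that])
  have Qm: "Q (Suc i) \<in> borel_measurable (F (p i))" for i
    unfolding Q_def by (intro borel_measurable_sum borel_measurable_times borel_measurable_power xm) auto
  have y: "adapted_grid p y"
    unfolding adapted_grid_def
  proof (intro conjI allI \<open>mono p\<close>)
    fix i
    have [measurable]: "Q (Suc i) \<in> borel_measurable (F (p i))" "x i \<in> borel_measurable (F (p i))"
      using Qm xm by auto
    show "y i \<in> borel_measurable (F (p i))" unfolding y_def by measurable
    obtain C where "\<forall>\<omega>\<in>space M. \<bar>x i \<omega>\<bar> \<le> C" using g(1) unfolding adapted_grid_def by blast
    then show "\<exists>C. \<forall>\<omega>\<in>space M. \<bar>y i \<omega>\<bar> \<le> C"
      by (intro exI[of _ "max C 0"]) (auto simp: y_def le_max_iff_disj)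
  qed
  have yle: "(\<Sum>i<j. (y i \<omega>)\<^sup>2 * (p (Suc i) - p i)) \<le> \<delta>" for j \<omega>
  proof (induction j)
    case (Suc j)
    show ?case
    proof (cases "Q (Suc j) \<omega> \<le> \<delta>")
      case True
      then have "y i \<omega> = x i \<omega>" if "i \<le> j" for i
        unfolding y_def using Qmono[of "Suc i" "Suc j" \<omega>] that by simp
      then show ?thesis using True by (simp add: Q_def)
    next
      case False
      then show ?thesis using Suc by (simp add: y_def)
    qed
  qed (simp add: \<delta>)
  define S where "S \<omega> = (\<Sum>i<n. y i \<omega> * (B (p (Suc i)) \<omega> - B (p i) \<omega>))" for \<omega>
  have SM: "S \<in> borel_measurable M"
    unfolding S_def by (rule measurable_F_imp_M[OF grid_sum_measurable[OF y]])
  have QM: "Q j \<in> borel_measurable M" for j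
    unfolding Q_def by (intro borel_measurable_sum borel_measurable_times borel_measurable_power
        measurable_F_imp_M[OF xm[OF order_refl]]) auto
  note SM[measurable] QM[measurable]
  have en: "(\<integral>\<^sup>+s. ennreal ((simple_process H s \<omega>)\<^sup>2) \<partial>lborel) = ennreal (Q n \<omega>)" for \<omega>
    unfolding g(2) Q_def by (rule nn_integral_square_step[OF \<open>mono p\<close>])
  have Q0: "Q j \<omega> \<ge> 0" for j \<omega> unfolding Q_def using adapted_grid_mono[OF g(1)] by (intro sum_nonneg) auto
  have "expectation (\<lambda>\<omega>. (S \<omega>)\<^sup>2) \<le> expectation (\<lambda>\<omega>. \<delta>)"
    unfolding S_def conjunct2[OF grid_isometry[OF y]]
    by (rule integral_mono[OF grid_energy_integrable[OF y] _ yle]) simp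
  then have E: "expectation (\<lambda>\<omega>. (S \<omega>)\<^sup>2) \<le> \<delta>" by (simp add: prob_space)
  have iS: "integrable M (\<lambda>\<omega>. (S \<omega>)\<^sup>2)" unfolding S_def using grid_isometry[OF y] by blast
  have "measure M {\<omega>\<in>space M. \<epsilon> < \<bar>S \<omega>\<bar>} \<le> measure M {\<omega>\<in>space M. (S \<omega>)\<^sup>2 \<ge> \<epsilon>\<^sup>2}"
    using SM \<epsilon> by (intro finite_measure_mono) (auto simp: abs_le_square_iff[symmetric])
  also have "\<dots> \<le> expectation (\<lambda>\<omega>. (S \<omega>)\<^sup>2) / \<epsilon>\<^sup>2"
    using \<epsilon> by (intro integral_Markov_inequality_measure[where A="{}"] iS) auto
  also have "\<dots> \<le> \<delta> / \<epsilon>\<^sup>2" using E by (intro divide_right_mono) auto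
  finally have S: "measure M {\<omega>\<in>space M. \<epsilon> < \<bar>S \<omega>\<bar>} \<le> \<delta> / \<epsilon>\<^sup>2" .
  have "simple_ito_sum B H \<omega> = S \<omega>" if "Q n \<omega> \<le> \<delta>" for \<omega>
    unfolding g(3) S_def y_def using that by (intro sum.cong refl) (use order_trans[OF Qmono that] in auto)
  then have "{\<omega>\<in>space M. \<epsilon> < \<bar>simple_ito_sum B H \<omega>\<bar>} \<subseteq> {\<omega>\<in>space M. \<epsilon> < \<bar>S \<omega>\<bar>} \<union> {\<omega>\<in>space M. \<delta> < Q n \<omega>}"
    by force
  then have "measure M {\<omega>\<in>space M. \<epsilon> < \<bar>simple_ito_sum B H \<omega>\<bar>}
      \<le> measure M ({\<omega>\<in>space M. \<epsilon> < \<bar>S \<omega>\<bar>} \<union> {\<omega>\<in>space M. \<delta> < Q n \<omega>})"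
    by (intro finite_measure_mono) measurable
  also have "\<dots> \<le> measure M {\<omega>\<in>space M. \<epsilon> < \<bar>S \<omega>\<bar>} + measure M {\<omega>\<in>space M. \<delta> < Q n \<omega>}"
    by (intro measure_Un_le) measurable
  finally show ?thesis
    using S \<delta> Q0 by (simp add: en ennreal_less_iff)
qed

end

section \<open>Linear operations on simple integrands\<close>

definition scale_simple ::
  "real \<Rightarrow> (real \<times> real \<times> ('a \<Rightarrow> real)) list \<Rightarrow> (real \<times> real \<times> ('a \<Rightarrow> real)) list" where
  "scale_simple c H = map (\<lambda>(a, b, \<xi>). (a, b, \<lambda>\<omega>. c * \<xi> \<omega>)) H"

lemma simple_process_append: "simple_process (H @ G) s \<omega> = simple_process H s \<omega> + simple_process G s \<omega>"
  by (simp add: simple_process_def)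

lemma simple_ito_sum_append: "simple_ito_sum B (H @ G) \<omega> = simple_ito_sum B H \<omega> + simple_ito_sum B G \<omega>"
  by (simp add: simple_ito_sum_def)

lemma simple_process_scale: "simple_process (scale_simple c H) s \<omega> = c * simple_process H s \<omega>"
  by (induction H) (auto simp: simple_process_def scale_simple_def algebra_simps)

lemma simple_ito_sum_scale: "simple_ito_sum B (scale_simple c H) \<omega> = c * simple_ito_sum B H \<omega>"
  by (induction H) (auto simp: simple_ito_sum_def scale_simple_def algebra_simps)

lemma simple_predictable_append:
  "simple_predictable M F H \<Longrightarrow> simple_predictable M F G \<Longrightarrow> simple_predictable M F (H @ G)"
  by (auto simp: simple_predictable_def)

lemma simple_predictable_scale:
  assumes "simple_predictable M F H"
  shows "simple_predictable M F (scale_simple c H)"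
  unfolding simple_predictable_def
proof safe
  fix a b \<xi>'
  assume "(a, b, \<xi>') \<in> set (scale_simple c H)"
  then obtain \<xi> where \<xi>: "(a, b, \<xi>) \<in> set H" "\<xi>' = (\<lambda>\<omega>. c * \<xi> \<omega>)"
    by (auto simp: scale_simple_def)
  with assms have *: "a \<le> b" "\<xi> \<in> borel_measurable (F a)" and "\<exists>C. \<forall>\<omega>\<in>space M. \<bar>\<xi> \<omega>\<bar> \<le> C"
    by (auto simp: simple_predictable_def)
  then obtain C where "\<forall>\<omega>\<in>space M. \<bar>\<xi> \<omega>\<bar> \<le> C" by blast
  then show "\<exists>C. \<forall>\<omega>\<in>space M. \<bar>\<xi>' \<omega>\<bar> \<le> C"
    by (intro exI[of _ "\<bar>c\<bar> * C"]) (auto simp: \<xi> abs_mult intro!: mult_left_mono)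
  show "a \<le> b" "\<xi>' \<in> borel_measurable (F a)" using * by (auto simp: \<xi>)
qed

lemma square_diff_triangle: "((a::real) - c)\<^sup>2 \<le> 2 * ((a - b)\<^sup>2 + (b - c)\<^sup>2)"
proof -
  have "0 \<le> ((a - b) - (b - c))\<^sup>2" by simp
  then show ?thesis by (simp add: power2_eq_square algebra_simps)
qed

lemma square_add_le: "((a::real) + b)\<^sup>2 \<le> 2 * (a\<^sup>2 + b\<^sup>2)"
  using square_diff_triangle[of a "-b" 0] by simp

lemma nn_integral_square_triangle:
  fixes f g h :: "'b \<Rightarrow> real"
  assumes [measurable]: "(\<lambda>x. f x - g x) \<in> borel_measurable N" "(\<lambda>x. g x - h x) \<in> borel_measurable N"
  shows "(\<integral>\<^sup>+x. ennreal ((f x - h x)\<^sup>2) \<partial>N)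
    \<le> 2 * ((\<integral>\<^sup>+x. ennreal ((f x - g x)\<^sup>2) \<partial>N) + (\<integral>\<^sup>+x. ennreal ((g x - h x)\<^sup>2) \<partial>N))"
proof -
  have "(\<integral>\<^sup>+x. ennreal ((f x - h x)\<^sup>2) \<partial>N)
      \<le> (\<integral>\<^sup>+x. 2 * (ennreal ((f x - g x)\<^sup>2) + ennreal ((g x - h x)\<^sup>2)) \<partial>N)"
  proof (rule nn_integral_mono)
    fix x
    have "ennreal ((f x - h x)\<^sup>2) \<le> ennreal (2 * ((f x - g x)\<^sup>2 + (g x - h x)\<^sup>2))"
      by (intro ennreal_leI square_diff_triangle)
    also have "\<dots> = 2 * (ennreal ((f x - g x)\<^sup>2) + ennreal ((g x - h x)\<^sup>2))"
      by (subst ennreal_mult) auto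
    finally show "ennreal ((f x - h x)\<^sup>2) \<le> 2 * (ennreal ((f x - g x)\<^sup>2) + ennreal ((g x - h x)\<^sup>2))" .
  qed
  also have "\<dots> = 2 * ((\<integral>\<^sup>+x. ennreal ((f x - g x)\<^sup>2) \<partial>N) + (\<integral>\<^sup>+x. ennreal ((g x - h x)\<^sup>2) \<partial>N))"
    by (subst nn_integral_cmult, simp, subst nn_integral_add) auto
  finally show ?thesis .
qed

section \<open>Convergence to zero in probability\<close>

context prob_space
begin

definition vanishes_in_prob :: "(nat \<Rightarrow> 'a \<Rightarrow> ennreal) \<Rightarrow> bool" where
  "vanishes_in_prob f \<longleftrightarrow> (\<forall>n. f n \<in> borel_measurable M) \<and>
     (\<forall>\<epsilon>>0. (\<lambda>n. prob {\<omega>\<in>space M. ennreal \<epsilon> < f n \<omega>}) \<longlonglongrightarrow> 0)"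

lemma vanishes_in_probD:
  "vanishes_in_prob f \<Longrightarrow> \<epsilon> > 0 \<Longrightarrow> (\<lambda>n. prob {\<omega>\<in>space M. ennreal \<epsilon> < f n \<omega>}) \<longlonglongrightarrow> 0"
  by (simp add: vanishes_in_prob_def)

lemma vanishes_in_prob_le:
  assumes f: "vanishes_in_prob f" and g: "vanishes_in_prob g" and c: "c > 0"
    and h: "\<And>n. h n \<in> borel_measurable M"
    and le: "\<And>n \<omega>. \<omega> \<in> space M \<Longrightarrow> h n \<omega> \<le> ennreal c * (f n \<omega> + g n \<omega>)"
  shows "vanishes_in_prob h"
  unfolding vanishes_in_prob_def
proof (intro conjI allI impI h)
  fix \<epsilon> :: real assume \<epsilon>: "\<epsilon> > 0"
  define d where "d = \<epsilon> / (2 * c)"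
  have d: "d > 0" using \<epsilon> c by (simp add: d_def)
  have [measurable]: "f n \<in> borel_measurable M" "g n \<in> borel_measurable M" for n
    using f g by (auto simp: vanishes_in_prob_def)
  note h[measurable]
  have sub: "{\<omega>\<in>space M. ennreal \<epsilon> < h n \<omega>}
      \<subseteq> {\<omega>\<in>space M. ennreal d < f n \<omega>} \<union> {\<omega>\<in>space M. ennreal d < g n \<omega>}" for n
  proof (safe, rule ccontr)
    fix \<omega> assume \<omega>: "\<omega> \<in> space M" "ennreal \<epsilon> < h n \<omega>" "\<not> ennreal d < g n \<omega>" "\<not> ennreal d < f n \<omega>"
    have "h n \<omega> \<le> ennreal c * (f n \<omega> + g n \<omega>)" by (rule le) fact
    also have "\<dots> \<le> ennreal c * (ennreal d + ennreal d)"
      using \<omega> by (intro mult_left_mono add_mono) auto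
    also have "\<dots> = ennreal \<epsilon>"
      using c d by (simp add: ennreal_plus[symmetric] ennreal_mult[symmetric] d_def del: ennreal_plus)
    finally show False using \<omega> by simp
  qed
  have bound: "prob {\<omega>\<in>space M. ennreal \<epsilon> < h n \<omega>}
      \<le> prob {\<omega>\<in>space M. ennreal d < f n \<omega>} + prob {\<omega>\<in>space M. ennreal d < g n \<omega>}" for n
  proof -
    have "prob {\<omega>\<in>space M. ennreal \<epsilon> < h n \<omega>}
        \<le> prob ({\<omega>\<in>space M. ennreal d < f n \<omega>} \<union> {\<omega>\<in>space M. ennreal d < g n \<omega>})"
      by (intro finite_measure_mono sub) measurable
    also have "\<dots> \<le> prob {\<omega>\<in>space M. ennreal d < f n \<omega>} + prob {\<omega>\<in>space M. ennreal d < g n \<omega>}"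
      by (intro measure_Un_le) measurable
    finally show ?thesis .
  qed
  show "(\<lambda>n. prob {\<omega>\<in>space M. ennreal \<epsilon> < h n \<omega>}) \<longlonglongrightarrow> 0"
  proof (rule tendsto_sandwich[OF _ _ tendsto_const])
    show "(\<lambda>n. prob {\<omega>\<in>space M. ennreal d < f n \<omega>} + prob {\<omega>\<in>space M. ennreal d < g n \<omega>}) \<longlonglongrightarrow> 0"
      using tendsto_add[OF vanishes_in_probD[OF f d] vanishes_in_probD[OF g d]] by simp
  qed (use bound in auto)
qed

lemma vanishes_in_prob_L1:
  assumes [measurable]: "\<And>n. f n \<in> borel_measurable M"
    and lim: "(\<lambda>n. \<integral>\<^sup>+\<omega>. f n \<omega> \<partial>M) \<longlonglongrightarrow> 0"
  shows "vanishes_in_prob f"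
  unfolding vanishes_in_prob_def
proof (intro conjI allI impI)
  fix \<epsilon> :: real assume \<epsilon>: "\<epsilon> > 0"
  have bound: "emeasure M {\<omega>\<in>space M. ennreal \<epsilon> < f n \<omega>} \<le> ennreal (1 / \<epsilon>) * (\<integral>\<^sup>+\<omega>. f n \<omega> \<partial>M)" for n
  proof -
    have "emeasure M {\<omega>\<in>space M. ennreal \<epsilon> < f n \<omega>} \<le> emeasure M {\<omega>\<in>space M. 1 \<le> ennreal (1 / \<epsilon>) * f n \<omega>}"
    proof (intro emeasure_mono subsetI, safe)
      fix \<omega> assume "ennreal \<epsilon> < f n \<omega>"
      then have "ennreal (1 / \<epsilon>) * ennreal \<epsilon> \<le> ennreal (1 / \<epsilon>) * f n \<omega>" by (intro mult_left_mono) auto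
      then show "1 \<le> ennreal (1 / \<epsilon>) * f n \<omega>"
        using \<epsilon> by (simp add: ennreal_mult[symmetric])
    qed measurable
    also have "\<dots> = emeasure M ({\<omega>\<in>space M. 1 \<le> ennreal (1 / \<epsilon>) * f n \<omega>} \<inter> space M)"
      by (intro arg_cong[where f="emeasure M"]) auto
    also have "\<dots> \<le> ennreal (1 / \<epsilon>) * (\<integral>\<^sup>+\<omega>. f n \<omega> * indicator (space M) \<omega> \<partial>M)"
      using nn_integral_Markov_inequality[where u="f n" and A="space M" and c="ennreal (1 / \<epsilon>)" and M=M]
      by (simp add: Int_def conj_commute)
    also have "(\<integral>\<^sup>+\<omega>. f n \<omega> * indicator (space M) \<omega> \<partial>M) = (\<integral>\<^sup>+\<omega>. f n \<omega> \<partial>M)"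
      by (intro nn_integral_cong) simp
    finally show ?thesis .
  qed
  have "(\<lambda>n. ennreal (1 / \<epsilon>) * (\<integral>\<^sup>+\<omega>. f n \<omega> \<partial>M)) \<longlonglongrightarrow> ennreal (1 / \<epsilon>) * 0"
    by (intro ennreal_tendsto_cmult lim) simp
  then have bound0: "(\<lambda>n. ennreal (1 / \<epsilon>) * (\<integral>\<^sup>+\<omega>. f n \<omega> \<partial>M)) \<longlonglongrightarrow> 0" by simp
  have "(\<lambda>n. emeasure M {\<omega>\<in>space M. ennreal \<epsilon> < f n \<omega>}) \<longlonglongrightarrow> 0"
    by (rule tendsto_sandwich[OF _ _ tendsto_const bound0]) (use bound in auto)
  then have "(\<lambda>n. ennreal (prob {\<omega>\<in>space M. ennreal \<epsilon> < f n \<omega>})) \<longlonglongrightarrow> ennreal 0"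
    by (simp add: emeasure_eq_measure)
  then show "(\<lambda>n. prob {\<omega>\<in>space M. ennreal \<epsilon> < f n \<omega>}) \<longlonglongrightarrow> 0"
    by (rule tendsto_ennrealD) auto
qed measurable

text \<open>Applied to the distance of two limits, this turns uniqueness of limits in probability into an almost
sure statement.\<close>

lemma vanishes_in_prob_const:
  assumes "vanishes_in_prob (\<lambda>_. f)"
  shows "AE \<omega> in M. f \<omega> = 0"
proof -
  have [measurable]: "f \<in> borel_measurable M" using assms by (simp add: vanishes_in_prob_def)
  have "AE \<omega> in M. \<not> ennreal (1 / Suc k) < f \<omega>" for k
  proof (rule AE_I')
    have "prob {\<omega>\<in>space M. ennreal (1 / Suc k) < f \<omega>} = 0"
      using vanishes_in_probD[OF assms, of "1 / Suc k"] by (simp add: LIMSEQ_const_iff)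
    then show "{\<omega>\<in>space M. ennreal (1 / Suc k) < f \<omega>} \<in> null_sets M"
      by (auto simp: null_sets_def emeasure_eq_measure)
  qed auto
  then have "AE \<omega> in M. \<forall>k. \<not> ennreal (1 / Suc k) < f \<omega>" by (simp add: AE_all_countable)
  then show ?thesis
  proof eventually_elim
    case (elim \<omega>)
    have "(\<lambda>k. ennreal (1 / Suc k)) \<longlonglongrightarrow> ennreal 0"
      by (intro tendsto_ennrealI LIMSEQ_Suc[OF lim_const_over_n]) 
    then have "f \<omega> \<le> ennreal 0"
      using elim by (intro LIMSEQ_le_const) (auto simp: not_less)
    then show ?case by simp
  qed
qed

end

section \<open>Predictable processes and uniqueness of the integral\<close>

context two_sided_brownian_motion
begin

sublocale pair: pair_sigma_finite lborel M ..

abbreviation Pred where "Pred \<equiv> predictable_sigma M F"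

lemma space_Pred: "space Pred = UNIV \<times> space M"
  and sets_Pred: "sets Pred = sigma_sets (UNIV \<times> space M)
    {{a<..b} \<times> A | a b A. a \<le> b \<and> A \<in> sets (F a)}"
proof -
  have "{{a<..b} \<times> A | a b A. a \<le> b \<and> A \<in> sets (F a)} \<subseteq> Pow (UNIV \<times> space M)"
    using sets_F_subset sets.sets_into_space[of _ M] by blast
  then show "space Pred = UNIV \<times> space M" "sets Pred = sigma_sets (UNIV \<times> space M)
    {{a<..b} \<times> A | a b A. a \<le> b \<and> A \<in> sets (F a)}"
    by (auto simp: predictable_sigma_def space_measure_of sets_measure_of)
qed

lemma rectangle_Pred: "A \<in> sets (F a) \<Longrightarrow> {a<..b} \<times> A \<in> sets Pred"
  by (cases "a \<le> b") (auto simp: sets_Pred)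

lemma sets_Pred_subset: "sets Pred \<subseteq> sets (lborel \<Otimes>\<^sub>M M)"
proof -
  have "{{a<..b} \<times> A | a b A. a \<le> b \<and> A \<in> sets (F a)} \<subseteq> sets (lborel \<Otimes>\<^sub>M M)"
    using subsetD[OF sets_F_subset] by (auto simp del: sets_pair_measure_cong intro!: pair_measureI)
  from sets.sigma_sets_subset[OF this] show ?thesis
    by (simp add: sets_Pred space_pair_measure)
qed

lemma Pred_measurable_pair: "f \<in> borel_measurable Pred \<Longrightarrow> f \<in> borel_measurable (lborel \<Otimes>\<^sub>M M)"
  using measurable_mono[OF order_refl refl sets_Pred_subset] by (auto simp: space_Pred space_pair_measure)

lemma simple_process_Pred:
  assumes "simple_predictable M F H"
  shows "(\<lambda>(s, \<omega>). simple_process H s \<omega>) \<in> borel_measurable Pred"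
proof -
  have 1: "(\<lambda>(s, \<omega>). \<xi> \<omega> * indicator {a<..b} s) \<in> borel_measurable Pred"
    if "a \<le> b" "\<xi> \<in> borel_measurable (F a)" for a b and \<xi> :: "'a \<Rightarrow> real"
    unfolding borel_measurable_iff_greater
  proof
    fix c :: real
    show "{w \<in> space Pred. c < (case w of (s, \<omega>) \<Rightarrow> \<xi> \<omega> * indicator {a<..b} s)} \<in> sets Pred"
    proof (cases "c < 0")
      case True
      have "{\<omega> \<in> space (F a). \<xi> \<omega> \<le> c} \<in> sets (F a)" using that by measurable
      then have "space Pred - {a<..b} \<times> {\<omega> \<in> space M. \<xi> \<omega> \<le> c} \<in> sets Pred"
        by (intro sets.compl_sets rectangle_Pred) (simp add: space_F)
      also have "space Pred - {a<..b} \<times> {\<omega> \<in> space M. \<xi> \<omega> \<le> c}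
        = {w \<in> space Pred. c < (case w of (s, \<omega>) \<Rightarrow> \<xi> \<omega> * indicator {a<..b} s)}"
        using True by (auto simp: space_Pred not_le split: split_indicator split_indicator_asm)
      finally show ?thesis .
    next
      case False
      have "{\<omega> \<in> space (F a). c < \<xi> \<omega>} \<in> sets (F a)" using that by measurable
      then have "{a<..b} \<times> {\<omega> \<in> space M. c < \<xi> \<omega>} \<in> sets Pred"
        by (intro rectangle_Pred) (simp add: space_F)
      also have "{a<..b} \<times> {\<omega> \<in> space M. c < \<xi> \<omega>}
        = {w \<in> space Pred. c < (case w of (s, \<omega>) \<Rightarrow> \<xi> \<omega> * indicator {a<..b} s)}"
        using False by (auto simp: space_Pred split: split_indicator split_indicator_asm)
      finally show ?thesis .
    qed
  qed
  have "(\<lambda>(s, \<omega>). \<Sum>(a, b, \<xi>)\<leftarrow>G. \<xi> \<omega> * indicator {a<..b} s) \<in> borel_measurable Pred"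
    if "set G \<subseteq> set H" for G
    using that
  proof (induction G)
    case (Cons h G)
    obtain a b \<xi> where h: "h = (a, b, \<xi>)" by (cases h)
    have "a \<le> b" "\<xi> \<in> borel_measurable (F a)" using assms Cons.prems by (auto simp: simple_predictable_def h)
    from borel_measurable_add[OF 1[OF this] Cons.IH] Cons.prems show ?case
      by (simp add: h case_prod_unfold)
  qed (simp add: case_prod_unfold)
  from this[of H] show ?thesis by (simp add: simple_process_def)
qed

lemma nn_integral_time_measurable:
  assumes "f \<in> borel_measurable (lborel \<Otimes>\<^sub>M M)"
  shows "(\<lambda>\<omega>. \<integral>\<^sup>+s. f (s, \<omega>) \<partial>lborel) \<in> borel_measurable M"
  using lborel.borel_measurable_nn_integral_fst[OF measurable_pair_swap[OF assms]] by simp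

lemma square_distance_measurable:
  assumes "predictable_process M F \<phi>" "simple_predictable M F H"
  shows "(\<lambda>(s, \<omega>). simple_process H s \<omega> - \<phi> s \<omega>) \<in> borel_measurable (lborel \<Otimes>\<^sub>M M)"
    "(\<lambda>\<omega>. \<integral>\<^sup>+s. ennreal ((simple_process H s \<omega> - \<phi> s \<omega>)\<^sup>2) \<partial>lborel) \<in> borel_measurable M"
proof -
  show 1: "(\<lambda>(s, \<omega>). simple_process H s \<omega> - \<phi> s \<omega>) \<in> borel_measurable (lborel \<Otimes>\<^sub>M M)"
    using borel_measurable_diff[OF Pred_measurable_pair[OF simple_process_Pred[OF assms(2)]]
      Pred_measurable_pair[OF assms(1)[unfolded predictable_process_def]]]
    by (simp add: case_prod_unfold)
  have [measurable]: "(\<lambda>x. simple_process H (fst x) (snd x) - \<phi> (fst x) (snd x)) \<in> borel_measurable (lborel \<Otimes>\<^sub>M M)"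
    using 1 by (simp add: case_prod_unfold)
  have "(\<lambda>x. ennreal ((simple_process H (fst x) (snd x) - \<phi> (fst x) (snd x))\<^sup>2))
      \<in> borel_measurable (lborel \<Otimes>\<^sub>M M)" by measurable
  from nn_integral_time_measurable[OF this]
  show "(\<lambda>\<omega>. \<integral>\<^sup>+s. ennreal ((simple_process H s \<omega> - \<phi> s \<omega>)\<^sup>2) \<partial>lborel) \<in> borel_measurable M"
    by simp
qed

text \<open>The measurability that is part of \<^const>\<open>vanishes_in_prob\<close> holds automatically here: the squared distance
is jointly measurable because predictable processes are.\<close>

lemma has_ito_integral_iff:
  "has_ito_integral M F B \<phi> I \<longleftrightarrow>
     predictable_process M F \<phi> \<and>
     (AE \<omega> in M. (\<integral>\<^sup>+s. ennreal ((\<phi> s \<omega>)\<^sup>2) \<partial>lborel) < \<infinity>) \<and>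
     I \<in> borel_measurable M \<and>
     (\<exists>H. (\<forall>n. simple_predictable M F (H n)) \<and>
       vanishes_in_prob (\<lambda>n \<omega>. \<integral>\<^sup>+s. ennreal ((simple_process (H n) s \<omega> - \<phi> s \<omega>)\<^sup>2) \<partial>lborel) \<and>
       vanishes_in_prob (\<lambda>n \<omega>. ennreal \<bar>simple_ito_sum B (H n) \<omega> - I \<omega>\<bar>))"
proof (cases "predictable_process M F \<phi> \<and> I \<in> borel_measurable M")
  case True
  then have [measurable]: "I \<in> borel_measurable M" by simp
  have "(\<forall>n. simple_predictable M F (H n)) \<Longrightarrow> (\<forall>\<epsilon>>0. (\<lambda>n. measure M {\<omega>\<in>space M.
          ennreal \<epsilon> < (\<integral>\<^sup>+s. ennreal ((simple_process (H n) s \<omega> - \<phi> s \<omega>)\<^sup>2) \<partial>lborel)})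
          \<longlonglongrightarrow> 0) \<longleftrightarrow>
        vanishes_in_prob (\<lambda>n \<omega>. \<integral>\<^sup>+s. ennreal ((simple_process (H n) s \<omega> - \<phi> s \<omega>)\<^sup>2) \<partial>lborel)"
    for H :: "nat \<Rightarrow> (real \<times> real \<times> ('a \<Rightarrow> real)) list"
    unfolding vanishes_in_prob_def using square_distance_measurable(2) True by auto
  moreover have "(\<forall>n. simple_predictable M F (H n)) \<Longrightarrow>
        (\<forall>\<epsilon>>0. (\<lambda>n. measure M {\<omega>\<in>space M. \<epsilon> < \<bar>simple_ito_sum B (H n) \<omega> - I \<omega>\<bar>}) \<longlonglongrightarrow> 0) \<longleftrightarrow>
        vanishes_in_prob (\<lambda>n \<omega>. ennreal \<bar>simple_ito_sum B (H n) \<omega> - I \<omega>\<bar>)"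
    for H :: "nat \<Rightarrow> (real \<times> real \<times> ('a \<Rightarrow> real)) list"
  proof -
    assume "\<forall>n. simple_predictable M F (H n)"
    then have [measurable]: "simple_ito_sum B (H n) \<in> borel_measurable M" for n
      using simple_ito_sum_measurable by blast
    have "\<epsilon> < \<bar>x\<bar> \<longleftrightarrow> ennreal \<epsilon> < ennreal \<bar>x\<bar>" if "\<epsilon> > 0" for \<epsilon> x :: real
      using that by (simp add: ennreal_less_iff)
    then show ?thesis unfolding vanishes_in_prob_def by (auto cong: conj_cong)
  qed
  ultimately show ?thesis using True unfolding has_ito_integral_def by (auto cong: conj_cong)
qed (auto simp: has_ito_integral_def)

text \<open>Continuity of the integral in probability: in \<open>simple_ito_tail\<close> the bound \<open>\<delta>\<close> on the energy can be chosen
small compared with \<open>\<epsilon>\<^sup>2\<close>, and the energy exceeds it with vanishing probability.\<close>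

lemma vanishes_simple_ito:
  assumes H: "\<And>n. simple_predictable M F (H n)"
    and v: "vanishes_in_prob (\<lambda>n \<omega>. \<integral>\<^sup>+s. ennreal ((simple_process (H n) s \<omega>)\<^sup>2) \<partial>lborel)"
  shows "vanishes_in_prob (\<lambda>n \<omega>. ennreal \<bar>simple_ito_sum B (H n) \<omega>\<bar>)"
  unfolding vanishes_in_prob_def
proof (intro conjI allI impI)
  fix n
  have [measurable]: "simple_ito_sum B (H n) \<in> borel_measurable M"
    by (rule simple_ito_sum_measurable[OF H])
  show "(\<lambda>\<omega>. ennreal \<bar>simple_ito_sum B (H n) \<omega>\<bar>) \<in> borel_measurable M" by measurable
next
  fix \<epsilon> :: real assume \<epsilon>: "\<epsilon> > 0"
  show "(\<lambda>n. prob {\<omega>\<in>space M. ennreal \<epsilon> < ennreal \<bar>simple_ito_sum B (H n) \<omega>\<bar>}) \<longlonglongrightarrow> 0"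
  proof (rule LIMSEQ_I)
    fix r :: real assume r: "r > 0"
    define \<delta> where "\<delta> = r * \<epsilon>\<^sup>2 / 2"
    have \<delta>: "\<delta> > 0" using r \<epsilon> by (simp add: \<delta>_def)
    let ?Q = "\<lambda>n. prob {\<omega>\<in>space M. ennreal \<delta> < (\<integral>\<^sup>+s. ennreal ((simple_process (H n) s \<omega>)\<^sup>2) \<partial>lborel)}"
    obtain N where N: "\<And>n. n \<ge> N \<Longrightarrow> ?Q n < r / 2"
      using LIMSEQ_D[OF vanishes_in_probD[OF v \<delta>], of "r / 2"] r by auto
    have "prob {\<omega>\<in>space M. ennreal \<epsilon> < ennreal \<bar>simple_ito_sum B (H n) \<omega>\<bar>} < r" if "n \<ge> N" for n
      using simple_ito_tail[OF H \<epsilon>, of \<delta> n] N[OF that] \<delta> \<epsilon> r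
      by (simp add: ennreal_less_iff \<delta>_def)
    then show "\<exists>N. \<forall>n\<ge>N. norm (prob {\<omega>\<in>space M. ennreal \<epsilon> < ennreal \<bar>simple_ito_sum B (H n) \<omega>\<bar>} - 0) < r"
      by auto
  qed
qed

lemma has_ito_integral_diff:
  assumes "has_ito_integral M F B \<phi> I" "has_ito_integral M F B \<psi> J"
  shows "has_ito_integral M F B (\<lambda>s \<omega>. \<phi> s \<omega> - \<psi> s \<omega>) (\<lambda>\<omega>. I \<omega> - J \<omega>)"
proof -
  obtain H where \<phi>: "predictable_process M F \<phi>" "AE \<omega> in M. (\<integral>\<^sup>+s. ennreal ((\<phi> s \<omega>)\<^sup>2) \<partial>lborel) < \<infinity>"
    "I \<in> borel_measurable M" and H: "\<And>n. simple_predictable M F (H n)"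
       "vanishes_in_prob (\<lambda>n \<omega>. \<integral>\<^sup>+s. ennreal ((simple_process (H n) s \<omega> - \<phi> s \<omega>)\<^sup>2) \<partial>lborel)"
       "vanishes_in_prob (\<lambda>n \<omega>. ennreal \<bar>simple_ito_sum B (H n) \<omega> - I \<omega>\<bar>)"
    using assms(1) unfolding has_ito_integral_iff by blast
  obtain G where \<psi>: "predictable_process M F \<psi>" "AE \<omega> in M. (\<integral>\<^sup>+s. ennreal ((\<psi> s \<omega>)\<^sup>2) \<partial>lborel) < \<infinity>"
    "J \<in> borel_measurable M" and G: "\<And>n. simple_predictable M F (G n)"
       "vanishes_in_prob (\<lambda>n \<omega>. \<integral>\<^sup>+s. ennreal ((simple_process (G n) s \<omega> - \<psi> s \<omega>)\<^sup>2) \<partial>lborel)"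
       "vanishes_in_prob (\<lambda>n \<omega>. ennreal \<bar>simple_ito_sum B (G n) \<omega> - J \<omega>\<bar>)"
    using assms(2) unfolding has_ito_integral_iff by blast
  define K where "K n = H n @ scale_simple (- 1) (G n)" for n
  have K: "simple_predictable M F (K n)" for n
    unfolding K_def by (intro simple_predictable_append simple_predictable_scale H(1) G(1))
  have pp: "predictable_process M F (\<lambda>s \<omega>. \<phi> s \<omega> - \<psi> s \<omega>)"
    using \<phi>(1) \<psi>(1) unfolding predictable_process_def case_prod_unfold
    by (rule borel_measurable_diff)
  note [measurable] = \<phi>(3) \<psi>(3) simple_ito_sum_measurable[OF K] simple_ito_sum_measurable[OF H(1)]
    simple_ito_sum_measurable[OF G(1)]
  have meas_s: "(\<lambda>s. f s \<omega>) \<in> borel_measurable lborel" if "(\<lambda>(s, \<omega>). f s \<omega>) \<in> borel_measurable (lborel \<Otimes>\<^sub>M M)"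
    "\<omega> \<in> space M" for f :: "real \<Rightarrow> 'a \<Rightarrow> real" and \<omega>
    using measurable_Pair1[OF that] by simp
  have pmeas: "(\<lambda>s. \<phi> s \<omega>) \<in> borel_measurable lborel" "(\<lambda>s. \<psi> s \<omega>) \<in> borel_measurable lborel"
    if "\<omega> \<in> space M" for \<omega>
    using meas_s[OF Pred_measurable_pair[OF \<phi>(1)[unfolded predictable_process_def]] that]
      meas_s[OF Pred_measurable_pair[OF \<psi>(1)[unfolded predictable_process_def]] that] by simp_all
  have AE: "AE \<omega> in M. (\<integral>\<^sup>+s. ennreal ((\<phi> s \<omega> - \<psi> s \<omega>)\<^sup>2) \<partial>lborel) < \<infinity>"
    using \<phi>(2) \<psi>(2) AE_space
  proof eventually_elim
    case (elim \<omega>)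
    note [measurable] = pmeas[OF elim(3)]
    have "(\<integral>\<^sup>+s. ennreal ((\<phi> s \<omega> - \<psi> s \<omega>)\<^sup>2) \<partial>lborel)
      \<le> 2 * ((\<integral>\<^sup>+s. ennreal ((\<phi> s \<omega> - 0)\<^sup>2) \<partial>lborel) + (\<integral>\<^sup>+s. ennreal ((0 - \<psi> s \<omega>)\<^sup>2) \<partial>lborel))"
      by (rule nn_integral_square_triangle) measurable
    also have "\<dots> < \<infinity>" using elim by (simp add: ennreal_mult_less_top)
    finally show ?case .
  qed
  have v1: "vanishes_in_prob (\<lambda>n \<omega>. \<integral>\<^sup>+s. ennreal ((simple_process (K n) s \<omega> - (\<phi> s \<omega> - \<psi> s \<omega>))\<^sup>2) \<partial>lborel)"
  proof (rule vanishes_in_prob_le[OF H(2) G(2), of 2])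
    fix n \<omega> assume \<omega>: "\<omega> \<in> space M"
    note [measurable] = pmeas[OF \<omega>] meas_s[OF Pred_measurable_pair[OF simple_process_Pred[OF H(1)]] \<omega>]
      meas_s[OF Pred_measurable_pair[OF simple_process_Pred[OF G(1)]] \<omega>]
    let ?h = "\<lambda>s. simple_process (H n) s \<omega> - \<phi> s \<omega>" and ?g = "\<lambda>s. simple_process (G n) s \<omega> - \<psi> s \<omega>"
    have "(\<integral>\<^sup>+s. ennreal ((?h s - ?g s)\<^sup>2) \<partial>lborel)
      \<le> 2 * ((\<integral>\<^sup>+s. ennreal ((?h s - 0)\<^sup>2) \<partial>lborel) + (\<integral>\<^sup>+s. ennreal ((0 - ?g s)\<^sup>2) \<partial>lborel))"
      by (rule nn_integral_square_triangle) measurable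
    moreover have "simple_process (K n) s \<omega> - (\<phi> s \<omega> - \<psi> s \<omega>) = ?h s - ?g s" for s
      by (simp add: K_def simple_process_append simple_process_scale)
    moreover have "(0 - ?g s)\<^sup>2 = (?g s)\<^sup>2" for s by (simp add: power2_commute)
    ultimately show "(\<integral>\<^sup>+s. ennreal ((simple_process (K n) s \<omega> - (\<phi> s \<omega> - \<psi> s \<omega>))\<^sup>2) \<partial>lborel)
      \<le> ennreal 2 * ((\<integral>\<^sup>+s. ennreal ((?h s)\<^sup>2) \<partial>lborel) + (\<integral>\<^sup>+s. ennreal ((?g s)\<^sup>2) \<partial>lborel))"
      by (simp only: diff_zero ennreal_numeral)
  qed (use square_distance_measurable(2)[OF pp K] in auto)
  have v2: "vanishes_in_prob (\<lambda>n \<omega>. ennreal \<bar>simple_ito_sum B (K n) \<omega> - (I \<omega> - J \<omega>)\<bar>)"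
  proof (rule vanishes_in_prob_le[OF H(3) G(3), of 1])
    fix n \<omega>
    show "ennreal \<bar>simple_ito_sum B (K n) \<omega> - (I \<omega> - J \<omega>)\<bar>
      \<le> ennreal 1 * (ennreal \<bar>simple_ito_sum B (H n) \<omega> - I \<omega>\<bar> + ennreal \<bar>simple_ito_sum B (G n) \<omega> - J \<omega>\<bar>)"
      by (auto simp: K_def simple_ito_sum_append simple_ito_sum_scale ennreal_plus[symmetric]
          simp del: ennreal_plus intro!: ennreal_leI)
  qed auto
  show ?thesis
    unfolding has_ito_integral_iff
    by (intro conjI exI[of _ K] allI pp AE K v1 v2) measurable
qed

lemma has_ito_integral_zero_unique:
  assumes "has_ito_integral M F B (\<lambda>s \<omega>. 0) I"
  shows "AE \<omega> in M. I \<omega> = 0"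
proof -
  obtain H where I: "I \<in> borel_measurable M" and H: "\<And>n. simple_predictable M F (H n)"
       "vanishes_in_prob (\<lambda>n \<omega>. \<integral>\<^sup>+s. ennreal ((simple_process (H n) s \<omega> - 0)\<^sup>2) \<partial>lborel)"
       "vanishes_in_prob (\<lambda>n \<omega>. ennreal \<bar>simple_ito_sum B (H n) \<omega> - I \<omega>\<bar>)"
    using assms unfolding has_ito_integral_iff by blast
  have "vanishes_in_prob (\<lambda>n \<omega>. ennreal \<bar>simple_ito_sum B (H n) \<omega>\<bar>)"
    by (rule vanishes_simple_ito[OF H(1)]) (use H(2) in simp)
  from vanishes_in_prob_le[OF this H(3), of 1 "\<lambda>_ \<omega>. ennreal \<bar>I \<omega>\<bar>"]
  have "vanishes_in_prob (\<lambda>_ \<omega>. ennreal \<bar>I \<omega>\<bar>)"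
    using I by (auto simp: ennreal_plus[symmetric] simp del: ennreal_plus intro!: ennreal_leI)
  from vanishes_in_prob_const[OF this] show ?thesis by (simp add: ennreal_eq_0_iff)
qed

lemma has_ito_integral_unique:
  assumes "has_ito_integral M F B \<phi> I" "has_ito_integral M F B \<phi> J"
  shows "AE \<omega> in M. I \<omega> = J \<omega>"
  using has_ito_integral_zero_unique[of "\<lambda>\<omega>. I \<omega> - J \<omega>"] has_ito_integral_diff[OF assms] by simp

section \<open>Approximation by simple processes\<close>

definition energy :: "(real \<times> 'a \<Rightarrow> real) \<Rightarrow> ennreal" where
  "energy f = (\<integral>\<^sup>+x. ennreal ((f x)\<^sup>2) \<partial>(lborel \<Otimes>\<^sub>M M))"

abbreviation simple_fun :: "(real \<times> real \<times> ('a \<Rightarrow> real)) list \<Rightarrow> real \<times> 'a \<Rightarrow> real" where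
  "simple_fun H x \<equiv> simple_process H (fst x) (snd x)"

lemma simple_fun_Pred: "simple_predictable M F H \<Longrightarrow> simple_fun H \<in> borel_measurable Pred"
  using simple_process_Pred by (simp add: case_prod_unfold)

text \<open>The closure, in \<open>L\<^sup>2(ds \<otimes> P)\<close>, of the simple processes. The following lemmas show that it is a
linear space closed under dominated limits and contains the indicators of bounded predictable sets;
hence it consists of all square-integrable predictable processes.\<close>

definition approximable :: "(real \<times> 'a \<Rightarrow> real) \<Rightarrow> bool" where
  "approximable f \<longleftrightarrow> f \<in> borel_measurable Pred \<and>
     (\<forall>e>0. \<exists>H. simple_predictable M F H \<and> energy (\<lambda>x. simple_fun H x - f x) \<le> ennreal e)"

lemma energy_triangle:
  assumes "f \<in> borel_measurable Pred" "g \<in> borel_measurable Pred" "h \<in> borel_measurable Pred"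
  shows "energy (\<lambda>x. f x - h x) \<le> 2 * (energy (\<lambda>x. f x - g x) + energy (\<lambda>x. g x - h x))"
  unfolding energy_def
  by (intro nn_integral_square_triangle borel_measurable_diff assms[THEN Pred_measurable_pair])

lemma approximableE:
  assumes "approximable f" "e > 0"
  obtains H where "simple_predictable M F H" "energy (\<lambda>x. simple_fun H x - f x) \<le> ennreal e"
  using assms unfolding approximable_def by blast

lemma approximable_closed:
  assumes f: "f \<in> borel_measurable Pred"
    and ex: "\<And>e. e > 0 \<Longrightarrow> \<exists>g. approximable g \<and> energy (\<lambda>x. g x - f x) \<le> ennreal e"
  shows "approximable f"
  unfolding approximable_def
proof (intro conjI f allI impI)
  fix e :: real assume e: "e > 0"
  then have e4: "e / 4 > 0" by simp
  obtain g where g: "approximable g" "energy (\<lambda>x. g x - f x) \<le> ennreal (e / 4)"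
    using ex[OF e4] by blast
  obtain H where H: "simple_predictable M F H" "energy (\<lambda>x. simple_fun H x - g x) \<le> ennreal (e / 4)"
    using approximableE[OF g(1) e4] .
  have "energy (\<lambda>x. simple_fun H x - f x) \<le> 2 * (energy (\<lambda>x. simple_fun H x - g x) + energy (\<lambda>x. g x - f x))"
    using g(1) by (intro energy_triangle simple_fun_Pred H f) (simp add: approximable_def)
  also have "\<dots> \<le> 2 * (ennreal (e / 4) + ennreal (e / 4))"
    using g H by (intro mult_left_mono add_mono) auto
  also have "\<dots> = ennreal e"
    using e by (simp add: ennreal_plus[symmetric] ennreal_mult''[symmetric] ennreal_numeral[symmetric]
        del: ennreal_plus ennreal_numeral)
  finally show "\<exists>H. simple_predictable M F H \<and> energy (\<lambda>x. simple_fun H x - f x) \<le> ennreal e"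
    using H by blast
qed

lemma approximable_simple: "simple_predictable M F H \<Longrightarrow> approximable (simple_fun H)"
  unfolding approximable_def by (auto simp: simple_fun_Pred energy_def intro!: exI[of _ H])

lemma approximable_cong:
  assumes "approximable f" "\<And>x. x \<in> UNIV \<times> space M \<Longrightarrow> f x = g x"
  shows "approximable g"
proof -
  have "f \<in> borel_measurable Pred \<longleftrightarrow> g \<in> borel_measurable Pred"
    by (intro measurable_cong) (use assms(2) in \<open>simp add: space_Pred\<close>)
  moreover have "energy (\<lambda>x. simple_fun H x - f x) = energy (\<lambda>x. simple_fun H x - g x)" for H
    unfolding energy_def by (intro nn_integral_cong) (use assms(2) in \<open>simp add: space_pair_measure\<close>)
  ultimately show ?thesis using assms(1) by (simp add: approximable_def)
qed

lemma approximable_add: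
  assumes f: "approximable f" and g: "approximable g"
  shows "approximable (\<lambda>x. f x + g x)"
  unfolding approximable_def
proof (intro conjI allI impI)
  have fg: "f \<in> borel_measurable Pred" "g \<in> borel_measurable Pred"
    using f g by (auto simp: approximable_def)
  then show "(\<lambda>x. f x + g x) \<in> borel_measurable Pred" by (rule borel_measurable_add)
  fix e :: real assume e: "e > 0"
  then have e4: "e / 4 > 0" by simp
  obtain H where H: "simple_predictable M F H" "energy (\<lambda>x. simple_fun H x - f x) \<le> ennreal (e / 4)"
    using approximableE[OF f e4] .
  obtain G where G: "simple_predictable M F G" "energy (\<lambda>x. simple_fun G x - g x) \<le> ennreal (e / 4)"
    using approximableE[OF g e4] .
  have "energy (\<lambda>x. simple_fun (H @ G) x - (f x + g x))
    \<le> 2 * (energy (\<lambda>x. simple_fun (H @ G) x - (simple_fun G x + f x)) + energy (\<lambda>x. (simple_fun G x + f x) - (f x + g x)))"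
    using fg simple_fun_Pred[OF G(1)]
    by (intro energy_triangle simple_fun_Pred simple_predictable_append H(1) G(1)) auto
  also have "\<dots> = 2 * (energy (\<lambda>x. simple_fun H x - f x) + energy (\<lambda>x. simple_fun G x - g x))"
    by (simp add: simple_process_append algebra_simps)
  also have "\<dots> \<le> 2 * (ennreal (e / 4) + ennreal (e / 4))"
    using G H by (intro mult_left_mono add_mono) auto
  also have "\<dots> = ennreal e"
    using e by (simp add: ennreal_plus[symmetric] ennreal_mult''[symmetric] ennreal_numeral[symmetric]
        del: ennreal_plus ennreal_numeral)
  finally show "\<exists>H. simple_predictable M F H \<and> energy (\<lambda>x. simple_fun H x - (f x + g x)) \<le> ennreal e"
    using simple_predictable_append[OF H(1) G(1)] by blast
qed

lemma energy_scale:
  assumes "f \<in> borel_measurable Pred"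
  shows "energy (\<lambda>x. c * f x) = ennreal (c\<^sup>2) * energy f"
proof -
  note [measurable] = assms[THEN Pred_measurable_pair]
  show ?thesis
    unfolding energy_def power_mult_distrib
    by (subst nn_integral_cmult[symmetric]) (auto simp: ennreal_mult)
qed

lemma approximable_scale:
  assumes f: "approximable f"
  shows "approximable (\<lambda>x. c * f x)"
  unfolding approximable_def
proof (intro conjI allI impI)
  have fm: "f \<in> borel_measurable Pred" using f by (auto simp: approximable_def)
  then show "(\<lambda>x. c * f x) \<in> borel_measurable Pred" by simp
  fix e :: real assume e: "e > 0"
  define d where "d = e / (c\<^sup>2 + 1)"
  have "c\<^sup>2 + 1 > 0" by (simp add: add_nonneg_pos)
  then have d: "d > 0" "c\<^sup>2 * d \<le> e" using e by (auto simp: d_def field_simps)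
  obtain H where H: "simple_predictable M F H" "energy (\<lambda>x. simple_fun H x - f x) \<le> ennreal d"
    using approximableE[OF f d(1)] .
  have "energy (\<lambda>x. simple_fun (scale_simple c H) x - c * f x) = energy (\<lambda>x. c * (simple_fun H x - f x))"
    by (simp add: simple_process_scale algebra_simps)
  also have "\<dots> = ennreal (c\<^sup>2) * energy (\<lambda>x. simple_fun H x - f x)"
    by (intro energy_scale borel_measurable_diff simple_fun_Pred H fm)
  also have "\<dots> \<le> ennreal (c\<^sup>2) * ennreal d" using H by (intro mult_left_mono) auto
  also have "\<dots> \<le> ennreal e" using d by (simp add: ennreal_mult[symmetric] ennreal_leI)
  finally show "\<exists>H. simple_predictable M F H \<and> energy (\<lambda>x. simple_fun H x - c * f x) \<le> ennreal e"
    using simple_predictable_scale[OF H(1)] by blast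
qed

lemma approximable_zero: "approximable (\<lambda>x. 0)"
  using approximable_simple[of "[]"] by (simp add: simple_predictable_def simple_process_def)

lemma approximable_sum:
  "finite J \<Longrightarrow> (\<And>j. j \<in> J \<Longrightarrow> approximable (f j)) \<Longrightarrow> approximable (\<lambda>x. \<Sum>j\<in>J. f j x)"
  by (induction J rule: finite_induct) (auto intro: approximable_zero approximable_add)

lemma approximable_dominated:
  assumes g: "\<And>n. approximable (g n)" and f: "f \<in> borel_measurable Pred" and w: "w \<in> borel_measurable Pred"
    and lim: "\<And>x. x \<in> UNIV \<times> space M \<Longrightarrow> (\<lambda>n. g n x) \<longlonglongrightarrow> f x"
    and bound: "\<And>n x. x \<in> UNIV \<times> space M \<Longrightarrow> \<bar>g n x\<bar> \<le> w x" "\<And>x. x \<in> UNIV \<times> space M \<Longrightarrow> \<bar>f x\<bar> \<le> w x"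
    and fin: "energy w < \<infinity>"
  shows "approximable f"
proof (rule approximable_closed[OF f])
  fix e :: real assume e: "e > 0"
  have [measurable]: "g n \<in> borel_measurable (lborel \<Otimes>\<^sub>M M)" "f \<in> borel_measurable (lborel \<Otimes>\<^sub>M M)"
    "w \<in> borel_measurable (lborel \<Otimes>\<^sub>M M)" for n
    using g f w by (auto simp: approximable_def intro!: Pred_measurable_pair)
  have "(\<lambda>n. energy (\<lambda>x. g n x - f x)) \<longlonglongrightarrow> (\<integral>\<^sup>+(x :: real \<times> 'a). 0 \<partial>(lborel \<Otimes>\<^sub>M M))"
    unfolding energy_def
  proof (rule nn_integral_dominated_convergence[where w="\<lambda>x. ennreal (2\<^sup>2) * ennreal ((w x)\<^sup>2)" and u'="\<lambda>_. 0"
        and u="\<lambda>n x. ennreal ((g n x - f x)\<^sup>2)"])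
    show "AE x in lborel \<Otimes>\<^sub>M M. ennreal ((g n x - f x)\<^sup>2) \<le> ennreal (2\<^sup>2) * ennreal ((w x)\<^sup>2)" for n
    proof (rule AE_I2)
      fix x :: "real \<times> 'a" assume "x \<in> space (lborel \<Otimes>\<^sub>M M)"
      then have "x \<in> UNIV \<times> space M" by (simp add: space_pair_measure)
      from bound(1)[OF this, of n] bound(2)[OF this]
      have "\<bar>g n x - f x\<bar> \<le> \<bar>2 * w x\<bar>" by linarith
      then have "(g n x - f x)\<^sup>2 \<le> (2 * w x)\<^sup>2" by (simp only: abs_le_square_iff)
      then show "ennreal ((g n x - f x)\<^sup>2) \<le> ennreal (2\<^sup>2) * ennreal ((w x)\<^sup>2)"
        by (subst ennreal_mult[symmetric]) (auto simp: power_mult_distrib intro!: ennreal_leI)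
    qed
    show "(\<integral>\<^sup>+x. ennreal (2\<^sup>2) * ennreal ((w x)\<^sup>2) \<partial>(lborel \<Otimes>\<^sub>M M)) < \<infinity>"
      using fin by (subst nn_integral_cmult) (auto simp: energy_def ennreal_mult_less_top)
    show "AE x in lborel \<Otimes>\<^sub>M M. (\<lambda>n. ennreal ((g n x - f x)\<^sup>2)) \<longlonglongrightarrow> 0"
    proof (rule AE_I2)
      fix x :: "real \<times> 'a" assume "x \<in> space (lborel \<Otimes>\<^sub>M M)"
      then have "x \<in> UNIV \<times> space M" by (simp add: space_pair_measure)
      from tendsto_power[OF tendsto_diff[OF lim[OF this] tendsto_const[of "f x"]], of 2]
      have "(\<lambda>n. (g n x - f x)\<^sup>2) \<longlonglongrightarrow> 0" by simp
      from tendsto_ennrealI[OF this] show "(\<lambda>n. ennreal ((g n x - f x)\<^sup>2)) \<longlonglongrightarrow> 0" by simp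
    qed
  qed measurable
  then have "(\<lambda>n. energy (\<lambda>x. g n x - f x)) \<longlonglongrightarrow> 0" by simp
  moreover have "(0::ennreal) < ennreal e" using e by simp
  ultimately have "\<forall>\<^sub>F n in sequentially. energy (\<lambda>x. g n x - f x) < ennreal e"
    by (rule order_tendstoD(2))
  then obtain n where "energy (\<lambda>x. g n x - f x) < ennreal e"
    by (auto simp: eventually_sequentially)
  then show "\<exists>h. approximable h \<and> energy (\<lambda>x. h x - f x) \<le> ennreal e"
    using g by (auto intro!: exI[of _ "g n"])
qed

lemma energy_indicator:
  assumes "A \<in> sets Pred"
  shows "energy (indicator A) = emeasure (lborel \<Otimes>\<^sub>M M) A"
proof -
  have "(\<lambda>x. ennreal ((indicator A x)\<^sup>2)) = (indicator A :: _ \<Rightarrow> ennreal)"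
    by (auto simp: indicator_def)
  then show ?thesis
    using assms sets_Pred_subset unfolding energy_def by (auto simp: subset_iff)
qed

text \<open>In general, indicators of predictable sets are square integrable only after restriction to a bounded
time window.\<close>

abbreviation window :: "nat \<Rightarrow> (real \<times> 'a) set" where
  "window m \<equiv> {- real m<..real m} \<times> space M"

lemma space_M_F: "space M \<in> sets (F t)"
  using sets.top[of "F t"] by (simp add: space_F)

lemma window_Pred: "window m \<in> sets Pred"
  by (rule rectangle_Pred[OF space_M_F])

lemma energy_window: "energy (indicator (window m)) < \<infinity>"
  unfolding energy_indicator[OF window_Pred]
  by (subst emeasure_pair_measure_Times) (auto simp: emeasure_space_1)

text \<open>The rectangles generating the predictable \<open>\<sigma>\<close>-algebra are stable under intersection, and their
indicators are simple. So it suffices that the sets with this property form a Dynkin system, which follows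
from linearity and dominated convergence.\<close>

lemma approximable_indicator:
  assumes "A \<in> sets Pred"
  shows "approximable (indicator (A \<inter> window m))"
proof -
  let ?G = "{{a<..b} \<times> A | a b A. a \<le> b \<and> A \<in> sets (F a)}"
  have st: "Int_stable ?G"
  proof (rule Int_stableI, safe)
    fix a b a' b' :: real and A A'
    assume *: "a \<le> b" "A \<in> sets (F a)" "a' \<le> b'" "A' \<in> sets (F a')"
    have "A \<in> sets (F (max a a'))" "A' \<in> sets (F (max a a'))"
      using * sets_F_mono[of a "max a a'"] sets_F_mono[of a' "max a a'"] by auto
    then have AA: "A \<inter> A' \<in> sets (F (max a a'))" by simp
    show "\<exists>c d C. ({a<..b} \<times> A) \<inter> ({a'<..b'} \<times> A') = {c<..d} \<times> C \<and> c \<le> d \<and> C \<in> sets (F c)"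
      by (rule exI[of _ "max a a'"], rule exI[of _ "max (max a a') (min b b')"], rule exI[of _ "A \<inter> A'"])
        (use AA in auto)
  qed
  have sub: "?G \<subseteq> Pow (UNIV \<times> space M)"
    using sets_F_subset sets.sets_into_space[of _ M] by blast
  have rect: "approximable (indicator ({a<..b} \<times> A \<inter> window m))" if A: "A \<in> sets (F a)" for a b A
  proof -
    \<comment> \<open>The outer maximum in \<open>d\<close> makes the interval \<open>(c, d]\<close> empty if \<open>(a, b]\<close> misses the window.\<close>
    define c d where "c = max a (- real m)" and "d = max c (min b (real m))"
    have Ac: "A \<in> sets (F c)" using sets_F_mono[of a c] A by (auto simp: c_def)
    have sp: "simple_predictable M F [(c, d, indicator A)]"
      using Ac by (auto simp: simple_predictable_def d_def indicator_def intro!: exI[of _ 1])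
    have "A \<subseteq> space M" using sets.sets_into_space[OF A] by (simp add: space_F)
    then have "simple_fun [(c, d, indicator A)] = indicator ({a<..b} \<times> A \<inter> window m)"
      by (auto simp: fun_eq_iff simple_process_def c_def d_def split: split_indicator)
    then show ?thesis using approximable_simple[OF sp] by simp
  qed
  have full: "approximable (indicator (window m))"
    using rect[OF space_M_F, of "- real m" "real m"] by simp
  have "A \<in> sigma_sets (UNIV \<times> space M) ?G" using assms by (simp add: sets_Pred)
  with st sub show ?thesis
  proof (induction rule: sigma_sets_induct_disjoint)
    case (basic A)
    then show ?case using rect by auto
  next
    case empty
    then show ?case using approximable_zero by (simp add: fun_eq_iff)
  next
    case (compl A)
    have "approximable (\<lambda>x. indicator (window m) x + (- 1) * indicator (A \<inter> window m) x)"
      by (intro approximable_add approximable_scale full compl)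
    then show ?case
      by (rule approximable_cong) (auto split: split_indicator)
  next
    case (union A)
    have AP: "A i \<in> sets Pred" for i using union(2) by (auto simp: sets_Pred)
    have "approximable (\<lambda>x. \<Sum>i<n. indicator (A i \<inter> window m) x)" for n
      by (intro approximable_sum union) auto
    moreover have ind: "(\<Sum>i<n. indicator (A i \<inter> window m) x) = (indicator ((\<Union>i<n. A i) \<inter> window m) x :: real)" for n x
    proof -
      have "disjoint_family_on (\<lambda>i. A i \<inter> window m) {..<n}"
        using union(1) by (auto simp: disjoint_family_on_def)
      then have "(\<Sum>i<n. indicator (A i \<inter> window m) x) = (indicator (\<Union>i<n. A i \<inter> window m) x :: real)"
        by (intro indicator_UN_disjoint[symmetric, simplified]) auto
      then show ?thesis by (simp add: Int_UN_distrib2 UN_extend_simps(4) del: UN_simps)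
    qed
    ultimately have ap: "approximable (indicator ((\<Union>i<n. A i) \<inter> window m))" for n by simp
    show ?case
    proof (rule approximable_dominated[OF ap])
      show "indicator ((\<Union>i. A i) \<inter> window m) \<in> borel_measurable Pred"
        using AP window_Pred by (intro borel_measurable_indicator sets.Int sets.countable_UN) auto
      show "(indicator (window m) :: _ \<Rightarrow> real) \<in> borel_measurable Pred"
        using window_Pred by (intro borel_measurable_indicator)
      show "(\<lambda>n. indicator ((\<Union>i<n. A i) \<inter> window m) x) \<longlonglongrightarrow> (indicator ((\<Union>i. A i) \<inter> window m) x :: real)" for x
        using tendsto_mult[OF LIMSEQ_indicator_UN[of A x] tendsto_const[of "indicator (window m) x :: real"]]
        by (simp add: indicator_inter_arith)
    qed (use energy_window[of m] in \<open>auto split: split_indicator\<close>)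
  qed
qed

text \<open>Approximation by simple functions bounded by \<open>2 |f|\<close>, cut off to growing time windows.\<close>

theorem square_integrable_approximable:
  assumes f: "f \<in> borel_measurable Pred" and fin: "energy f < \<infinity>"
  shows "approximable f"
proof -
  obtain g :: "nat \<Rightarrow> real \<times> 'a \<Rightarrow> real" where g: "\<And>i. simple_function Pred (g i)"
    "\<And>x. x \<in> space Pred \<Longrightarrow> (\<lambda>i. g i x) \<longlonglongrightarrow> f x"
    "\<And>i x. x \<in> space Pred \<Longrightarrow> dist (g i x) 0 \<le> 2 * dist (f x) 0"
    using borel_measurable_implies_sequence_metric[OF f, of 0] by blast
  define h where "h i x = g i x * indicator (window i) x" for i :: nat and x :: "real \<times> 'a"
  have ap: "approximable (h i)" for i
  proof -
    have "approximable (\<lambda>x. \<Sum>y\<in>g i ` space Pred. y * indicator ((g i -` {y} \<inter> space Pred) \<inter> window i) x)"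
      using g(1)[of i] by (intro approximable_sum approximable_scale approximable_indicator)
        (auto simp: simple_function_def)
    then show ?thesis
    proof (rule approximable_cong)
      fix x :: "real \<times> 'a" assume "x \<in> UNIV \<times> space M"
      then have "x \<in> space Pred" by (simp add: space_Pred)
      from simple_function_indicator_representation_banach[OF g(1) this, of i]
      have "h i x = (\<Sum>y\<in>g i ` space Pred. indicator (g i -` {y} \<inter> space Pred) x *\<^sub>R y) * indicator (window i) x"
        unfolding h_def by (rule arg_cong[where f="\<lambda>z. z * indicator (window i) x"])
      also have "\<dots> = (\<Sum>y\<in>g i ` space Pred. y * indicator ((g i -` {y} \<inter> space Pred) \<inter> window i) x)"
        unfolding sum_distrib_right by (intro sum.cong refl) (simp split: split_indicator)
      finally show "(\<Sum>y\<in>g i ` space Pred. y * indicator ((g i -` {y} \<inter> space Pred) \<inter> window i) x) = h i x"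
        by (rule sym)
    qed
  qed
  show ?thesis
  proof (rule approximable_dominated[OF ap f, of "\<lambda>x. 2 * \<bar>f x\<bar>"])
    show "(\<lambda>x. 2 * \<bar>f x\<bar>) \<in> borel_measurable Pred" using f by simp
    show "\<bar>h n x\<bar> \<le> 2 * \<bar>f x\<bar>" if "x \<in> UNIV \<times> space M" for n and x :: "real \<times> 'a"
      using g(3)[of x n] that by (auto simp: h_def space_Pred split: split_indicator)
    show "(\<lambda>n. h n x) \<longlonglongrightarrow> f x" if x: "x \<in> UNIV \<times> space M" for x :: "real \<times> 'a"
    proof (rule Lim_transform_eventually)
      show "(\<lambda>n. g n x) \<longlonglongrightarrow> f x" using g(2) x by (simp add: space_Pred)
      obtain N :: nat where "N > \<bar>fst x\<bar>" using reals_Archimedean2 by blast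
      then show "\<forall>\<^sub>F n in sequentially. g n x = h n x"
        using x by (intro eventually_sequentiallyI[of N]) (auto simp: h_def split: split_indicator)
    qed
    show "energy (\<lambda>x. 2 * \<bar>f x\<bar>) < \<infinity>"
      using fin f by (subst energy_scale) (auto simp: energy_def ennreal_mult_less_top)
  qed auto
qed

lemma energy_iterated:
  assumes "f \<in> borel_measurable Pred"
  shows "(\<integral>\<^sup>+\<omega>. (\<integral>\<^sup>+s. ennreal ((f (s, \<omega>))\<^sup>2) \<partial>lborel) \<partial>M) = energy f"
    "(\<integral>\<^sup>+s. (\<integral>\<^sup>+\<omega>. ennreal ((f (s, \<omega>))\<^sup>2) \<partial>M) \<partial>lborel) = energy f"
proof -
  note [measurable] = assms[THEN Pred_measurable_pair]
  have m: "(\<lambda>x. ennreal ((f x)\<^sup>2)) \<in> borel_measurable (lborel \<Otimes>\<^sub>M M)" by measurable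
  show "(\<integral>\<^sup>+\<omega>. (\<integral>\<^sup>+s. ennreal ((f (s, \<omega>))\<^sup>2) \<partial>lborel) \<partial>M) = energy f"
    unfolding energy_def by (rule pair.nn_integral_snd[OF m])
  show "(\<integral>\<^sup>+s. (\<integral>\<^sup>+\<omega>. ennreal ((f (s, \<omega>))\<^sup>2) \<partial>M) \<partial>lborel) = energy f"
    unfolding energy_def by (rule nn_integral_fst[OF m])
qed

lemma simple_ito_energy:
  assumes "simple_predictable M F H"
  shows "(\<integral>\<^sup>+\<omega>. ennreal ((simple_ito_sum B H \<omega>)\<^sup>2) \<partial>M) = energy (simple_fun H)"
  using simple_ito_isometry[OF assms] energy_iterated(1)[OF simple_fun_Pred[OF assms]] by simp

end

section \<open>The integral of a square-integrable process\<close>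

text \<open>Fatou's lemma in the form in which estimates for approximations pass to an almost sure limit.\<close>

lemma nn_integral_Fatou_bound:
  fixes u :: "nat \<Rightarrow> 'b \<Rightarrow> ennreal"
  assumes "\<And>n. u n \<in> borel_measurable N" "AE x in N. (\<lambda>n. u n x) \<longlonglongrightarrow> v x"
    and "\<And>n. (\<integral>\<^sup>+x. u n x \<partial>N) \<le> c n" "c \<longlonglongrightarrow> C"
  shows "(\<integral>\<^sup>+x. v x \<partial>N) \<le> C"
proof -
  have "(\<integral>\<^sup>+x. v x \<partial>N) = (\<integral>\<^sup>+x. liminf (\<lambda>n. u n x) \<partial>N)"
    by (rule nn_integral_cong_AE, use assms(2) in eventually_elim) (auto dest: lim_imp_Liminf[rotated])
  also have "\<dots> \<le> liminf (\<lambda>n. \<integral>\<^sup>+x. u n x \<partial>N)"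
    by (rule nn_integral_liminf[OF assms(1)])
  also have "\<dots> \<le> liminf c" by (intro Liminf_mono always_eventually allI assms(3))
  also have "\<dots> = C" by (rule lim_imp_Liminf[OF _ assms(4)]) simp
  finally show ?thesis .
qed

context two_sided_brownian_motion
begin

lemma vanishes_in_prob_square:
  fixes f :: "nat \<Rightarrow> 'a \<Rightarrow> real"
  assumes "vanishes_in_prob (\<lambda>n \<omega>. ennreal ((f n \<omega>)\<^sup>2))" and [measurable]: "\<And>n. f n \<in> borel_measurable M"
  shows "vanishes_in_prob (\<lambda>n \<omega>. ennreal \<bar>f n \<omega>\<bar>)"
  unfolding vanishes_in_prob_def
proof (intro conjI allI impI)
  fix \<epsilon> :: real assume \<epsilon>: "\<epsilon> > 0"
  have "ennreal \<epsilon> < ennreal \<bar>x\<bar> \<longleftrightarrow> ennreal (\<epsilon>\<^sup>2) < ennreal (x\<^sup>2)" for x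
    using \<epsilon> abs_le_square_iff[of x \<epsilon>] by (auto simp: ennreal_less_iff not_le[symmetric])
  then show "(\<lambda>n. prob {\<omega>\<in>space M. ennreal \<epsilon> < ennreal \<bar>f n \<omega>\<bar>}) \<longlonglongrightarrow> 0"
    using vanishes_in_probD[OF assms(1), of "\<epsilon>\<^sup>2"] \<epsilon> by simp
qed measurable

text \<open>Along approximations with summable errors, the sums for simple integrands converge almost surely, and
Fatou's lemma shows that they converge in mean square, too. The factor 2 in the moment bound is not
sharp; it comes from comparing the limit with the approximations by the quadratic triangle inequality.\<close>

theorem square_integrable_ito_exists:
  assumes \<phi>: "predictable_process M F \<phi>" and fin: "energy (\<lambda>(s, \<omega>). \<phi> s \<omega>) < \<infinity>"
  obtains I where "has_ito_integral M F B \<phi> I"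
    "(\<integral>\<^sup>+\<omega>. ennreal ((I \<omega>)\<^sup>2) \<partial>M) \<le> 2 * energy (\<lambda>(s, \<omega>). \<phi> s \<omega>)"
proof -
  define f where "f = (\<lambda>(s, \<omega>). \<phi> s \<omega>)"
  have f: "f \<in> borel_measurable Pred" using \<phi> by (simp add: f_def predictable_process_def)
  have fin: "energy f < \<infinity>" using fin by (simp add: f_def)
  \<comment> \<open>The errors decay fast enough that the bound \<open>\<bar>x\<bar> \<le> 2\<^sup>-\<^sup>n + 2\<^sup>n x\<^sup>2\<close>, used for the increments
    of the approximating integrals, gives summable first moments.\<close>
  define e :: "nat \<Rightarrow> real" where "e n = (1/16)^n" for n
  have e: "e n > 0" "m \<ge> n \<Longrightarrow> e m \<le> e n" for m n by (auto simp: e_def power_decreasing)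
  have "\<exists>H. simple_predictable M F H \<and> energy (\<lambda>x. simple_fun H x - f x) \<le> ennreal (e n)" for n
    using square_integrable_approximable[OF f fin] e(1) unfolding approximable_def by blast
  then obtain H where H: "\<And>n. simple_predictable M F (H n)"
    and He: "\<And>n. energy (\<lambda>x. simple_fun (H n) x - f x) \<le> ennreal (e n)"
    by metis
  note Hm = simple_fun_Pred[OF H]
  define S where "S n = simple_ito_sum B (H n)" for n
  have S[measurable]: "S n \<in> borel_measurable M" for n
    unfolding S_def by (rule simple_ito_sum_measurable[OF H])
  have He': "energy (\<lambda>x. f x - simple_fun (H n) x) \<le> ennreal (e n)" for n
    using He[of n] by (simp add: energy_def power2_commute)
  have SS: "(\<integral>\<^sup>+\<omega>. ennreal ((S m \<omega> - S n \<omega>)\<^sup>2) \<partial>M) \<le> ennreal (4 * e n)" if "m \<ge> n" for m n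
  proof -
    let ?K = "H m @ scale_simple (- 1) (H n)"
    have K: "simple_predictable M F ?K"
      by (intro simple_predictable_append simple_predictable_scale H)
    have "(\<integral>\<^sup>+\<omega>. ennreal ((S m \<omega> - S n \<omega>)\<^sup>2) \<partial>M) = energy (\<lambda>x. simple_fun (H m) x - simple_fun (H n) x)"
      using simple_ito_energy[OF K]
      by (simp add: S_def simple_ito_sum_append simple_ito_sum_scale simple_process_append simple_process_scale)
    also have "\<dots> \<le> 2 * (energy (\<lambda>x. simple_fun (H m) x - f x) + energy (\<lambda>x. f x - simple_fun (H n) x))"
      by (rule energy_triangle[OF Hm f Hm])
    also have "\<dots> \<le> 2 * (ennreal (e n) + ennreal (e n))"
      using e(2)[OF that] by (intro mult_left_mono add_mono He' order_trans[OF He] ennreal_leI) auto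
    also have "\<dots> = ennreal (4 * e n)"
      using e(1)[of n] by (simp add: ennreal_plus[symmetric] ennreal_mult''[symmetric] ennreal_numeral[symmetric]
        del: ennreal_plus ennreal_numeral)
    finally show ?thesis .
  qed
  define D where "D n \<omega> = S (Suc n) \<omega> - S n \<omega>" for n \<omega>
  have D[measurable]: "D n \<in> borel_measurable M" for n unfolding D_def by measurable
  have D1: "(\<integral>\<^sup>+\<omega>. ennreal \<bar>D n \<omega>\<bar> \<partial>M) \<le> ennreal (5 * (1/2)^n)" for n
  proof -
    have le: "\<bar>x\<bar> \<le> (1/2)^n + 2^n * x\<^sup>2" for x :: real
    proof (cases "\<bar>x\<bar> \<le> (1/2)^n")
      case False
      then have "2^n * \<bar>x\<bar> \<ge> 2^n * (1/2)^n" by (intro mult_left_mono) auto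
      then have "2^n * \<bar>x\<bar> \<ge> 1" by (simp add: power_mult_distrib[symmetric])
      then have "1 * \<bar>x\<bar> \<le> 2^n * \<bar>x\<bar> * \<bar>x\<bar>" by (intro mult_right_mono) auto
      also have "\<dots> = 2^n * x\<^sup>2" by (simp add: power2_eq_square)
      finally show ?thesis by (simp add: add_increasing)
    qed (simp add: add_increasing2)
    have "(\<integral>\<^sup>+\<omega>. ennreal \<bar>D n \<omega>\<bar> \<partial>M) \<le> (\<integral>\<^sup>+\<omega>. ennreal ((1/2)^n) + ennreal (2^n) * ennreal ((D n \<omega>)\<^sup>2) \<partial>M)"
      by (intro nn_integral_mono) (simp add: ennreal_mult[symmetric] ennreal_plus[symmetric] le ennreal_leI del: ennreal_plus)
    also have "\<dots> = ennreal ((1/2)^n) + ennreal (2^n) * (\<integral>\<^sup>+\<omega>. ennreal ((D n \<omega>)\<^sup>2) \<partial>M)"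
      by (subst nn_integral_add) (auto simp: nn_integral_cmult emeasure_space_1)
    also have "\<dots> \<le> ennreal ((1/2)^n) + ennreal (2^n) * ennreal (4 * e n)"
      unfolding D_def by (intro add_left_mono mult_left_mono SS) auto
    also have "ennreal (2^n) * ennreal (4 * e n) = ennreal (2^n * (4 * e n))"
      by (rule ennreal_mult[symmetric]) (use e(1)[of n] in auto)
    also have "ennreal ((1/2)^n) + ennreal (2^n * (4 * e n)) = ennreal ((1/2)^n + 2^n * (4 * e n))"
      by (rule ennreal_plus[symmetric]) (use e(1)[of n] in auto)
    also have "\<dots> \<le> ennreal (5 * (1/2)^n)"
    proof (rule ennreal_leI)
      have "2^n * e n = (1/8)^n" by (simp add: e_def power_mult_distrib[symmetric])
      also have "\<dots> \<le> (1/2)^n" by (intro power_mono) auto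
      finally have "2^n * e n \<le> (1/2)^n" .
      moreover have "2^n * (4 * e n) = 4 * (2^n * e n)" by (rule mult.left_commute)
      ultimately show "(1/2)^n + 2^n * (4 * e n) \<le> 5 * (1/2)^n" by linarith
    qed
    finally show ?thesis .
  qed
  have conv: "AE \<omega> in M. convergent (\<lambda>n. S n \<omega>)"
  proof -
    have "(\<integral>\<^sup>+\<omega>. (\<Sum>n. ennreal \<bar>D n \<omega>\<bar>) \<partial>M) = (\<Sum>n. \<integral>\<^sup>+\<omega>. ennreal \<bar>D n \<omega>\<bar> \<partial>M)"
      by (rule nn_integral_suminf) measurable
    also have "\<dots> \<le> (\<Sum>n. ennreal (5 * (1/2)^n))" by (intro suminf_le D1) auto
    also have "\<dots> < \<infinity>"
    proof -
      have "summable (\<lambda>n. 5 * (1/2::real)^n)" by (intro summable_mult summable_geometric) simp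
      then show ?thesis unfolding infinity_ennreal_def less_top[symmetric]
        by (rule ennreal_suminf_neq_top) simp
    qed
    finally have "AE \<omega> in M. (\<Sum>n. ennreal \<bar>D n \<omega>\<bar>) \<noteq> \<infinity>"
      by (intro nn_integral_PInf_AE) auto
    then show ?thesis
    proof eventually_elim
      case (elim \<omega>)
      then have "summable (\<lambda>n. \<bar>D n \<omega>\<bar>)" by (intro summable_suminf_not_top) auto
      then have "summable (\<lambda>n. D n \<omega>)" by (rule summable_rabs_cancel)
      then have "(\<lambda>n. S 0 \<omega> + (\<Sum>i<n. D i \<omega>)) \<longlonglongrightarrow> S 0 \<omega> + (\<Sum>i. D i \<omega>)"
        by (intro tendsto_add tendsto_const summable_LIMSEQ)
      moreover have "S 0 \<omega> + (\<Sum>i<n. D i \<omega>) = S n \<omega>" for n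
        using sum_lessThan_telescope[of "\<lambda>n. S n \<omega>" n] by (simp add: D_def)
      ultimately show ?case by (auto simp: convergent_def)
    qed
  qed
  define I where "I \<omega> = lim (\<lambda>n. S n \<omega>)" for \<omega>
  have I[measurable]: "I \<in> borel_measurable M" unfolding I_def by measurable
  have lim: "AE \<omega> in M. (\<lambda>n. S n \<omega>) \<longlonglongrightarrow> I \<omega>"
    using conv by eventually_elim (simp add: I_def convergent_LIMSEQ_iff)
  have IS: "(\<integral>\<^sup>+\<omega>. ennreal ((S n \<omega> - I \<omega>)\<^sup>2) \<partial>M) \<le> ennreal (4 * e n)" for n
  proof (rule nn_integral_Fatou_bound[where u="\<lambda>m \<omega>. ennreal ((S (m + n) \<omega> - S n \<omega>)\<^sup>2)"])
    show "AE \<omega> in M. (\<lambda>m. ennreal ((S (m + n) \<omega> - S n \<omega>)\<^sup>2)) \<longlonglongrightarrow> ennreal ((S n \<omega> - I \<omega>)\<^sup>2)"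
      using lim
    proof eventually_elim
      case (elim \<omega>)
      from LIMSEQ_ignore_initial_segment[OF elim, of n]
      have "(\<lambda>m. ennreal ((S (m + n) \<omega> - S n \<omega>)\<^sup>2)) \<longlonglongrightarrow> ennreal ((I \<omega> - S n \<omega>)\<^sup>2)"
        by (intro tendsto_ennrealI tendsto_power tendsto_diff tendsto_const)
      then show ?case by (simp add: power2_commute)
    qed
    show "(\<integral>\<^sup>+\<omega>. ennreal ((S (m + n) \<omega> - S n \<omega>)\<^sup>2) \<partial>M) \<le> ennreal (4 * e n)" for m
      by (rule SS) simp
  qed auto
  have e0: "(\<lambda>n. ennreal (c * e n)) \<longlonglongrightarrow> 0" for c
  proof -
    have "e \<longlonglongrightarrow> 0" unfolding e_def by (rule LIMSEQ_power_zero) simp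
    from tendsto_ennrealI[OF tendsto_mult_right_zero[OF this, of c]] show ?thesis by simp
  qed
  have en: "(\<integral>\<^sup>+\<omega>. (\<integral>\<^sup>+s. ennreal ((simple_process (H n) s \<omega> - \<phi> s \<omega>)\<^sup>2) \<partial>lborel) \<partial>M) \<le> ennreal (1 * e n)" for n
    using energy_iterated(1)[OF borel_measurable_diff[OF Hm f], of n] He[of n] by (simp add: f_def)
  have "has_ito_integral M F B \<phi> I"
    unfolding has_ito_integral_iff
  proof (intro conjI exI[of _ H] allI H \<phi> I)
    have "(\<integral>\<^sup>+\<omega>. (\<integral>\<^sup>+s. ennreal ((\<phi> s \<omega>)\<^sup>2) \<partial>lborel) \<partial>M) < \<infinity>"
      using energy_iterated(1)[OF f] fin by (simp add: f_def)
    moreover have "(\<lambda>\<omega>. \<integral>\<^sup>+s. ennreal ((\<phi> s \<omega>)\<^sup>2) \<partial>lborel) \<in> borel_measurable M"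
    proof -
      note [measurable] = f[THEN Pred_measurable_pair]
      have "(\<lambda>x. ennreal ((f x)\<^sup>2)) \<in> borel_measurable (lborel \<Otimes>\<^sub>M M)" by measurable
      from nn_integral_time_measurable[OF this] show ?thesis by (simp add: f_def)
    qed
    ultimately show "AE \<omega> in M. (\<integral>\<^sup>+s. ennreal ((\<phi> s \<omega>)\<^sup>2) \<partial>lborel) < \<infinity>"
      using nn_integral_PInf_AE[of "\<lambda>\<omega>. \<integral>\<^sup>+s. ennreal ((\<phi> s \<omega>)\<^sup>2) \<partial>lborel" M] by (simp add: less_top)
    show "vanishes_in_prob (\<lambda>n \<omega>. \<integral>\<^sup>+s. ennreal ((simple_process (H n) s \<omega> - \<phi> s \<omega>)\<^sup>2) \<partial>lborel)"
      by (intro vanishes_in_prob_L1 square_distance_measurable(2) \<phi> H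
          tendsto_sandwich[OF _ _ tendsto_const e0[of 1]] always_eventually allI en zero_le)
    have "vanishes_in_prob (\<lambda>n \<omega>. ennreal ((S n \<omega> - I \<omega>)\<^sup>2))"
      by (intro vanishes_in_prob_L1 tendsto_sandwich[OF _ _ tendsto_const e0[of 4]] always_eventually allI IS zero_le)
        measurable
    then show "vanishes_in_prob (\<lambda>n \<omega>. ennreal \<bar>simple_ito_sum B (H n) \<omega> - I \<omega>\<bar>)"
      unfolding S_def[symmetric] by (rule vanishes_in_prob_square) measurable
  qed
  moreover have "(\<integral>\<^sup>+\<omega>. ennreal ((I \<omega>)\<^sup>2) \<partial>M) \<le> 2 * energy f"
  proof (rule nn_integral_Fatou_bound[where u="\<lambda>n \<omega>. ennreal ((S n \<omega>)\<^sup>2)"])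
    show "AE \<omega> in M. (\<lambda>n. ennreal ((S n \<omega>)\<^sup>2)) \<longlonglongrightarrow> ennreal ((I \<omega>)\<^sup>2)"
      using lim by eventually_elim (intro tendsto_ennrealI tendsto_power)
    show "(\<integral>\<^sup>+\<omega>. ennreal ((S n \<omega>)\<^sup>2) \<partial>M) \<le> 2 * (ennreal (1 * e n) + energy f)" for n
    proof -
      have "(\<integral>\<^sup>+\<omega>. ennreal ((S n \<omega>)\<^sup>2) \<partial>M) = energy (\<lambda>x. simple_fun (H n) x - 0)"
        unfolding S_def simple_ito_energy[OF H] by simp
      also have "\<dots> \<le> 2 * (energy (\<lambda>x. simple_fun (H n) x - f x) + energy (\<lambda>x. f x - 0))"
        by (rule energy_triangle[OF Hm f]) simp
      also have "\<dots> \<le> 2 * (ennreal (1 * e n) + energy f)"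
        using He[of n] by (intro mult_left_mono add_mono) auto
      finally show ?thesis .
    qed
    have "(\<lambda>n. 2 * (ennreal (1 * e n) + energy f)) \<longlonglongrightarrow> 2 * (0 + energy f)"
      by (intro ennreal_tendsto_cmult tendsto_add e0 tendsto_const) simp
    then show "(\<lambda>n. 2 * (ennreal (1 * e n) + energy f)) \<longlonglongrightarrow> 2 * energy f" by simp
  qed measurable
  ultimately show ?thesis using that by (simp add: f_def)
qed

section \<open>Integrands with a deterministic kernel\<close>

lemma fst_Pred: "fst \<in> borel_measurable Pred"
  unfolding borel_measurable_iff_le
proof
  fix c :: real
  have "{w \<in> space Pred. fst w \<le> c} = (\<Union>n. {c - real n<..c} \<times> space M)"
  proof (intro set_eqI iffI)
    fix w assume w: "w \<in> {w \<in> space Pred. fst w \<le> c}"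
    obtain n :: nat where "c - fst w < real n" using reals_Archimedean2 by blast
    with w show "w \<in> (\<Union>n. {c - real n<..c} \<times> space M)"
      by (intro UN_I[of n]) (auto simp: space_Pred)
  qed (auto simp: space_Pred)
  also have "\<dots> \<in> sets Pred"
    by (intro sets.countable_UN) (auto intro: rectangle_Pred[OF space_M_F])
  finally show "{w \<in> space Pred. fst w \<le> c} \<in> sets Pred" .
qed

lemma left_dyadic_tendsto:
  fixes s :: real
  shows "filterlim (\<lambda>n. real_of_int (\<lceil>2^n * s\<rceil> - 1) / 2^n) (at_left s) sequentially"
  unfolding filterlim_at
proof
  have le: "real_of_int (\<lceil>2^n * s\<rceil> - 1) / 2^n < s" "s - (1/2)^n \<le> real_of_int (\<lceil>2^n * s\<rceil> - 1) / 2^n" for n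
  proof -
    have "real_of_int (\<lceil>2^n * s\<rceil> - 1) < 2^n * s" "2^n * s - 1 \<le> real_of_int (\<lceil>2^n * s\<rceil> - 1)"
      by linarith+
    then show "real_of_int (\<lceil>2^n * s\<rceil> - 1) / 2^n < s" "s - (1/2)^n \<le> real_of_int (\<lceil>2^n * s\<rceil> - 1) / 2^n"
      by (auto simp: field_simps)
  qed
  then show "\<forall>\<^sub>F n in sequentially. real_of_int (\<lceil>2^n * s\<rceil> - 1) / 2^n \<in> {..<s} \<and> real_of_int (\<lceil>2^n * s\<rceil> - 1) / 2^n \<noteq> s"
    by (intro always_eventually) (force simp: less_le)
  have "(\<lambda>n. s - (1/2)^n) \<longlonglongrightarrow> s - 0"
    by (intro tendsto_diff tendsto_const LIMSEQ_power_zero) simp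
  then have lim: "(\<lambda>n. s - (1/2)^n) \<longlonglongrightarrow> s" by simp
  show "(\<lambda>n. real_of_int (\<lceil>2^n * s\<rceil> - 1) / 2^n) \<longlonglongrightarrow> s"
    by (rule tendsto_sandwich[OF _ _ lim tendsto_const])
      (rule always_eventually allI le less_imp_le[OF le(1)])+
qed

text \<open>A left-continuous process is the limit of its values at the last dyadic point strictly before the
current time; the approximations are constant on left-open dyadic intervals.\<close>

lemma adapted_caglad_predictable:
  assumes ad: "adapted_process F \<sigma>" and cag: "caglad_process M \<sigma>"
  shows "predictable_process M F \<sigma>"
  unfolding predictable_process_def
proof (rule borel_measurable_LIMSEQ_metric)
  define a where "a n s = real_of_int (\<lceil>2^n * s\<rceil> - 1) / 2^n" for n :: nat and s :: real
  show "(\<lambda>n. (\<lambda>(s, \<omega>). \<sigma> (a n s) \<omega>) w) \<longlonglongrightarrow> (\<lambda>(s, \<omega>). \<sigma> s \<omega>) w" if w: "w \<in> space Pred" for w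
  proof -
    obtain s \<omega> where w': "w = (s, \<omega>)" "\<omega> \<in> space M" using w by (auto simp: space_Pred)
    have "((\<lambda>s. \<sigma> s \<omega>) \<longlongrightarrow> \<sigma> s \<omega>) (at_left s)"
      using cag w'(2) by (auto simp: caglad_process_def continuous_within)
    from filterlim_compose[OF this left_dyadic_tendsto] show ?thesis by (simp add: w' a_def)
  qed
  fix n
  show "(\<lambda>(s, \<omega>). \<sigma> (a n s) \<omega>) \<in> borel_measurable Pred"
  proof (rule measurableI)
    fix A :: "real set" assume A: "A \<in> sets borel"
    let ?R = "\<lambda>j::int. {j / 2^n<..(j + 1) / 2^n} \<times> (\<sigma> (j / 2^n) -` A \<inter> space M)"
    have "(\<lambda>(s, \<omega>). \<sigma> (a n s) \<omega>) -` A \<inter> space Pred = (\<Union>j. ?R j)"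
    proof (intro set_eqI iffI)
      fix w assume w: "w \<in> (\<lambda>(s, \<omega>). \<sigma> (a n s) \<omega>) -` A \<inter> space Pred"
      obtain s \<omega> where w': "w = (s, \<omega>)" by (cases w)
      define j where "j = \<lceil>2^n * s\<rceil> - 1"
      have "real_of_int j < 2^n * s" "2^n * s \<le> real_of_int j + 1" unfolding j_def by linarith+
      then have "s \<in> {j / 2^n<..(j + 1) / 2^n}" by (auto simp: field_simps)
      moreover have "a n s = j / 2^n" by (simp only: a_def j_def)
      ultimately have "w \<in> ?R j" using w by (auto simp: w' space_Pred)
      then show "w \<in> (\<Union>j. ?R j)" by blast
    next
      fix w assume "w \<in> (\<Union>j. ?R j)"
      then obtain j s \<omega> where w: "w = (s, \<omega>)" "w \<in> ?R j" by (cases w) blast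
      then have "real_of_int j < 2^n * s" "2^n * s \<le> real_of_int j + 1" by (auto simp: field_simps)
      then have "\<lceil>2^n * s\<rceil> = j + 1" by (intro ceiling_unique) auto
      then have "a n s = j / 2^n" by (simp only: a_def) simp
      then show "w \<in> (\<lambda>(s, \<omega>). \<sigma> (a n s) \<omega>) -` A \<inter> space Pred"
        using w by (auto simp: space_Pred)
    qed
    also have "\<dots> \<in> sets Pred"
    proof -
      have "?R j \<in> sets Pred" for j
      proof (rule rectangle_Pred)
        have "\<sigma> (j / 2^n) \<in> borel_measurable (F (j / 2^n))" using ad by (simp add: adapted_process_def)
        from measurable_sets[OF this A] show "\<sigma> (j / 2^n) -` A \<inter> space M \<in> sets (F (j / 2^n))"
          by (simp add: space_F)
      qed
      then show ?thesis by (intro sets.countable_UN') auto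
    qed
    finally show "(\<lambda>(s, \<omega>). \<sigma> (a n s) \<omega>) -` A \<inter> space Pred \<in> sets Pred" .
  qed simp
qed

text \<open>By Tonelli's theorem the mean energy of \<open>k \<sigma>\<close> is at most the energy of \<open>k\<close> times the bound on the second
moments of \<open>\<sigma>\<close>.\<close>

theorem kernel_ito_exists:
  assumes \<sigma>: "predictable_process M F \<sigma>" and k[measurable]: "k \<in> borel_measurable borel"
    and mom: "\<And>t. (\<integral>\<^sup>+\<omega>. ennreal ((\<sigma> t \<omega>)\<^sup>2) \<partial>M) \<le> ennreal C"
    and k2: "(\<integral>\<^sup>+s. ennreal ((k s)\<^sup>2) \<partial>lborel) < \<infinity>"
  obtains I where "has_ito_integral M F B (\<lambda>s \<omega>. k s * \<sigma> s \<omega>) I"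
    "(\<integral>\<^sup>+\<omega>. ennreal ((I \<omega>)\<^sup>2) \<partial>M) \<le> 2 * (ennreal C * (\<integral>\<^sup>+s. ennreal ((k s)\<^sup>2) \<partial>lborel))"
proof -
  have "(\<lambda>w. k (fst w)) \<in> borel_measurable Pred"
    by (rule measurable_compose[OF fst_Pred k])
  then have p: "predictable_process M F (\<lambda>s \<omega>. k s * \<sigma> s \<omega>)"
    using \<sigma> unfolding predictable_process_def case_prod_unfold by (rule borel_measurable_times)
  have sm: "\<sigma> s \<in> borel_measurable M" for s
    using measurable_Pair2[OF Pred_measurable_pair[OF \<sigma>[unfolded predictable_process_def]], of s] by simp
  have "energy (\<lambda>(s, \<omega>). k s * \<sigma> s \<omega>) = (\<integral>\<^sup>+s. (\<integral>\<^sup>+\<omega>. ennreal ((k s)\<^sup>2) * ennreal ((\<sigma> s \<omega>)\<^sup>2) \<partial>M) \<partial>lborel)"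
    using energy_iterated(2)[OF p[unfolded predictable_process_def]]
    by (simp add: power_mult_distrib ennreal_mult)
  also have "\<dots> \<le> (\<integral>\<^sup>+s. ennreal ((k s)\<^sup>2) * ennreal C \<partial>lborel)"
    using sm mom by (intro nn_integral_mono) (simp add: nn_integral_cmult mult_left_mono)
  also have "\<dots> = ennreal C * (\<integral>\<^sup>+s. ennreal ((k s)\<^sup>2) \<partial>lborel)"
    by (subst nn_integral_multc) (auto simp: mult.commute)
  finally have le: "energy (\<lambda>(s, \<omega>). k s * \<sigma> s \<omega>) \<le> ennreal C * (\<integral>\<^sup>+s. ennreal ((k s)\<^sup>2) \<partial>lborel)" .
  also have "\<dots> < \<infinity>" using k2 by (simp add: ennreal_mult_less_top)
  finally have fin: "energy (\<lambda>(s, \<omega>). k s * \<sigma> s \<omega>) < \<infinity>" .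
  show ?thesis
  proof (rule square_integrable_ito_exists[OF p fin])
    fix I assume I: "has_ito_integral M F B (\<lambda>s \<omega>. k s * \<sigma> s \<omega>) I"
      "(\<integral>\<^sup>+\<omega>. ennreal ((I \<omega>)\<^sup>2) \<partial>M) \<le> 2 * energy (\<lambda>(s, \<omega>). k s * \<sigma> s \<omega>)"
    show thesis by (rule that[OF I(1) order_trans[OF I(2) mult_left_mono[OF le]]]) simp
  qed
qed

lemma ito_integral_I: "has_ito_integral M F B \<phi> I \<Longrightarrow> has_ito_integral M F B \<phi> (ito_integral M F B \<phi>)"
  unfolding ito_integral_def by (rule someI[where P="\<lambda>I. has_ito_integral M F B \<phi> I"])

end

section \<open>Absolutely continuous modifications\<close>

text \<open>The integral over \<open>[0, N]\<close> of the squared derivative of the piecewise linear interpolation of \<open>f\<close> at the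
multiples of \<open>2\<^sup>-\<^sup>n\<close>.\<close>

definition dyadic_energy :: "nat \<Rightarrow> nat \<Rightarrow> (real \<Rightarrow> real) \<Rightarrow> real" where
  "dyadic_energy N n f = (\<Sum>j<N * 2^n. 2^n * (f (real (Suc j) / 2^n) - f (real j / 2^n))\<^sup>2)"

lemma dyadic_energy_nonneg: "dyadic_energy N n f \<ge> 0"
  unfolding dyadic_energy_def by (intro sum_nonneg) simp

text \<open>An increment over a cell is the sum of the increments over its two halves, and
\<open>(x + y)\<^sup>2 \<le> 2 (x\<^sup>2 + y\<^sup>2)\<close>.\<close>

lemma dyadic_energy_Suc: "dyadic_energy N n f \<le> dyadic_energy N (Suc n) f"
proof -
  let ?d = "\<lambda>j. f (real (Suc j) / 2^Suc n) - f (real j / 2^Suc n)"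
  have "dyadic_energy N (Suc n) f = (\<Sum>j<N * 2^n. \<Sum>i=j*2..<j*2+2. 2^Suc n * (?d i)\<^sup>2)"
  proof -
    have e: "N * 2^Suc n = N * 2^n * 2" by simp
    show ?thesis unfolding dyadic_energy_def e by (rule sum.nat_group[symmetric])
  qed
  also have "\<dots> = (\<Sum>j<N * 2^n. 2^Suc n * ((?d (2 * j))\<^sup>2 + (?d (Suc (2 * j)))\<^sup>2))"
  proof (intro sum.cong refl)
    fix j
    have "{j*2..<j*2+2} = {2 * j, Suc (2 * j)}" by auto
    then show "(\<Sum>i=j*2..<j*2+2. 2^Suc n * (?d i)\<^sup>2) = 2^Suc n * ((?d (2 * j))\<^sup>2 + (?d (Suc (2 * j)))\<^sup>2)"
      by (simp add: distrib_left)
  qed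
  finally have eq: "dyadic_energy N (Suc n) f = (\<Sum>j<N * 2^n. 2^Suc n * ((?d (2 * j))\<^sup>2 + (?d (Suc (2 * j)))\<^sup>2))" .
  show ?thesis
    unfolding eq unfolding dyadic_energy_def[of N n]
  proof (intro sum_mono)
    fix j
    have "real (Suc j) / 2^n = real (Suc (Suc (2 * j))) / 2^Suc n" "real j / 2^n = real (2 * j) / 2^Suc n"
      by (auto simp: field_simps)
    then have "f (real (Suc j) / 2^n) - f (real j / 2^n) = ?d (Suc (2 * j)) + ?d (2 * j)" by simp
    then have "(f (real (Suc j) / 2^n) - f (real j / 2^n))\<^sup>2 \<le> 2 * ((?d (2 * j))\<^sup>2 + (?d (Suc (2 * j)))\<^sup>2)"
      using square_add_le[of "?d (Suc (2 * j))" "?d (2 * j)"] by simp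
    then have "2^n * (f (real (Suc j) / 2^n) - f (real j / 2^n))\<^sup>2 \<le> 2^n * (2 * ((?d (2 * j))\<^sup>2 + (?d (Suc (2 * j)))\<^sup>2))"
      by (intro mult_left_mono) auto
    also have "\<dots> = 2^Suc n * ((?d (2 * j))\<^sup>2 + (?d (Suc (2 * j)))\<^sup>2)" by (simp only: power_Suc mult_ac)
    finally show "2^n * (f (real (Suc j) / 2^n) - f (real j / 2^n))\<^sup>2 \<le> 2^Suc n * ((?d (2 * j))\<^sup>2 + (?d (Suc (2 * j)))\<^sup>2)" .
  qed
qed

text \<open>The Cauchy-Schwarz inequality for the increments over all cells of the given intervals, whose number is
\<open>2\<^sup>n\<close> times the total length.\<close>

lemma dyadic_variation_bound:
  fixes p q :: "nat \<Rightarrow> nat"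
  assumes R: "dyadic_energy N n f \<le> R"
    and pq: "\<And>i. i < m \<Longrightarrow> p i \<le> q i \<and> q i \<le> N * 2^n"
    and dj: "disjoint_family_on (\<lambda>i. {p i..<q i}) {..<m}"
  shows "(\<Sum>i<m. \<bar>f (real (q i) / 2^n) - f (real (p i) / 2^n)\<bar>)\<^sup>2
    \<le> R * (\<Sum>i<m. real (q i) / 2^n - real (p i) / 2^n)"
proof -
  let ?d = "\<lambda>j. f (real (Suc j) / 2^n) - f (real j / 2^n)"
  define J where "J = (\<Union>i<m. {p i..<q i})"
  have J: "J \<subseteq> {..<N * 2^n}" using pq by (force simp: J_def)
  have fJ: "finite J" by (simp add: J_def)
  have dj': "\<forall>i\<in>{..<m}. \<forall>j\<in>{..<m}. i \<noteq> j \<longrightarrow> {p i..<q i} \<inter> {p j..<q j} = {}"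
    using dj by (auto simp: disjoint_family_on_def)
  have "(\<Sum>i<m. \<bar>f (real (q i) / 2^n) - f (real (p i) / 2^n)\<bar>) \<le> (\<Sum>i<m. \<Sum>j=p i..<q i. \<bar>?d j\<bar>)"
  proof (rule sum_mono)
    fix i assume "i \<in> {..<m}"
    then have "p i \<le> q i" using pq by simp
    from sum_Suc_diff'[OF this, of "\<lambda>j. f (real j / 2^n)"]
    have "f (real (q i) / 2^n) - f (real (p i) / 2^n) = (\<Sum>j=p i..<q i. ?d j)" by (rule sym)
    then show "\<bar>f (real (q i) / 2^n) - f (real (p i) / 2^n)\<bar> \<le> (\<Sum>j=p i..<q i. \<bar>?d j\<bar>)"
      by (simp only: sum_abs)
  qed
  also have "\<dots> = (\<Sum>j\<in>J. \<bar>?d j\<bar>)"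
    unfolding J_def by (rule sum.UNION_disjoint[symmetric]) (use dj' in auto)
  finally have le: "(\<Sum>i<m. \<bar>f (real (q i) / 2^n) - f (real (p i) / 2^n)\<bar>) \<le> (\<Sum>j\<in>J. \<bar>?d j\<bar>)" .
  have "card J = (\<Sum>i<m. q i - p i)"
    unfolding J_def by (subst card_UN_disjoint) (use dj' in auto)
  then have "real (card J) = (\<Sum>i<m. real (q i - p i))" by simp
  also have "\<dots> = (\<Sum>i<m. real (q i) - real (p i))"
    using pq by (intro sum.cong) (auto simp: of_nat_diff)
  finally have ceq: "real (card J) / 2^n = (\<Sum>i<m. real (q i) / 2^n - real (p i) / 2^n)"
    by (simp add: sum_divide_distrib diff_divide_distrib)
  have "(\<Sum>i<m. \<bar>f (real (q i) / 2^n) - f (real (p i) / 2^n)\<bar>)\<^sup>2 \<le> (\<Sum>j\<in>J. \<bar>?d j\<bar>)\<^sup>2"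
    by (intro power_mono le sum_nonneg) simp
  moreover have "(\<Sum>j\<in>J. \<bar>?d j\<bar>)\<^sup>2 \<le> (\<Sum>j\<in>J. \<bar>?d j\<bar>\<^sup>2) * real (card J)"
    by (rule sum_squared_le_sum_of_squares)
  moreover have "(\<Sum>j\<in>J. \<bar>?d j\<bar>\<^sup>2) * real (card J) \<le> R * (real (card J) / 2^n)"
  proof -
    have "2^n * (\<Sum>j\<in>J. \<bar>?d j\<bar>\<^sup>2) = (\<Sum>j\<in>J. 2^n * (?d j)\<^sup>2)" by (simp add: sum_distrib_left)
    also have "\<dots> \<le> dyadic_energy N n f"
      unfolding dyadic_energy_def by (intro sum_mono2 J) auto
    finally have "2^n * (\<Sum>j\<in>J. \<bar>?d j\<bar>\<^sup>2) \<le> R" using R by linarith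
    then have "(2^n * (\<Sum>j\<in>J. \<bar>?d j\<bar>\<^sup>2)) * (real (card J) / 2^n) \<le> R * (real (card J) / 2^n)"
      by (intro mult_right_mono) auto
    then show ?thesis by simp
  qed
  ultimately show ?thesis unfolding ceq[symmetric] by linarith
qed

definition dyadic_below :: "nat \<Rightarrow> real \<Rightarrow> real" where
  "dyadic_below n t = real (nat \<lfloor>2^n * t\<rfloor>) / 2^n"

lemma dyadic_below:
  assumes "t \<ge> 0"
  shows "dyadic_below n t \<ge> 0" "dyadic_below n t \<le> t" "t - dyadic_below n t \<le> (1/2)^n"
proof -
  have e: "real (nat \<lfloor>2^n * t\<rfloor>) = real_of_int \<lfloor>2^n * t\<rfloor>" using assms by simp
  show "dyadic_below n t \<ge> 0" by (simp add: dyadic_below_def)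
  have *: "real_of_int \<lfloor>2^n * t\<rfloor> \<le> 2^n * t" "2^n * t - real_of_int \<lfloor>2^n * t\<rfloor> \<le> 1" by linarith+
  then show "dyadic_below n t \<le> t"
    unfolding dyadic_below_def e by (simp add: field_simps)
  have "t - dyadic_below n t = (2^n * t - real_of_int \<lfloor>2^n * t\<rfloor>) / 2^n"
    unfolding dyadic_below_def e by (simp add: diff_divide_distrib)
  also have "\<dots> \<le> 1 / 2^n" using *(2) by (intro divide_right_mono) auto
  finally show "t - dyadic_below n t \<le> (1/2)^n" by (simp add: power_one_over)
qed

lemma dyadic_below_tendsto:
  assumes "t \<ge> 0"
  shows "(\<lambda>n. dyadic_below n t) \<longlonglongrightarrow> t"
proof (rule tendsto_sandwich[OF _ _ _ tendsto_const])
  have "(\<lambda>n. t - (1/2)^n) \<longlonglongrightarrow> t - 0"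
    by (intro tendsto_diff tendsto_const LIMSEQ_power_zero) simp
  then show "(\<lambda>n. t - (1/2)^n) \<longlonglongrightarrow> t" by simp
  show "\<forall>\<^sub>F n in sequentially. t - (1/2)^n \<le> dyadic_below n t"
    using dyadic_below(3)[OF assms] by (intro always_eventually) (auto simp: algebra_simps)
qed (use dyadic_below(2)[OF assms] in auto)

text \<open>By \<open>dyadic_variation_bound\<close>, a function whose dyadic energies are bounded by \<open>R\<close> is Hoelder continuous of
order 1/2 on the dyadic points and so extends to \<open>[0, \<infinity>)\<close>. The bound for the variation passes to the
extension: rounding endpoints down to the grid preserves their order and hence the disjointness of
intervals.\<close>

lemma dyadic_limit_absolutely_continuous:
  assumes bd: "\<And>N. \<exists>R. \<forall>n. dyadic_energy N n f \<le> R"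
  defines "V \<equiv> \<lambda>t. lim (\<lambda>n. f (dyadic_below n t))"
  shows "\<And>t. t \<ge> 0 \<Longrightarrow> (\<lambda>n. f (dyadic_below n t)) \<longlonglongrightarrow> V t"
    and "\<And>T. T \<ge> 0 \<Longrightarrow> absolutely_continuous_on_interval 0 T V"
proof -
  show lim: "(\<lambda>n. f (dyadic_below n t)) \<longlonglongrightarrow> V t" if t: "t \<ge> 0" for t
  proof -
    obtain N :: nat where N: "t \<le> real N" using real_arch_simple by blast
    obtain R where R: "\<And>n. dyadic_energy N n f \<le> R" using bd by blast
    have R0: "R \<ge> 0" using R dyadic_energy_nonneg order_trans by blast
    have step: "(f (dyadic_below m t) - f (dyadic_below n t))\<^sup>2 \<le> R * (1/2)^n" if mn: "n \<le> m" for m n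
    proof -
      \<comment> \<open>Both points are viewed as points of the finer grid.\<close>
      define p q where "p = nat \<lfloor>2^n * t\<rfloor> * 2^(m - n)" and "q = nat \<lfloor>2^m * t\<rfloor>"
      have pow: "(2::real)^m = 2^n * 2^(m - n)" using mn by (simp flip: power_add)
      have p: "real p / 2^m = dyadic_below n t" by (simp add: p_def dyadic_below_def pow)
      have q: "real q / 2^m = dyadic_below m t" by (simp add: q_def dyadic_below_def)
      have "real p \<le> 2^m * t"
        using dyadic_below(2)[OF t, of n] unfolding p[symmetric] by (simp add: field_simps)
      then have pq: "p \<le> q" unfolding q_def using t by (simp add: le_nat_floor)
      have "real q \<le> 2^m * t" using dyadic_below(2)[OF t, of m] unfolding q[symmetric] by (simp add: field_simps)
      also have "\<dots> \<le> 2^m * real N" using N by (intro mult_left_mono) auto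
      finally have "real q \<le> real (N * 2^m)" by (simp add: mult.commute)
      then have qN: "q \<le> N * 2^m" by (simp only: of_nat_le_iff)
      have "(\<Sum>i<Suc 0. \<bar>f (real q / 2^m) - f (real p / 2^m)\<bar>)\<^sup>2 \<le> R * (\<Sum>i<Suc 0. real q / 2^m - real p / 2^m)"
        by (rule dyadic_variation_bound[OF R]) (use pq qN in \<open>auto simp: disjoint_family_on_def\<close>)
      then have "(f (dyadic_below m t) - f (dyadic_below n t))\<^sup>2 \<le> R * (dyadic_below m t - dyadic_below n t)"
        by (simp add: p q)
      also have "\<dots> \<le> R * (1/2)^n"
        using dyadic_below(3)[OF t, of n] dyadic_below(2)[OF t, of m] R0 by (intro mult_left_mono) auto
      finally show ?thesis .
    qed
    have "Cauchy (\<lambda>n. f (dyadic_below n t))"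
      unfolding Cauchy_altdef
    proof (intro allI impI)
      fix e :: real assume e: "e > 0"
      have "(\<lambda>n. R * (1/2)^n) \<longlonglongrightarrow> R * 0"
        by (intro tendsto_mult tendsto_const LIMSEQ_power_zero) simp
      then have "\<forall>\<^sub>F n in sequentially. R * (1/2)^n < e\<^sup>2"
        using e by (intro order_tendstoD(2)) auto
      then obtain M where M: "\<And>n. n \<ge> M \<Longrightarrow> R * (1/2)^n < e\<^sup>2" by (auto simp: eventually_sequentially)
      have "dist (f (dyadic_below m t)) (f (dyadic_below n t)) < e" if "m \<ge> M" "n > m" for m n
      proof -
        have "(f (dyadic_below n t) - f (dyadic_below m t))\<^sup>2 < e\<^sup>2"
          using step[of m n] M[of m] that by simp
        then have "\<bar>f (dyadic_below n t) - f (dyadic_below m t)\<bar> < e"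
          using e by (intro power_less_imp_less_base[of _ 2 e]) auto
        then show ?thesis by (simp add: dist_real_def abs_minus_commute)
      qed
      then show "\<exists>M. \<forall>m\<ge>M. \<forall>n>m. dist (f (dyadic_below m t)) (f (dyadic_below n t)) < e" by blast
    qed
    then show ?thesis unfolding V_def by (simp add: Cauchy_convergent_iff convergent_LIMSEQ_iff)
  qed
  fix T :: real assume T: "T \<ge> 0"
  obtain N :: nat where N: "T \<le> real N" using real_arch_simple by blast
  obtain R where R: "\<And>n. dyadic_energy N n f \<le> R" using bd by blast
  have R0: "R \<ge> 0" using R dyadic_energy_nonneg order_trans by blast
  have key: "(\<Sum>i<m. \<bar>V (b i) - V (a i)\<bar>)\<^sup>2 \<le> R * (\<Sum>i<m. b i - a i)"
    if ab: "\<forall>i<m. 0 \<le> a i \<and> a i \<le> b i \<and> b i \<le> T"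
      and dj: "disjoint_family_on (\<lambda>i. {a i<..<b i}) {..<m}" for m :: nat and a b :: "nat \<Rightarrow> real"
  proof (rule LIMSEQ_le)
    show "(\<lambda>n. (\<Sum>i<m. \<bar>f (dyadic_below n (b i)) - f (dyadic_below n (a i))\<bar>)\<^sup>2) \<longlonglongrightarrow> (\<Sum>i<m. \<bar>V (b i) - V (a i)\<bar>)\<^sup>2"
      using ab by (intro tendsto_power tendsto_sum tendsto_rabs tendsto_diff lim) force+
    show "(\<lambda>n. R * (\<Sum>i<m. dyadic_below n (b i) - dyadic_below n (a i))) \<longlonglongrightarrow> R * (\<Sum>i<m. b i - a i)"
      using ab by (intro tendsto_mult tendsto_const tendsto_sum tendsto_diff dyadic_below_tendsto) force+
    show "\<exists>M. \<forall>n\<ge>M. (\<Sum>i<m. \<bar>f (dyadic_below n (b i)) - f (dyadic_below n (a i))\<bar>)\<^sup>2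
      \<le> R * (\<Sum>i<m. dyadic_below n (b i) - dyadic_below n (a i))"
    proof (intro exI allI impI)
      fix n :: nat
      show "(\<Sum>i<m. \<bar>f (dyadic_below n (b i)) - f (dyadic_below n (a i))\<bar>)\<^sup>2
        \<le> R * (\<Sum>i<m. dyadic_below n (b i) - dyadic_below n (a i))"
        unfolding dyadic_below_def
      proof (rule dyadic_variation_bound[OF R, where p="\<lambda>i. nat \<lfloor>2^n * a i\<rfloor>" and q="\<lambda>i. nat \<lfloor>2^n * b i\<rfloor>"])
        have mono: "nat \<lfloor>2^n * x\<rfloor> \<le> nat \<lfloor>2^n * y\<rfloor>" if "x \<le> y" for x y :: real
          using that by (intro nat_mono floor_mono mult_left_mono) auto
        show "nat \<lfloor>2^n * a i\<rfloor> \<le> nat \<lfloor>2^n * b i\<rfloor> \<and> nat \<lfloor>2^n * b i\<rfloor> \<le> N * 2^n" if "i < m" for i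
        proof -
          have "b i \<le> real N" using ab N that by force
          from mono[OF this] have "nat \<lfloor>2^n * b i\<rfloor> \<le> nat \<lfloor>2^n * real N\<rfloor>" .
          also have "nat \<lfloor>2^n * real N\<rfloor> = N * 2^n"
          proof -
            have "2^n * real N = real_of_int (int (N * 2^n))" by (simp add: mult.commute)
            then show ?thesis by (simp only: floor_of_int nat_int)
          qed
          finally show ?thesis using mono[of "a i" "b i"] ab that by simp
        qed
        show "disjoint_family_on (\<lambda>i. {nat \<lfloor>2^n * a i\<rfloor>..<nat \<lfloor>2^n * b i\<rfloor>}) {..<m}"
          unfolding disjoint_family_on_def
        proof (intro ballI impI)
          fix i j assume ij: "i \<in> {..<m}" "j \<in> {..<m}" "i \<noteq> j"
          then have "{a i<..<b i} \<inter> {a j<..<b j} = {}" using dj by (auto simp: disjoint_family_on_def)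
          then have *: "b i \<le> a j \<or> b j \<le> a i \<or> a i = b i \<or> a j = b j"
            using ab ij by (auto simp: Int_greaterThanLessThan max_def min_def split: if_splits)
          show "{nat \<lfloor>2^n * a i\<rfloor>..<nat \<lfloor>2^n * b i\<rfloor>} \<inter> {nat \<lfloor>2^n * a j\<rfloor>..<nat \<lfloor>2^n * b j\<rfloor>} = {}"
          proof -
            have disj: "{x..<y} \<inter> {z..<w} = {}" if "y \<le> z \<or> w \<le> x \<or> x = y \<or> z = w" for x y z w :: nat
              using that by auto
            show ?thesis
              by (rule disj, use * in \<open>elim disjE\<close>) (simp_all only: mono simp_thms)
          qed
        qed
      qed
    qed
  qed
  show "absolutely_continuous_on_interval 0 T V"
    unfolding absolutely_continuous_on_interval_def
  proof (intro allI impI)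
    fix \<epsilon> :: real assume \<epsilon>: "\<epsilon> > 0"
    \<comment> \<open>Here \<open>R + 1\<close> instead of \<open>R\<close> avoids a division by 0.\<close>
    define \<delta> where "\<delta> = \<epsilon>\<^sup>2 / (R + 1)"
    have \<delta>: "\<delta> > 0" using \<epsilon> R0 by (simp add: \<delta>_def)
    show "\<exists>\<delta>>0. \<forall>(n::nat) a b. (\<forall>i<n. 0 \<le> a i \<and> a i \<le> b i \<and> b i \<le> T) \<and>
        disjoint_family_on (\<lambda>i. {a i<..<b i}) {..<n} \<and> (\<Sum>i<n. b i - a i) < \<delta> \<longrightarrow>
        (\<Sum>i<n. \<bar>V (b i) - V (a i)\<bar>) < \<epsilon>"
    proof (intro exI[of _ \<delta>] conjI \<delta> allI impI, elim conjE)
      fix n :: nat and a b :: "nat \<Rightarrow> real"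
      assume *: "\<forall>i<n. 0 \<le> a i \<and> a i \<le> b i \<and> b i \<le> T" "disjoint_family_on (\<lambda>i. {a i<..<b i}) {..<n}"
        and less: "(\<Sum>i<n. b i - a i) < \<delta>"
      have "(\<Sum>i<n. \<bar>V (b i) - V (a i)\<bar>)\<^sup>2 \<le> R * (\<Sum>i<n. b i - a i)" by (rule key[OF *])
      also have "\<dots> \<le> R * \<delta>" using less R0 by (intro mult_left_mono) auto
      also have "\<dots> < (R + 1) * \<delta>" using \<delta> by (simp add: distrib_right)
      also have "\<dots> = \<epsilon>\<^sup>2" using R0 by (simp add: \<delta>_def)
      finally show "(\<Sum>i<n. \<bar>V (b i) - V (a i)\<bar>) < \<epsilon>"
        using \<epsilon> by (intro power_less_imp_less_base[of _ 2 \<epsilon>]) auto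
    qed
  qed
qed

text \<open>The Lipschitz condition bounds the expectation of the dyadic energy over \<open>[0, N]\<close> by \<open>N C\<close>, uniformly in
the level. By monotone convergence almost every path has bounded dyadic energies on each \<open>[0, N]\<close>, so
that the limit along dyadic points is absolutely continuous; it is a modification because \<open>W\<close> is
continuous in mean square.\<close>

theorem (in prob_space) absolutely_continuous_modification:
  fixes W :: "real \<Rightarrow> 'a \<Rightarrow> real"
  assumes W[measurable]: "\<And>t. t \<ge> 0 \<Longrightarrow> W t \<in> borel_measurable M"
    and lip: "\<And>N::nat. \<exists>C\<ge>0. \<forall>u t. 0 \<le> u \<and> u \<le> t \<and> t \<le> real N \<longrightarrow>
      (\<integral>\<^sup>+\<omega>. ennreal ((W t \<omega> - W u \<omega>)\<^sup>2) \<partial>M) \<le> ennreal (C * (t - u)\<^sup>2)"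
  obtains V where "\<And>t. t \<ge> 0 \<Longrightarrow> AE \<omega> in M. V t \<omega> = W t \<omega>"
    "AE \<omega> in M. \<forall>T\<ge>0. absolutely_continuous_on_interval 0 T (\<lambda>t. V t \<omega>)"
proof -
  define S where "S N n \<omega> = dyadic_energy N n (\<lambda>t. W t \<omega>)" for N n \<omega>
  have Sm[measurable]: "S N n \<in> borel_measurable M" for N n
    unfolding S_def dyadic_energy_def by (intro borel_measurable_sum borel_measurable_times
        borel_measurable_power borel_measurable_diff borel_measurable_const W) auto
  have bounded: "AE \<omega> in M. \<exists>R. \<forall>n. S N n \<omega> \<le> R" for N
  proof -
    obtain C where C0: "C \<ge> 0" and C: "\<And>u t. 0 \<le> u \<Longrightarrow> u \<le> t \<Longrightarrow> t \<le> real N \<Longrightarrow>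
      (\<integral>\<^sup>+\<omega>. ennreal ((W t \<omega> - W u \<omega>)\<^sup>2) \<partial>M) \<le> ennreal (C * (t - u)\<^sup>2)"
      using lip[of N] by blast
    have E: "(\<integral>\<^sup>+\<omega>. ennreal (S N n \<omega>) \<partial>M) \<le> ennreal (real N * C)" for n
    proof -
      have "(\<integral>\<^sup>+\<omega>. ennreal (S N n \<omega>) \<partial>M)
        = (\<integral>\<^sup>+\<omega>. (\<Sum>j<N * 2^n. ennreal (2^n) * ennreal ((W (real (Suc j) / 2^n) \<omega> - W (real j / 2^n) \<omega>)\<^sup>2)) \<partial>M)"
        unfolding S_def dyadic_energy_def
        by (intro nn_integral_cong, subst sum_ennreal[symmetric]) (auto intro!: sum.cong simp: ennreal_mult)
      also have "\<dots> = (\<Sum>j<N * 2^n. ennreal (2^n) * (\<integral>\<^sup>+\<omega>. ennreal ((W (real (Suc j) / 2^n) \<omega> - W (real j / 2^n) \<omega>)\<^sup>2) \<partial>M))"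
        by (subst nn_integral_sum) (auto intro!: sum.cong nn_integral_cmult)
      also have "\<dots> \<le> (\<Sum>j<N * 2^n. ennreal (2^n) * ennreal (C * (real (Suc j) / 2^n - real j / 2^n)\<^sup>2))"
      proof (intro sum_mono mult_left_mono C)
        fix j assume "j \<in> {..<N * 2^n}"
        then have "real (Suc j) \<le> real (N * 2^n)" by (simp only: of_nat_le_iff) simp
        then show "real (Suc j) / 2^n \<le> real N" by (simp add: field_simps)
      qed (auto simp: divide_right_mono)
      also have "\<dots> = (\<Sum>j<N * 2^n. ennreal (C / 2^n))"
      proof (intro sum.cong refl)
        fix j
        have "real (Suc j) / 2^n - real j / 2^n = 1 / 2^n" by (simp add: field_simps)
        then show "ennreal (2^n) * ennreal (C * (real (Suc j) / 2^n - real j / 2^n)\<^sup>2) = ennreal (C / 2^n)"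
          using C0 by (subst ennreal_mult[symmetric]) (auto simp: power2_eq_square)
      qed
      also have "\<dots> = ennreal (real N * C)"
        using C0 by (subst sum_ennreal) auto
      finally show ?thesis .
    qed
    have inc: "incseq (\<lambda>n \<omega>. ennreal (S N n \<omega>))"
      by (intro incseq_SucI le_funI ennreal_leI) (simp add: S_def dyadic_energy_Suc)
    have "(\<integral>\<^sup>+\<omega>. (SUP n. ennreal (S N n \<omega>)) \<partial>M) = (SUP n. \<integral>\<^sup>+\<omega>. ennreal (S N n \<omega>) \<partial>M)"
      by (rule nn_integral_monotone_convergence_SUP[OF inc]) measurable
    also have "\<dots> \<le> ennreal (real N * C)" by (intro SUP_least E)
    finally have "AE \<omega> in M. (SUP n. ennreal (S N n \<omega>)) \<noteq> \<infinity>"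
      by (intro nn_integral_PInf_AE) (auto simp: top_unique)
    then show ?thesis
    proof eventually_elim
      case (elim \<omega>)
      then obtain R where R: "R \<ge> 0" "(SUP n. ennreal (S N n \<omega>)) = ennreal R"
        by (cases "SUP n. ennreal (S N n \<omega>)") auto
      have "ennreal (S N n \<omega>) \<le> ennreal R" for n unfolding R(2)[symmetric] by (rule SUP_upper) simp
      then show ?case using R(1) by (intro exI[of _ R]) (simp add: ennreal_le_iff)
    qed
  qed
  then have good: "AE \<omega> in M. \<forall>N. \<exists>R. \<forall>n. S N n \<omega> \<le> R" by (simp add: AE_all_countable)
  define V where "V t \<omega> = lim (\<lambda>n. W (dyadic_below n t) \<omega>)" for t \<omega>
  have Vlim: "AE \<omega> in M. (\<lambda>n. W (dyadic_below n t) \<omega>) \<longlonglongrightarrow> V t \<omega>" if "t \<ge> 0" for t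
    using good
  proof eventually_elim
    case (elim \<omega>)
    then show ?case
      using dyadic_limit_absolutely_continuous(1)[of "\<lambda>t. W t \<omega>" t] that by (simp add: S_def V_def)
  qed
  have AC: "AE \<omega> in M. \<forall>T\<ge>0. absolutely_continuous_on_interval 0 T (\<lambda>t. V t \<omega>)"
    using good
  proof eventually_elim
    case (elim \<omega>)
    then show ?case
      using dyadic_limit_absolutely_continuous(2)[of "\<lambda>t. W t \<omega>"] by (simp add: S_def V_def)
  qed
  have eq: "AE \<omega> in M. V t \<omega> = W t \<omega>" if t: "t \<ge> 0" for t
  proof -
    note [measurable] = W[OF t] W[OF dyadic_below(1)[OF t]]
    obtain N :: nat where N: "t \<le> real N" using real_arch_simple by blast
    obtain C where C0: "C \<ge> 0" and C: "\<And>u t. 0 \<le> u \<Longrightarrow> u \<le> t \<Longrightarrow> t \<le> real N \<Longrightarrow>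
      (\<integral>\<^sup>+\<omega>. ennreal ((W t \<omega> - W u \<omega>)\<^sup>2) \<partial>M) \<le> ennreal (C * (t - u)\<^sup>2)"
      using lip[of N] by blast
    have [measurable]: "V t \<in> borel_measurable M" unfolding V_def by measurable
    have "(\<integral>\<^sup>+\<omega>. ennreal ((W t \<omega> - V t \<omega>)\<^sup>2) \<partial>M) \<le> 0"
    proof (rule nn_integral_Fatou_bound)
      show "AE \<omega> in M. (\<lambda>n. ennreal ((W t \<omega> - W (dyadic_below n t) \<omega>)\<^sup>2)) \<longlonglongrightarrow> ennreal ((W t \<omega> - V t \<omega>)\<^sup>2)"
        using Vlim[OF t] by eventually_elim (intro tendsto_ennrealI tendsto_power tendsto_diff tendsto_const)
      show "(\<integral>\<^sup>+\<omega>. ennreal ((W t \<omega> - W (dyadic_below n t) \<omega>)\<^sup>2) \<partial>M) \<le> ennreal (C * (t - dyadic_below n t)\<^sup>2)" for n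
        using dyadic_below[OF t, of n] N by (intro C) auto
      have "(\<lambda>n. C * (t - dyadic_below n t)\<^sup>2) \<longlonglongrightarrow> C * (t - t)\<^sup>2"
        by (intro tendsto_mult tendsto_const tendsto_power tendsto_diff dyadic_below_tendsto t)
      then have "(\<lambda>n. C * (t - dyadic_below n t)\<^sup>2) \<longlonglongrightarrow> 0" by simp
      from tendsto_ennrealI[OF this]
      show "(\<lambda>n. ennreal (C * (t - dyadic_below n t)\<^sup>2)) \<longlonglongrightarrow> 0" by simp
    qed measurable
    then have "AE \<omega> in M. ennreal ((W t \<omega> - V t \<omega>)\<^sup>2) = 0"
      by (subst nn_integral_0_iff_AE[symmetric]) auto
    then show ?thesis by eventually_elim (simp add: ennreal_eq_0_iff)
  qed
  show ?thesis by (rule that[OF eq AC])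
qed

section \<open>Integrals of powers\<close>

lemma nn_integral_powr_interval:
  fixes a :: real
  assumes "a > -1" "r \<ge> 0"
  shows "(\<integral>\<^sup>+v. ennreal (v powr a) * indicator {0..r} v \<partial>lborel) = ennreal (r powr (a + 1) / (a + 1))"
  by (rule nn_integral_has_integral_lebesgue'[OF _ has_integral_powr_from_0[OF assms]]) simp

lemma nn_integral_powr_tail:
  fixes a :: real
  assumes "a < -1" "c > 0"
  shows "(\<integral>\<^sup>+v. ennreal (v powr a) * indicator {c..} v \<partial>lborel) = ennreal (- (c powr (a + 1)) / (a + 1))"
  by (rule nn_integral_has_integral_lebesgue'[OF _ has_integral_powr_to_inf[OF assms]]) simp

lemma nn_integral_shifted_powr:
  fixes a :: real
  assumes "r \<ge> 0" "a \<noteq> 1"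
  shows "(\<integral>\<^sup>+v. ennreal ((1 + r - v) powr (- a)) * indicator {0..r} v \<partial>lborel)
    = ennreal (((1 + r) powr (1 - a) - 1) / (1 - a))"
proof -
  have "(\<integral>\<^sup>+v. ennreal ((1 + r - v) powr (- a)) * indicator {0..r} v \<partial>lborel)
    = ennreal ((- ((1 + r - r) powr (1 - a) / (1 - a))) - (- ((1 + r - 0) powr (1 - a) / (1 - a))))"
  proof (rule nn_integral_FTC_Icc)
    fix x assume x: "x \<in> {0..r}"
    show "((\<lambda>v. - ((1 + r - v) powr (1 - a) / (1 - a))) has_real_derivative (1 + r - x) powr (- a)) (at x)"
    proof -
      have "((\<lambda>v. 1 + r - v) has_real_derivative - 1) (at x)" by (auto intro!: derivative_eq_intros)
      from DERIV_fun_powr[OF this, of "1 - a"]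
      have "((\<lambda>v. (1 + r - v) powr (1 - a)) has_real_derivative (1 - a) * (1 + r - x) powr (1 - a - 1) * - 1) (at x)"
        using x by simp
      from DERIV_cmult[OF this, of "- 1 / (1 - a)"]
      have "((\<lambda>v. - ((1 + r - v) powr (1 - a) / (1 - a))) has_real_derivative (1 + r - x) powr (- a)) (at x)"
        using assms by simp
      then show ?thesis .
    qed
  qed (use assms in auto)
  also have "(- ((1 + r - r) powr (1 - a) / (1 - a))) - (- ((1 + r - 0) powr (1 - a) / (1 - a))) = ((1 + r) powr (1 - a) - 1) / (1 - a)"
    by (simp add: diff_divide_distrib)
  finally show ?thesis .
qed

section \<open>Square-integrable functions on the line\<close>

definition square_integrable :: "(real \<Rightarrow> real) \<Rightarrow> bool" where
  "square_integrable f \<longleftrightarrow> f \<in> borel_measurable borel \<and> (\<integral>\<^sup>+s. ennreal ((f s)\<^sup>2) \<partial>lborel) < \<infinity>"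

lemma square_integrable_measurable: "square_integrable f \<Longrightarrow> f \<in> borel_measurable borel"
  by (simp add: square_integrable_def)

lemma square_integrable_bound:
  assumes g: "square_integrable g" and f: "f \<in> borel_measurable borel"
    and le: "\<And>s. \<bar>f s\<bar> \<le> c * \<bar>g s\<bar>"
  shows "square_integrable f"
proof -
  note [measurable] = f square_integrable_measurable[OF g]
  have "(f s)\<^sup>2 \<le> c\<^sup>2 * (g s)\<^sup>2" for s
    using power_mono[OF le, of s 2] by (simp add: power_mult_distrib)
  then have "(\<integral>\<^sup>+s. ennreal ((f s)\<^sup>2) \<partial>lborel) \<le> (\<integral>\<^sup>+s. ennreal (c\<^sup>2) * ennreal ((g s)\<^sup>2) \<partial>lborel)"
    by (intro nn_integral_mono) (simp add: ennreal_mult[symmetric] ennreal_leI)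
  also have "\<dots> = ennreal (c\<^sup>2) * (\<integral>\<^sup>+s. ennreal ((g s)\<^sup>2) \<partial>lborel)"
    by (rule nn_integral_cmult) measurable
  also have "\<dots> < \<infinity>" using g by (simp add: square_integrable_def ennreal_mult_less_top)
  finally show ?thesis using f by (simp add: square_integrable_def)
qed

lemma nn_integral_square_add_le:
  fixes f g :: "real \<Rightarrow> real"
  assumes "f \<in> borel_measurable borel" "g \<in> borel_measurable borel"
  shows "(\<integral>\<^sup>+s. ennreal ((f s + g s)\<^sup>2) \<partial>lborel)
    \<le> 2 * ((\<integral>\<^sup>+s. ennreal ((f s)\<^sup>2) \<partial>lborel) + (\<integral>\<^sup>+s. ennreal ((g s)\<^sup>2) \<partial>lborel))"
  using nn_integral_square_triangle[of f "\<lambda>_. 0" lborel "\<lambda>s. - g s"] assms by simp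

lemma square_integrable_add:
  assumes f: "square_integrable f" and g: "square_integrable g"
  shows "square_integrable (\<lambda>s. f s + g s)"
proof -
  note [measurable] = square_integrable_measurable[OF f] square_integrable_measurable[OF g]
  have "2 * ((\<integral>\<^sup>+s. ennreal ((f s)\<^sup>2) \<partial>lborel) + (\<integral>\<^sup>+s. ennreal ((g s)\<^sup>2) \<partial>lborel)) < \<infinity>"
    using f g by (simp add: square_integrable_def ennreal_mult_less_top)
  with nn_integral_square_add_le[of f g] have "(\<integral>\<^sup>+s. ennreal ((f s + g s)\<^sup>2) \<partial>lborel) < \<infinity>"
    by (auto intro: le_less_trans)
  then show ?thesis by (simp add: square_integrable_def)
qed

lemma square_integrable_cmult:
  assumes "square_integrable f"
  shows "square_integrable (\<lambda>s. c * f s)"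
  by (rule square_integrable_bound[OF assms, where c="\<bar>c\<bar>"])
    (use square_integrable_measurable[OF assms] in \<open>auto simp: abs_mult\<close>)

lemma square_integrable_diff:
  assumes "square_integrable f" "square_integrable g"
  shows "square_integrable (\<lambda>s. f s - g s)"
  using square_integrable_add[OF assms(1) square_integrable_cmult[OF assms(2), of "-1"]] by simp

lemma nn_integral_reflect:
  fixes f :: "real \<Rightarrow> ennreal"
  assumes [measurable]: "f \<in> borel_measurable borel"
  shows "(\<integral>\<^sup>+s. f (t - s) \<partial>lborel) = (\<integral>\<^sup>+s. f s \<partial>lborel)"
  using nn_integral_real_affine[OF assms, of "-1" t] by simp

lemma square_integrable_reflect:
  assumes f: "square_integrable f"
  shows "square_integrable (\<lambda>s. f (t - s))"
proof -
  note [measurable] = square_integrable_measurable[OF f]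
  show ?thesis
    using f nn_integral_reflect[of "\<lambda>s. ennreal ((f s)\<^sup>2)" t] by (simp add: square_integrable_def)
qed

lemma square_integrable_powr_0:
  fixes a :: real
  assumes "a > -1/2" "c \<ge> 0"
  shows "square_integrable (\<lambda>r. indicator {0..c} r * r powr a)"
proof -
  have "(\<integral>\<^sup>+r. ennreal ((indicator {0..c} r * r powr a)\<^sup>2) \<partial>lborel)
    = (\<integral>\<^sup>+r. ennreal (r powr (2 * a)) * indicator {0..c} r \<partial>lborel)"
    by (intro nn_integral_cong) (auto simp: power2_eq_square powr_add[symmetric] split: split_indicator)
  also have "\<dots> < \<infinity>" using assms by (subst nn_integral_powr_interval) auto
  finally show ?thesis by (simp add: square_integrable_def)
qed

lemma square_integrable_powr_inf:
  fixes a :: real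
  assumes "a < -1/2" "c > 0"
  shows "square_integrable (\<lambda>r. indicator {c..} r * r powr a)"
proof -
  have "(\<integral>\<^sup>+r. ennreal ((indicator {c..} r * r powr a)\<^sup>2) \<partial>lborel)
    = (\<integral>\<^sup>+r. ennreal (r powr (2 * a)) * indicator {c..} r \<partial>lborel)"
    by (intro nn_integral_cong) (auto simp: power2_eq_square powr_add[symmetric] split: split_indicator)
  also have "\<dots> < \<infinity>" using assms by (subst nn_integral_powr_tail) auto
  finally show ?thesis by (simp add: square_integrable_def)
qed

text \<open>A majorant with one power near 0 and another one at infinity.\<close>

definition two_powers :: "real \<Rightarrow> real \<Rightarrow> real \<Rightarrow> real \<Rightarrow> real" where
  "two_powers c a b r = (if r < 0 then 0 else if r \<le> c then r powr a else r powr b)"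

lemma two_powers_nonneg: "two_powers c a b r \<ge> 0"
  by (simp add: two_powers_def)

lemma two_powers_measurable [measurable]: "two_powers c a b \<in> borel_measurable borel"
  unfolding two_powers_def by measurable

lemma square_integrable_two_powers:
  assumes "a > -1/2" "b < -1/2" "c > 0"
  shows "square_integrable (two_powers c a b)"
proof (rule square_integrable_bound[where c=1])
  show "square_integrable (\<lambda>r. indicator {0..c} r * r powr a + indicator {c..} r * r powr b)"
    using assms by (intro square_integrable_add square_integrable_powr_0 square_integrable_powr_inf) auto
qed (auto simp: two_powers_def split: split_indicator)

lemma abs_set_integral_le:
  fixes f :: "real \<Rightarrow> real"
  assumes "(\<integral>\<^sup>+v. ennreal \<bar>f v\<bar> * indicator A v \<partial>lborel) \<le> ennreal K" "K \<ge> 0"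
  shows "\<bar>set_lebesgue_integral lborel A f\<bar> \<le> K"
proof (cases "set_integrable lborel A f")
  case True
  have "ennreal (norm (set_lebesgue_integral lborel A f)) \<le> (\<integral>\<^sup>+v. ennreal (norm (indicator A v *\<^sub>R f v)) \<partial>lborel)"
    using True unfolding set_lebesgue_integral_def set_integrable_def by (rule integral_norm_bound_ennreal)
  also have "\<dots> = (\<integral>\<^sup>+v. ennreal \<bar>f v\<bar> * indicator A v \<partial>lborel)"
    by (intro nn_integral_cong) (auto split: split_indicator)
  finally show ?thesis using assms order_trans by (fastforce simp: ennreal_le_iff)
next
  case False
  then have "set_lebesgue_integral lborel A f = 0"
    unfolding set_lebesgue_integral_def set_integrable_def by (rule not_integrable_integral_eq)
  then show ?thesis using assms by simp
qed

lemma nn_integral_const_bound: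
  fixes f g :: "real \<Rightarrow> real"
  assumes [measurable]: "g \<in> borel_measurable borel" "A \<in> sets borel"
    and le: "\<And>v. v \<in> A \<Longrightarrow> f v \<le> c * g v" and c: "c \<ge> 0" and g0: "\<And>v. v \<in> A \<Longrightarrow> g v \<ge> 0"
    and A: "A \<subseteq> A'" and int: "(\<integral>\<^sup>+v. ennreal (g v) * indicator A' v \<partial>lborel) \<le> ennreal I"
  shows "(\<integral>\<^sup>+v. ennreal (f v) * indicator A v \<partial>lborel) \<le> ennreal (c * I)"
proof -
  have "(\<integral>\<^sup>+v. ennreal (f v) * indicator A v \<partial>lborel) \<le> (\<integral>\<^sup>+v. ennreal c * (ennreal (g v) * indicator A v) \<partial>lborel)"
  proof (rule nn_integral_mono)
    fix v
    show "ennreal (f v) * indicator A v \<le> ennreal c * (ennreal (g v) * indicator A v)"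
      using le[of v] c g0[of v] by (auto simp: ennreal_mult[symmetric] ennreal_leI split: split_indicator)
  qed
  also have "\<dots> = ennreal c * (\<integral>\<^sup>+v. ennreal (g v) * indicator A v \<partial>lborel)"
    by (rule nn_integral_cmult) measurable
  also have "\<dots> \<le> ennreal c * (\<integral>\<^sup>+v. ennreal (g v) * indicator A' v \<partial>lborel)"
    using A by (intro mult_left_mono nn_integral_mono) (auto split: split_indicator)
  also have "\<dots> \<le> ennreal c * ennreal I" using int by (rule mult_left_mono) simp
  also have "\<dots> = ennreal (c * I)" using c by (simp add: ennreal_mult')
  finally show ?thesis .
qed

section \<open>Decay of functions of polynomial order\<close>

text \<open>A bound at infinity extends to \<open>[0, \<infinity>)\<close> by continuity once \<open>s\<close> is replaced by \<open>1 + s\<close>. The exponent is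
allowed to drop because later estimates are simplest for \<open>\<zeta> < 2\<close>.\<close>

lemma bigo_powr_bound:
  fixes f :: "real \<Rightarrow> real"
  assumes f: "continuous_on {0..} f" and O: "f \<in> O[at_top](\<lambda>s. s powr (- \<eta>))"
    and z: "0 \<le> \<zeta>" "\<zeta> \<le> \<eta>"
  obtains C where "C > 0" "\<And>y. y \<ge> 0 \<Longrightarrow> \<bar>f y\<bar> \<le> C * (1 + y) powr (- \<zeta>)"
proof -
  obtain c where c: "c > 0" "\<forall>\<^sub>F s in at_top. norm (f s) \<le> c * norm (s powr (- \<eta>))"
    using landau_o.bigE[OF O] by blast
  obtain S0 where S0: "\<And>s. s \<ge> S0 \<Longrightarrow> \<bar>f s\<bar> \<le> c * s powr (- \<eta>)"
    using c(2) by (auto simp: eventually_at_top_linorder)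
  define S where "S = max S0 1"
  have "compact (f ` {0..S})"
    by (intro compact_continuous_image continuous_on_subset[OF f]) auto
  then have "bounded (f ` {0..S})" by (rule compact_imp_bounded)
  then obtain K where K: "K > 0" "\<And>y. 0 \<le> y \<Longrightarrow> y \<le> S \<Longrightarrow> \<bar>f y\<bar> \<le> K"
    unfolding bounded_pos by auto
  define C where "C = max (K * (1 + S) powr \<zeta>) (c * 2 powr \<zeta>)"
  have "C > 0" using c(1) by (auto simp: C_def less_max_iff_disj)
  moreover have "\<bar>f y\<bar> \<le> C * (1 + y) powr (- \<zeta>)" if y: "y \<ge> 0" for y
  proof (cases "y \<le> S")
    case True
    have "\<bar>f y\<bar> \<le> K * 1" using K y True by simp
    also have "\<dots> \<le> K * ((1 + S) powr \<zeta> * (1 + y) powr (- \<zeta>))"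
    proof (rule mult_left_mono)
      have "(1 + y) powr \<zeta> \<le> (1 + S) powr \<zeta>" using True y z by (intro powr_mono2) auto
      then show "1 \<le> (1 + S) powr \<zeta> * (1 + y) powr (- \<zeta>)" using y by (simp add: powr_minus field_simps)
    qed (use K in simp)
    also have "\<dots> \<le> C * (1 + y) powr (- \<zeta>)"
      unfolding mult.assoc[symmetric] by (intro mult_right_mono) (auto simp: C_def)
    finally show ?thesis .
  next
    case False
    then have y1: "y \<ge> 1" "y \<ge> S0" by (auto simp: S_def)
    have "\<bar>f y\<bar> \<le> c * y powr (- \<eta>)" using S0 y1 by simp
    also have "\<dots> \<le> c * y powr (- \<zeta>)" using c y1 z by (intro mult_left_mono powr_mono) auto
    also have "\<dots> \<le> c * ((1 + y) / 2) powr (- \<zeta>)"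
      using c y1 z by (intro mult_left_mono powr_mono2') auto
    also have "((1 + y) / 2) powr (- \<zeta>) = 2 powr \<zeta> * (1 + y) powr (- \<zeta>)"
      using y by (simp add: powr_divide powr_minus field_simps)
    also have "c * (2 powr \<zeta> * (1 + y) powr (- \<zeta>)) \<le> C * (1 + y) powr (- \<zeta>)"
      unfolding mult.assoc[symmetric] by (intro mult_right_mono) (auto simp: C_def)
    finally show ?thesis .
  qed
  ultimately show ?thesis by (rule that)
qed

section \<open>The integral term of the kernel transform\<close>

text \<open>The integrands below are singular at \<open>v = 0\<close>, and they involve \<open>L\<close> and its derivatives at \<open>r - v\<close>, which
are large near \<open>v = r\<close>. The two terms of the majorant account for these two ends.\<close>

lemma abs_set_integral_two_bounds:
  fixes f :: "real \<Rightarrow> real"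
  assumes r: "r \<ge> 0" and a: "a \<noteq> 1" and b: "b > -1" and AB: "A \<ge> 0" "B \<ge> 0"
    and le: "\<And>v. 0 \<le> v \<Longrightarrow> v \<le> r \<Longrightarrow> \<bar>f v\<bar> \<le> A * v powr b + B * (1 + r - v) powr (- a)"
  shows "\<bar>set_lebesgue_integral lborel {0..r} f\<bar>
    \<le> A * (r powr (b + 1) / (b + 1)) + B * (((1 + r) powr (1 - a) - 1) / (1 - a))"
proof -
  have I0: "((1 + r) powr (1 - a) - 1) / (1 - a) \<ge> 0"
  proof (cases "a < 1")
    case True
    then have "(1 + r) powr (1 - a) \<ge> 1" using r by (intro ge_one_powr_ge_zero) auto
    then show ?thesis using True by simp
  next
    case False
    then have "(1 + r) powr (1 - a) \<le> (1 + r) powr 0" using r by (intro powr_mono) auto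
    then show ?thesis using False a r by (intro divide_nonpos_nonpos) auto
  qed
  show ?thesis
  proof (rule abs_set_integral_le)
    have "(\<integral>\<^sup>+v. ennreal \<bar>f v\<bar> * indicator {0..r} v \<partial>lborel)
      \<le> (\<integral>\<^sup>+v. ennreal A * (ennreal (v powr b) * indicator {0..r} v)
          + ennreal B * (ennreal ((1 + r - v) powr (- a)) * indicator {0..r} v) \<partial>lborel)"
    proof (rule nn_integral_mono)
      fix v
      show "ennreal \<bar>f v\<bar> * indicator {0..r} v \<le> ennreal A * (ennreal (v powr b) * indicator {0..r} v)
          + ennreal B * (ennreal ((1 + r - v) powr (- a)) * indicator {0..r} v)"
        using le[of v] AB
        by (auto simp: ennreal_mult[symmetric] ennreal_plus[symmetric] simp del: ennreal_plus
            intro!: ennreal_leI split: split_indicator)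
    qed
    also have "\<dots> = ennreal A * ennreal (r powr (b + 1) / (b + 1)) + ennreal B * ennreal (((1 + r) powr (1 - a) - 1) / (1 - a))"
      by (subst nn_integral_add, simp, simp)
        (simp add: nn_integral_cmult nn_integral_powr_interval[OF b r] nn_integral_shifted_powr[OF r a])
    also have "\<dots> = ennreal (A * (r powr (b + 1) / (b + 1)) + B * (((1 + r) powr (1 - a) - 1) / (1 - a)))"
    proof -
      have sum: "ennreal A * ennreal x + ennreal B * ennreal y = ennreal (A * x + B * y)" if "x \<ge> 0" "y \<ge> 0" for x y
        using AB that by (simp add: ennreal_mult)
      show ?thesis by (rule sum) (use b I0 in auto)
    qed
    finally show "(\<integral>\<^sup>+v. ennreal \<bar>f v\<bar> * indicator {0..r} v \<partial>lborel)
      \<le> ennreal (A * (r powr (b + 1) / (b + 1)) + B * (((1 + r) powr (1 - a) - 1) / (1 - a)))" .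
    show "0 \<le> A * (r powr (b + 1) / (b + 1)) + B * (((1 + r) powr (1 - a) - 1) / (1 - a))"
      using AB b I0 by (intro add_nonneg_nonneg mult_nonneg_nonneg) auto
  qed
qed

lemma mean_value_half_line:
  fixes f f' :: "real \<Rightarrow> real"
  assumes d: "\<And>s. 0 \<le> s \<Longrightarrow> (f has_real_derivative f' s) (at s within {0..})" and xy: "0 \<le> x" "x < y"
  obtains z where "x < z" "z < y" "f y - f x = (y - x) * f' z"
proof -
  have "continuous_on {0..} f"
    using d by (auto intro!: DERIV_continuous simp: continuous_on_eq_continuous_within)
  then have c: "continuous_on {x..y} f" by (rule continuous_on_subset) (use xy in auto)
  obtain z where z: "x < z" "z < y" "f y - f x = (\<lambda>h. f' z * h) (y - x)"
  proof (rule mvt[OF xy(2) c, of "\<lambda>z h. f' z * h"])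
    fix z assume "x < z" "z < y"
    then have "(f has_real_derivative f' z) (at z)"
      using d[of z] xy at_within_interior[of z "{0..}"] by (simp add: interior_real_atLeast)
    then show "(f has_derivative (\<lambda>h. f' z * h)) (at z)" by (simp add: has_field_derivative_def)
  qed
  then show ?thesis using that by (simp add: mult.commute)
qed

text \<open>The exponent may be assumed less than 2, since lowering it preserves the bounds. Then \<open>1 - \<zeta>\<close> lies in
\<open>(-1, 0)\<close>: the bound for \<open>L\<close> decays, but is not integrable, and its integral over \<open>[0, r]\<close> grows like
\<open>r\<^sup>2\<^sup>-\<^sup>\<zeta>\<close>.\<close>

locale decaying_kernel =
  fixes \<alpha> \<zeta> C :: real and L L' L'' :: "real \<Rightarrow> real"
  assumes alpha: "-1/2 < \<alpha>" "\<alpha> < 1/2"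
    and zeta: "\<alpha> + 3/2 < \<zeta>" "\<zeta> < 2"
    and L': "\<And>s. 0 \<le> s \<Longrightarrow> (L has_real_derivative L' s) (at s within {0..})"
    and L'': "\<And>s. 0 \<le> s \<Longrightarrow> (L' has_real_derivative L'' s) (at s within {0..})"
    and C: "C > 0"
    and L_bound: "\<And>y. 0 \<le> y \<Longrightarrow> \<bar>L y\<bar> \<le> C * (1 + y) powr (1 - \<zeta>)"
    and L'_bound: "\<And>y. 0 \<le> y \<Longrightarrow> \<bar>L' y\<bar> \<le> C * (1 + y) powr (- \<zeta>)"
    and L''_bound: "\<And>y. 0 \<le> y \<Longrightarrow> \<bar>L'' y\<bar> \<le> C * (1 + y) powr (- (\<zeta> + 1))"
begin

lemma zeta_gt_1: "\<zeta> > 1"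
  using alpha zeta by simp

text \<open>Nothing is known about \<open>L\<close> on the negative axis; this extension is Borel measurable on the whole line.\<close>

definition Lext :: "real \<Rightarrow> real" where
  "Lext x = L (max 0 x)"

lemma Lext_eq: "0 \<le> x \<Longrightarrow> Lext x = L x"
  by (simp add: Lext_def)

lemma continuous_L: "continuous_on {0..} L"
  using L' by (auto intro!: DERIV_continuous simp: continuous_on_eq_continuous_within)

lemma continuous_Lext: "continuous_on UNIV Lext"
  unfolding Lext_def
  by (rule continuous_on_compose2[OF continuous_L]) (auto intro!: continuous_intros)

lemma Lext_measurable [measurable]: "Lext \<in> borel_measurable borel"
  by (rule borel_measurable_continuous_onI[OF continuous_Lext])

lemma powr_le_1: "0 \<le> (x::real) \<Longrightarrow> a \<le> 0 \<Longrightarrow> (1 + x) powr a \<le> 1"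
  using powr_mono[of a 0 "1 + x"] by simp

lemma L_le: "0 \<le> y \<Longrightarrow> \<bar>L y\<bar> \<le> C"
proof -
  assume y: "0 \<le> y"
  have "C * (1 + y) powr (1 - \<zeta>) \<le> C * 1"
    using y C zeta_gt_1 by (intro mult_left_mono powr_le_1) auto
  with L_bound[OF y] show ?thesis by linarith
qed

lemma L_increment:
  assumes "0 \<le> x" "x \<le> y"
  shows "\<bar>L y - L x\<bar> \<le> (y - x) * (C * (1 + x) powr (- \<zeta>))"
proof (cases "x = y")
  case False
  with assms obtain z where z: "x < z" "L y - L x = (y - x) * L' z"
    using mean_value_half_line[OF L', of x y] by (metis less_le)
  have "\<bar>L' z\<bar> \<le> C * (1 + z) powr (- \<zeta>)" using z assms by (intro L'_bound) auto
  also have "\<dots> \<le> C * (1 + x) powr (- \<zeta>)"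
    using z assms C zeta_gt_1 by (intro mult_left_mono powr_mono2') auto
  finally show ?thesis using z assms by (simp add: abs_mult mult_left_mono)
qed simp

lemma L'_increment:
  assumes "0 \<le> x" "x \<le> y"
  shows "\<bar>L' y - L' x\<bar> \<le> (y - x) * (C * (1 + x) powr (- (\<zeta> + 1)))"
proof (cases "x = y")
  case False
  with assms obtain z where z: "x < z" "L' y - L' x = (y - x) * L'' z"
    using mean_value_half_line[OF L'', of x y] by (metis less_le)
  have "\<bar>L'' z\<bar> \<le> C * (1 + z) powr (- (\<zeta> + 1))" using z assms by (intro L''_bound) auto
  also have "\<dots> \<le> C * (1 + x) powr (- (\<zeta> + 1))"
    using z assms C zeta_gt_1 by (intro mult_left_mono powr_mono2') auto
  finally show ?thesis using z assms by (simp add: abs_mult mult_left_mono)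
qed simp

text \<open>By the mean value theorem applied to \<open>y \<mapsto> L (y + r - v) - L (y + r)\<close> on \<open>[0, h]\<close>, the second difference
is \<open>h\<close> times a difference of values of \<open>L'\<close> at distance \<open>v\<close>. The first bound is good for small \<open>v\<close>, the
second one for \<open>v\<close> comparable to \<open>r\<close>. Both are linear in \<open>h\<close> with coefficients not depending on \<open>h\<close>.\<close>

lemma L_second_difference:
  assumes v: "0 \<le> v" "v \<le> r" and h: "h > 0"
  shows "\<bar>(L (r + h - v) - L (r + h)) - (L (r - v) - L r)\<bar> \<le> h * (v * (C * (1 + r - v) powr (- (\<zeta> + 1))))"
    "\<bar>(L (r + h - v) - L (r + h)) - (L (r - v) - L r)\<bar> \<le> h * (2 * (C * (1 + r - v) powr (- \<zeta>)))"
proof -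
  define g where "g y = L (y + (r - v)) - L (y + r)" for y
  have d: "(g has_real_derivative L' (s + (r - v)) - L' (s + r)) (at s within {0..})" if "0 \<le> s" for s
  proof -
    have "((\<lambda>y. L (y + c)) has_real_derivative L' (s + c)) (at s within {0..})" if "c \<ge> 0" for c
    proof -
      have "(L has_real_derivative L' (s + c)) (at (s + c) within (\<lambda>y. y + c) ` {0..})"
        using that \<open>0 \<le> s\<close> by (intro DERIV_subset[OF L']) auto
      moreover have "((\<lambda>y. y + c) has_real_derivative 1) (at s within {0..})"
        by (auto intro!: derivative_eq_intros)
      ultimately show ?thesis using DERIV_image_chain[of L "L' (s + c)" "\<lambda>y. y + c" s "{0..}" 1]
        by (simp add: comp_def)
    qed
    from DERIV_diff[OF this[of "r - v"] this[of r]] show ?thesis unfolding g_def using v by simp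
  qed
  obtain z where z: "0 < z" "z < h" "g h - g 0 = (h - 0) * (L' (z + (r - v)) - L' (z + r))"
    using mean_value_half_line[OF d, of 0 h] h by auto
  have eq: "(L (r + h - v) - L (r + h)) - (L (r - v) - L r) = h * (L' (z + (r - v)) - L' (z + r))"
    using z(3) by (simp add: g_def algebra_simps)
  have le: "(1 + (z + (r - v))) powr (- a) \<le> (1 + r - v) powr (- a)" if "a \<ge> 0" for a
    using v z that by (intro powr_mono2') auto
  have "\<bar>L' (z + (r - v)) - L' (z + r)\<bar> \<le> v * (C * (1 + (z + (r - v))) powr (- (\<zeta> + 1)))"
    using L'_increment[of "z + (r - v)" "z + r"] v z by (simp add: abs_minus_commute)
  also have "\<dots> \<le> v * (C * (1 + r - v) powr (- (\<zeta> + 1)))"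
    using v C zeta_gt_1 by (intro mult_left_mono le) auto
  finally show "\<bar>(L (r + h - v) - L (r + h)) - (L (r - v) - L r)\<bar> \<le> h * (v * (C * (1 + r - v) powr (- (\<zeta> + 1))))"
    unfolding eq using h by (simp add: abs_mult mult_left_mono)
  have "\<bar>L' (z + (r - v)) - L' (z + r)\<bar> \<le> C * (1 + (z + (r - v))) powr (- \<zeta>) + C * (1 + (z + r)) powr (- \<zeta>)"
    using v z by (intro order_trans[OF abs_triangle_ineq4 add_mono] L'_bound) auto
  also have "\<dots> \<le> C * (1 + r - v) powr (- \<zeta>) + C * (1 + r - v) powr (- \<zeta>)"
    using v z C zeta_gt_1 by (intro add_mono mult_left_mono powr_mono2') auto
  finally show "\<bar>(L (r + h - v) - L (r + h)) - (L (r - v) - L r)\<bar> \<le> h * (2 * (C * (1 + r - v) powr (- \<zeta>)))"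
    unfolding eq using h by (simp add: abs_mult mult_left_mono)
qed

text \<open>The increment integrand of the kernel transform after the substitution \<open>u = s + v\<close>, with \<open>r = t - s\<close>. The
zero of \<open>L (r - v) - L r\<close> at \<open>v = 0\<close> compensates the singularity of the power, which need not be
integrable.\<close>

definition frac_integrand :: "real \<Rightarrow> real \<Rightarrow> real" where
  "frac_integrand r v = (L (r - v) - L r) * (\<alpha> * v powr (\<alpha> - 1))"

definition frac_remainder :: "real \<Rightarrow> real" where
  "frac_remainder r = set_lebesgue_integral lborel {0..r} (frac_integrand r)"

lemma powr_absorb: "0 \<le> v \<Longrightarrow> v * v powr (a - 1) = v powr a" for v a :: real
  by (cases "v = 0") (auto simp: powr_diff)

lemma frac_integrand_bound:
  assumes "0 \<le> v" "v \<le> r"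
  shows "\<bar>frac_integrand r v\<bar> \<le> C * \<bar>\<alpha>\<bar> * (1 + r - v) powr (- \<zeta>) * v powr \<alpha>"
    "\<bar>frac_integrand r v\<bar> \<le> C * \<bar>\<alpha>\<bar> * v powr \<alpha>"
proof -
  have "\<bar>L (r - v) - L r\<bar> \<le> v * (C * (1 + r - v) powr (- \<zeta>))"
    using L_increment[of "r - v" r] assms by (simp add: abs_minus_commute add_diff_eq)
  then have "\<bar>frac_integrand r v\<bar> \<le> v * (C * (1 + r - v) powr (- \<zeta>)) * (\<bar>\<alpha>\<bar> * v powr (\<alpha> - 1))"
    by (simp add: frac_integrand_def abs_mult mult_right_mono)
  also have "\<dots> = C * \<bar>\<alpha>\<bar> * (1 + r - v) powr (- \<zeta>) * (v * v powr (\<alpha> - 1))" by simp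
  also have "v * v powr (\<alpha> - 1) = v powr \<alpha>" by (rule powr_absorb) fact
  finally show 1: "\<bar>frac_integrand r v\<bar> \<le> C * \<bar>\<alpha>\<bar> * (1 + r - v) powr (- \<zeta>) * v powr \<alpha>" .
  have "(1 + r - v) powr (- \<zeta>) \<le> 1" using powr_le_1[of "r - v" "- \<zeta>"] assms zeta_gt_1 by (simp add: algebra_simps)
  then have "C * \<bar>\<alpha>\<bar> * (1 + r - v) powr (- \<zeta>) * v powr \<alpha> \<le> C * \<bar>\<alpha>\<bar> * 1 * v powr \<alpha>"
    using C by (intro mult_right_mono mult_left_mono) auto
  with 1 show "\<bar>frac_integrand r v\<bar> \<le> C * \<bar>\<alpha>\<bar> * v powr \<alpha>" by simp
qed

lemma frac_integrand_integrable: "set_integrable lborel {0..r} (frac_integrand r)"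
proof (cases "r \<ge> 0")
  case r: True
  have eq: "(\<lambda>v. indicator {0..r} v *\<^sub>R frac_integrand r v)
    = (\<lambda>v. indicator {0..r} v * ((Lext (r - v) - Lext r) * (\<alpha> * v powr (\<alpha> - 1))))"
    using r by (auto simp: fun_eq_iff frac_integrand_def Lext_eq split: split_indicator)
  show ?thesis
    unfolding set_integrable_def
  proof (rule integrableI_bounded)
    show "(\<lambda>v. indicator {0..r} v *\<^sub>R frac_integrand r v) \<in> borel_measurable lborel"
      unfolding eq by measurable
    have "(\<integral>\<^sup>+v. ennreal (norm (indicator {0..r} v *\<^sub>R frac_integrand r v)) \<partial>lborel)
      = (\<integral>\<^sup>+v. ennreal \<bar>frac_integrand r v\<bar> * indicator {0..r} v \<partial>lborel)"
      by (intro nn_integral_cong) (auto split: split_indicator)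
    also have "\<dots> \<le> ennreal (C * \<bar>\<alpha>\<bar> * (r powr (\<alpha> + 1) / (\<alpha> + 1)))"
      using frac_integrand_bound(2)[of _ r] C alpha r
      by (intro nn_integral_const_bound[where A'="{0..r}" and g="\<lambda>v. v powr \<alpha>"])
        (auto simp: nn_integral_powr_interval)
    finally show "(\<integral>\<^sup>+v. ennreal (norm (indicator {0..r} v *\<^sub>R frac_integrand r v)) \<partial>lborel) < \<infinity>"
      by (auto intro: le_less_trans)
  qed
qed (simp add: set_integrable_def)

lemma frac_remainder_measurable [measurable]: "frac_remainder \<in> borel_measurable borel"
proof -
  have "frac_remainder = (\<lambda>r. \<integral>v. (if 0 \<le> v \<and> v \<le> r then (Lext (r - v) - Lext r) * (\<alpha> * v powr (\<alpha> - 1)) else 0) \<partial>lborel)"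
    unfolding frac_remainder_def set_lebesgue_integral_def
    by (intro ext Bochner_Integration.integral_cong refl)
      (auto simp: frac_integrand_def Lext_eq split: split_indicator)
  moreover have "\<dots> \<in> borel_measurable borel"
    by (rule lborel.borel_measurable_lebesgue_integral) measurable
  ultimately show ?thesis by simp
qed

lemma frac_remainder_small:
  assumes "r \<ge> 0"
  shows "\<bar>frac_remainder r\<bar> \<le> C * \<bar>\<alpha>\<bar> / (\<alpha> + 1) * r powr (\<alpha> + 1)"
proof -
  have "\<bar>frac_remainder r\<bar> \<le> C * \<bar>\<alpha>\<bar> * (r powr (\<alpha> + 1) / (\<alpha> + 1)) + 0 * (((1 + r) powr (1 - 0) - 1) / (1 - 0))"
    unfolding frac_remainder_def
    using assms alpha C frac_integrand_bound(2)[of _ r] by (intro abs_set_integral_two_bounds) auto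
  then show ?thesis by simp
qed

lemma frac_remainder_nonpos: "r \<le> 0 \<Longrightarrow> frac_remainder r = 0"
  using frac_remainder_small[of 0] by (cases "r = 0") (simp_all add: frac_remainder_def set_lebesgue_integral_def)

lemma half_powr: "r > 0 \<Longrightarrow> (r / 2) powr a = 2 powr (- a) * r powr a" for r a :: real
  by (simp add: powr_divide powr_minus field_simps)

text \<open>For \<open>v \<le> r/2\<close> the increment of \<open>L\<close> is at most \<open>v\<close> times the bound for \<open>L'\<close> beyond \<open>r/2\<close>; for \<open>v > r/2\<close> the
power is at most \<open>(r/2)\<^sup>\<alpha>\<^sup>-\<^sup>1\<close>, and the integral of the bound for \<open>L\<close> is at most of order \<open>r\<^sup>2\<^sup>-\<^sup>\<zeta>\<close>. Both
parts are of order \<open>r\<^sup>\<alpha>\<^sup>+\<^sup>1\<^sup>-\<^sup>\<zeta>\<close>, which is square integrable at infinity as \<open>\<zeta> > \<alpha> + 3/2\<close>.\<close>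

lemma frac_remainder_large:
  obtains K where "K \<ge> 0" "\<And>r. r \<ge> 1 \<Longrightarrow> \<bar>frac_remainder r\<bar> \<le> K * r powr (\<alpha> + 1 - \<zeta>)"
proof -
  define K1 where "K1 = C * \<bar>\<alpha>\<bar> * 2 powr \<zeta> / (\<alpha> + 1)"
  define K2 where "K2 = 2 * C * \<bar>\<alpha>\<bar> * 2 powr (1 - \<alpha>) * 2 powr (2 - \<zeta>) / (2 - \<zeta>)"
  have K: "K1 \<ge> 0" "K2 \<ge> 0" using C alpha zeta by (auto simp: K1_def K2_def)
  have "\<bar>frac_remainder r\<bar> \<le> (K1 + K2) * r powr (\<alpha> + 1 - \<zeta>)" if r: "r \<ge> 1" for r
  proof -
    define A where "A = C * \<bar>\<alpha>\<bar> * (r / 2) powr (- \<zeta>)"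
    define B where "B = 2 * C * \<bar>\<alpha>\<bar> * (r / 2) powr (\<alpha> - 1)"
    have AB: "A \<ge> 0" "B \<ge> 0" using C by (auto simp: A_def B_def)
    have "\<bar>frac_remainder r\<bar> \<le> A * (r powr (\<alpha> + 1) / (\<alpha> + 1)) + B * (((1 + r) powr (1 - (\<zeta> - 1)) - 1) / (1 - (\<zeta> - 1)))"
      unfolding frac_remainder_def
    proof (intro abs_set_integral_two_bounds AB)
      fix v assume v: "0 \<le> v" "v \<le> r"
      show "\<bar>frac_integrand r v\<bar> \<le> A * v powr \<alpha> + B * (1 + r - v) powr (- (\<zeta> - 1))"
      proof (cases "v \<le> r / 2")
        case True
        have "\<bar>frac_integrand r v\<bar> \<le> C * \<bar>\<alpha>\<bar> * (1 + r - v) powr (- \<zeta>) * v powr \<alpha>"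
          by (rule frac_integrand_bound) fact+
        also have "\<dots> \<le> A * v powr \<alpha>"
          unfolding A_def using True v r C zeta_gt_1 by (intro mult_right_mono mult_left_mono powr_mono2') auto
        finally show ?thesis using AB by (simp add: add_increasing2)
      next
        case False
        have "\<bar>L (r - v) - L r\<bar> \<le> C * (1 + (r - v)) powr (1 - \<zeta>) + C * (1 + r) powr (1 - \<zeta>)"
          using v r by (intro order_trans[OF abs_triangle_ineq4 add_mono] L_bound) auto
        also have "\<dots> \<le> C * (1 + r - v) powr (1 - \<zeta>) + C * (1 + r - v) powr (1 - \<zeta>)"
          using v r C zeta_gt_1 powr_mono2'[of "1 - \<zeta>" "1 + r - v" "1 + r"]
          by (intro add_mono mult_left_mono) (auto simp: algebra_simps)
        finally have "\<bar>L (r - v) - L r\<bar> \<le> 2 * C * (1 + r - v) powr (1 - \<zeta>)" by simp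
        moreover have "v powr (\<alpha> - 1) \<le> (r / 2) powr (\<alpha> - 1)"
          using False alpha r by (intro powr_mono2') auto
        ultimately have "\<bar>L (r - v) - L r\<bar> * (\<bar>\<alpha>\<bar> * v powr (\<alpha> - 1))
            \<le> (2 * C * (1 + r - v) powr (1 - \<zeta>)) * (\<bar>\<alpha>\<bar> * (r / 2) powr (\<alpha> - 1))"
          using C by (intro mult_mono mult_left_mono) auto
        then have "\<bar>frac_integrand r v\<bar> \<le> B * (1 + r - v) powr (- (\<zeta> - 1))"
          by (simp add: frac_integrand_def abs_mult B_def mult_ac)
        then show ?thesis using AB by (simp add: add_increasing)
      qed
    qed (use r alpha zeta in auto)
    also have "\<dots> \<le> K1 * r powr (\<alpha> + 1 - \<zeta>) + K2 * r powr (\<alpha> + 1 - \<zeta>)"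
    proof (rule add_mono)
      have "r powr (- \<zeta>) * r powr (\<alpha> + 1) = r powr (\<alpha> + 1 - \<zeta>)"
        by (simp add: powr_add[symmetric] algebra_simps)
      moreover have "A * (r powr (\<alpha> + 1) / (\<alpha> + 1)) = K1 * (r powr (- \<zeta>) * r powr (\<alpha> + 1))"
        using r unfolding A_def K1_def by (subst half_powr) (auto simp: mult_ac)
      ultimately show "A * (r powr (\<alpha> + 1) / (\<alpha> + 1)) \<le> K1 * r powr (\<alpha> + 1 - \<zeta>)" by simp
      have "(1 + r) powr (2 - \<zeta>) \<le> (2 * r) powr (2 - \<zeta>)" using r zeta by (intro powr_mono2) auto
      also have "\<dots> = 2 powr (2 - \<zeta>) * r powr (2 - \<zeta>)" using r by (simp add: powr_mult)
      finally have "(1 + r) powr (2 - \<zeta>) - 1 \<le> 2 powr (2 - \<zeta>) * r powr (2 - \<zeta>)" by simp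
      then have "B * (((1 + r) powr (2 - \<zeta>) - 1) / (2 - \<zeta>)) \<le> B * (2 powr (2 - \<zeta>) * r powr (2 - \<zeta>) / (2 - \<zeta>))"
        using AB zeta by (intro mult_left_mono divide_right_mono) auto
      also have "\<dots> = K2 * (r powr (\<alpha> - 1) * r powr (2 - \<zeta>))"
        using r unfolding B_def K2_def by (subst half_powr) (auto simp: mult_ac)
      also have "r powr (\<alpha> - 1) * r powr (2 - \<zeta>) = r powr (\<alpha> + 1 - \<zeta>)"
        by (simp add: powr_add[symmetric] algebra_simps)
      finally show "B * (((1 + r) powr (1 - (\<zeta> - 1)) - 1) / (1 - (\<zeta> - 1))) \<le> K2 * r powr (\<alpha> + 1 - \<zeta>)"
        by simp
    qed
    finally show ?thesis by (simp add: distrib_right)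
  qed
  with that[of "K1 + K2"] K show ?thesis by auto
qed

lemma frac_remainder_square_integrable: "square_integrable frac_remainder"
proof -
  obtain K where K: "K \<ge> 0" "\<And>r. r \<ge> 1 \<Longrightarrow> \<bar>frac_remainder r\<bar> \<le> K * r powr (\<alpha> + 1 - \<zeta>)"
    by (rule frac_remainder_large, rule that, assumption+)
  define D where "D = C * \<bar>\<alpha>\<bar> / (\<alpha> + 1)"
  have D: "D \<ge> 0" using C alpha by (simp add: D_def)
  show ?thesis
  proof (rule square_integrable_bound[where c="K + D" and g="two_powers 1 (\<alpha> + 1) (\<alpha> + 1 - \<zeta>)"])
    show "square_integrable (two_powers 1 (\<alpha> + 1) (\<alpha> + 1 - \<zeta>))"
      using alpha zeta by (intro square_integrable_two_powers) auto
    show "\<bar>frac_remainder r\<bar> \<le> (K + D) * \<bar>two_powers 1 (\<alpha> + 1) (\<alpha> + 1 - \<zeta>) r\<bar>" for r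
    proof -
      consider "r \<le> 0" | "0 < r" "r \<le> 1" | "r > 1" by linarith
      then show ?thesis
      proof cases
        case 1
        then show ?thesis using frac_remainder_nonpos K D by simp
      next
        case 2
        then show ?thesis using frac_remainder_small[of r] K(1)
          by (simp add: two_powers_def D_def[symmetric] distrib_right add_increasing)
      next
        case 3
        then show ?thesis using K(2)[of r] D
          by (simp add: two_powers_def distrib_right add_increasing2)
      qed
    qed
  qed measurable
qed

text \<open>The increment of the integral splits into the increment of the integrand over \<open>[0, r]\<close>, estimated by
\<open>L_second_difference\<close>, and the integral over \<open>(r, r + h]\<close>, where the integrand is bounded by a multiple
of the majorant at \<open>r\<close>. The majorant is square integrable because \<open>-1/2 < \<alpha> < 1/2\<close>; the minimum of \<open>\<alpha>\<close> and
0 makes it bounded below near 0, and nonincreasing, also when \<open>\<alpha> > 0\<close>.\<close>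

lemma frac_remainder_increment:
  obtains K where "K \<ge> 0" "\<And>r h. r > 0 \<Longrightarrow> h > 0 \<Longrightarrow>
    \<bar>frac_remainder (r + h) - frac_remainder r\<bar> \<le> K * h * two_powers 1 (min \<alpha> 0) (\<alpha> - 1) r"
proof -
  define K1 where "K1 = C * \<bar>\<alpha>\<bar> * 2 powr (\<zeta> + 1) / (\<alpha> + 1)"
  define K2 where "K2 = 2 * C * \<bar>\<alpha>\<bar> * 2 powr (1 - \<alpha>) / (\<zeta> - 1)"
  define K3 where "K3 = 2 * C * \<bar>\<alpha>\<bar>"
  have K: "K1 \<ge> 0" "K2 \<ge> 0" "K3 \<ge> 0" using C alpha zeta_gt_1 by (auto simp: K1_def K2_def K3_def)
  have main: "\<bar>frac_remainder (r + h) - frac_remainder r\<bar> \<le> (K1 + K2 + K3 + K3) * h * two_powers 1 (min \<alpha> 0) (\<alpha> - 1) r"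
    if r: "r > 0" and h: "h > 0" for r h
  proof -
    let ?n = "two_powers 1 (min \<alpha> 0) (\<alpha> - 1) r"
    have n1: "?n \<ge> 1" if "r \<le> 1"
    proof -
      have "r powr 0 \<le> r powr min \<alpha> 0" using that r by (intro powr_mono') auto
      then show ?thesis using that r by (simp add: two_powers_def)
    qed
    have un: "{0..r + h} = {0..r} \<union> {r<..r + h}" using r h by auto
    have i1: "set_integrable lborel {0..r} (frac_integrand (r + h))"
      by (rule set_integrable_subset[OF frac_integrand_integrable[of "r + h"]]) (use h in auto)
    have i2: "set_integrable lborel {r<..r + h} (frac_integrand (r + h))"
      by (rule set_integrable_subset[OF frac_integrand_integrable[of "r + h"]]) (use r in auto)
    have split: "frac_remainder (r + h) - frac_remainder r
      = set_lebesgue_integral lborel {0..r} (\<lambda>v. frac_integrand (r + h) v - frac_integrand r v)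
        + set_lebesgue_integral lborel {r<..r + h} (frac_integrand (r + h))"
      unfolding frac_remainder_def un
      by (subst set_integral_Un[OF _ i1 i2], force)
        (simp add: set_integral_diff(2)[OF i1 frac_integrand_integrable])
    let ?d = "\<lambda>v. frac_integrand (r + h) v - frac_integrand r v"
    have d: "?d v = ((L (r + h - v) - L (r + h)) - (L (r - v) - L r)) * (\<alpha> * v powr (\<alpha> - 1))" for v
      by (simp add: frac_integrand_def algebra_simps)
    have d1: "\<bar>?d v\<bar> \<le> h * (C * \<bar>\<alpha>\<bar> * (1 + r - v) powr (- (\<zeta> + 1)) * v powr \<alpha>)"
      and d2: "\<bar>?d v\<bar> \<le> h * (2 * C * \<bar>\<alpha>\<bar> * (1 + r - v) powr (- \<zeta>) * v powr (\<alpha> - 1))"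
      if v: "0 \<le> v" "v \<le> r" for v
    proof -
      have "\<bar>?d v\<bar> \<le> h * (v * (C * (1 + r - v) powr (- (\<zeta> + 1)))) * (\<bar>\<alpha>\<bar> * v powr (\<alpha> - 1))"
        unfolding d using L_second_difference(1)[OF v h] by (simp add: abs_mult mult_right_mono)
      also have "\<dots> = h * (C * \<bar>\<alpha>\<bar> * (1 + r - v) powr (- (\<zeta> + 1)) * (v * v powr (\<alpha> - 1)))" by simp
      finally show "\<bar>?d v\<bar> \<le> h * (C * \<bar>\<alpha>\<bar> * (1 + r - v) powr (- (\<zeta> + 1)) * v powr \<alpha>)"
        using powr_absorb[OF v(1), of \<alpha>] by simp
      have "\<bar>?d v\<bar> \<le> h * (2 * (C * (1 + r - v) powr (- \<zeta>))) * (\<bar>\<alpha>\<bar> * v powr (\<alpha> - 1))"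
        unfolding d using L_second_difference(2)[OF v h] by (simp add: abs_mult mult_right_mono)
      then show "\<bar>?d v\<bar> \<le> h * (2 * C * \<bar>\<alpha>\<bar> * (1 + r - v) powr (- \<zeta>) * v powr (\<alpha> - 1))"
        by (simp add: mult_ac)
    qed
    have first: "\<bar>set_lebesgue_integral lborel {0..r} ?d\<bar> \<le> h * ((K1 + K2 + K3) * ?n)"
    proof (cases "r \<le> 1")
      case True
      have "\<bar>set_lebesgue_integral lborel {0..r} ?d\<bar>
        \<le> h * (C * \<bar>\<alpha>\<bar>) * (r powr (\<alpha> + 1) / (\<alpha> + 1)) + 0 * (((1 + r) powr (1 - 0) - 1) / (1 - 0))"
      proof (rule abs_set_integral_two_bounds)
        fix v assume v: "0 \<le> v" "v \<le> r"
        have "(1 + r - v) powr (- (\<zeta> + 1)) \<le> 1"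
          using powr_le_1[of "r - v" "- (\<zeta> + 1)"] v zeta_gt_1 by (simp add: algebra_simps)
        then have "h * (C * \<bar>\<alpha>\<bar> * (1 + r - v) powr (- (\<zeta> + 1)) * v powr \<alpha>) \<le> h * (C * \<bar>\<alpha>\<bar> * 1 * v powr \<alpha>)"
          using h C by (intro mult_right_mono mult_left_mono) auto
        with d1[OF v] show "\<bar>?d v\<bar> \<le> h * (C * \<bar>\<alpha>\<bar>) * v powr \<alpha> + 0 * (1 + r - v) powr (- 0)" by simp
      qed (use r h C alpha in auto)
      also have "\<dots> \<le> h * (C * \<bar>\<alpha>\<bar>) * 2"
      proof -
        have "r powr (\<alpha> + 1) \<le> 1" using True r alpha powr_mono2[of "\<alpha> + 1" r 1] by simp
        then have "r powr (\<alpha> + 1) / (\<alpha> + 1) \<le> 2" using alpha by (simp add: field_simps)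
        then have "h * (C * \<bar>\<alpha>\<bar>) * (r powr (\<alpha> + 1) / (\<alpha> + 1)) \<le> h * (C * \<bar>\<alpha>\<bar>) * 2"
          using h C by (intro mult_left_mono) auto
        then show ?thesis by simp
      qed
      also have "\<dots> = h * (K3 * 1)" by (simp add: K3_def)
      also have "\<dots> \<le> h * ((K1 + K2 + K3) * ?n)"
        using h K n1[OF True] by (intro mult_left_mono mult_mono) auto
      finally show ?thesis .
    next
      case False
      then have r1: "r > 1" by simp
      define A where "A = h * (C * \<bar>\<alpha>\<bar> * (r / 2) powr (- (\<zeta> + 1)))"
      define B where "B = h * (2 * C * \<bar>\<alpha>\<bar> * (r / 2) powr (\<alpha> - 1))"
      have AB: "A \<ge> 0" "B \<ge> 0" using C h by (auto simp: A_def B_def)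
      have "\<bar>set_lebesgue_integral lborel {0..r} ?d\<bar>
        \<le> A * (r powr (\<alpha> + 1) / (\<alpha> + 1)) + B * (((1 + r) powr (1 - \<zeta>) - 1) / (1 - \<zeta>))"
      proof (intro abs_set_integral_two_bounds AB)
        fix v assume v: "0 \<le> v" "v \<le> r"
        show "\<bar>?d v\<bar> \<le> A * v powr \<alpha> + B * (1 + r - v) powr (- \<zeta>)"
        proof (cases "v \<le> r / 2")
          case True
          have "h * (C * \<bar>\<alpha>\<bar> * (1 + r - v) powr (- (\<zeta> + 1)) * v powr \<alpha>)
              \<le> h * (C * \<bar>\<alpha>\<bar> * (r / 2) powr (- (\<zeta> + 1)) * v powr \<alpha>)"
            using True v r1 h C zeta_gt_1 by (intro mult_right_mono mult_left_mono powr_mono2') auto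
          also have "\<dots> = A * v powr \<alpha>" by (simp add: A_def)
          finally show ?thesis using d1[OF v] AB by (simp add: add_increasing2)
        next
          case False
          have "v powr (\<alpha> - 1) \<le> (r / 2) powr (\<alpha> - 1)"
            using False alpha r1 by (intro powr_mono2') auto
          then have "h * (2 * C * \<bar>\<alpha>\<bar> * (1 + r - v) powr (- \<zeta>) * v powr (\<alpha> - 1))
              \<le> h * (2 * C * \<bar>\<alpha>\<bar> * (1 + r - v) powr (- \<zeta>) * (r / 2) powr (\<alpha> - 1))"
            using h C by (intro mult_left_mono) auto
          also have "\<dots> = B * (1 + r - v) powr (- \<zeta>)" by (simp add: B_def)
          finally show ?thesis using d2[OF v] AB by (simp add: add_increasing)
        qed
      qed (use r1 alpha zeta_gt_1 in auto)
      also have "\<dots> \<le> h * (K1 * r powr (\<alpha> - 1)) + h * (K2 * r powr (\<alpha> - 1))"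
      proof (rule add_mono)
        have "r powr (- (\<zeta> + 1)) * r powr (\<alpha> + 1) = r powr (\<alpha> - \<zeta>)"
          by (simp add: powr_add[symmetric] algebra_simps)
        moreover have "r powr (\<alpha> - \<zeta>) \<le> r powr (\<alpha> - 1)" using r1 zeta_gt_1 by (intro powr_mono) auto
        ultimately have le: "r powr (- (\<zeta> + 1)) * r powr (\<alpha> + 1) \<le> r powr (\<alpha> - 1)" by simp
        have "A * (r powr (\<alpha> + 1) / (\<alpha> + 1)) = h * (K1 * (r powr (- (\<zeta> + 1)) * r powr (\<alpha> + 1)))"
          using r1 unfolding A_def K1_def by (subst half_powr) (auto simp: mult_ac add.commute)
        also have "\<dots> \<le> h * (K1 * r powr (\<alpha> - 1))" using h K le by (intro mult_left_mono) auto
        finally show "A * (r powr (\<alpha> + 1) / (\<alpha> + 1)) \<le> h * (K1 * r powr (\<alpha> - 1))" .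
        have "((1 + r) powr (1 - \<zeta>) - 1) / (1 - \<zeta>) = (1 - (1 + r) powr (1 - \<zeta>)) / (\<zeta> - 1)"
          using zeta_gt_1 by (simp add: field_simps)
        also have "\<dots> \<le> 1 / (\<zeta> - 1)" using zeta_gt_1 by (intro divide_right_mono) auto
        finally have "B * (((1 + r) powr (1 - \<zeta>) - 1) / (1 - \<zeta>)) \<le> B * (1 / (\<zeta> - 1))"
          using AB by (intro mult_left_mono) auto
        also have "\<dots> = h * (K2 * r powr (\<alpha> - 1))"
          using r1 unfolding B_def K2_def by (subst half_powr) (auto simp: mult_ac)
        finally show "B * (((1 + r) powr (1 - \<zeta>) - 1) / (1 - \<zeta>)) \<le> h * (K2 * r powr (\<alpha> - 1))" .
      qed
      also have "\<dots> = h * ((K1 + K2) * ?n)" using r1 by (simp add: two_powers_def algebra_simps)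
      also have "\<dots> \<le> h * ((K1 + K2 + K3) * ?n)"
        using h K by (intro mult_left_mono mult_right_mono two_powers_nonneg) auto
      finally show ?thesis .
    qed
    have second: "\<bar>set_lebesgue_integral lborel {r<..r + h} (frac_integrand (r + h))\<bar> \<le> h * (K3 * ?n)"
    proof (rule abs_set_integral_le)
      have pt: "\<bar>frac_integrand (r + h) v\<bar> \<le> K3 * ?n" if v: "r < v" "v \<le> r + h" for v
      proof -
        have v0: "0 < v" using v r by simp
        have b1: "\<bar>frac_integrand (r + h) v\<bar> \<le> C * \<bar>\<alpha>\<bar> * v powr \<alpha>"
          using v v0 by (intro frac_integrand_bound(2)) auto
        have "\<bar>L (r + h - v) - L (r + h)\<bar> \<le> C + C"
          using v r h by (intro order_trans[OF abs_triangle_ineq4 add_mono] L_le) auto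
        then have "\<bar>L (r + h - v) - L (r + h)\<bar> * (\<bar>\<alpha>\<bar> * v powr (\<alpha> - 1)) \<le> (C + C) * (\<bar>\<alpha>\<bar> * v powr (\<alpha> - 1))"
          by (intro mult_right_mono) auto
        then have b2: "\<bar>frac_integrand (r + h) v\<bar> \<le> K3 * v powr (\<alpha> - 1)"
          by (simp add: frac_integrand_def abs_mult K3_def)
        consider "v \<le> 1" | "v > 1" "r \<le> 1" | "r > 1" by linarith
        then show ?thesis
        proof cases
          case 1
          have "v powr \<alpha> \<le> v powr min \<alpha> 0" using 1 v0 by (intro powr_mono') auto
          also have "\<dots> \<le> r powr min \<alpha> 0" using v r by (intro powr_mono2') auto
          finally have "v powr \<alpha> \<le> ?n" using 1 v r by (simp add: two_powers_def)
          then have "C * \<bar>\<alpha>\<bar> * v powr \<alpha> \<le> C * \<bar>\<alpha>\<bar> * ?n" using C by (intro mult_left_mono) auto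
          also have "\<dots> \<le> K3 * ?n" using C by (intro mult_right_mono two_powers_nonneg) (simp add: K3_def)
          finally show ?thesis using b1 by simp
        next
          case 2
          have "v powr (\<alpha> - 1) \<le> v powr 0" using 2 alpha by (intro powr_mono) auto
          also have "\<dots> \<le> ?n" using n1 2 by simp
          finally have "K3 * v powr (\<alpha> - 1) \<le> K3 * ?n" using K by (intro mult_left_mono) auto
          then show ?thesis using b2 by simp
        next
          case 3
          then have "v powr (\<alpha> - 1) \<le> r powr (\<alpha> - 1)" using v r alpha by (intro powr_mono2') auto
          also have "\<dots> = ?n" using 3 by (simp add: two_powers_def)
          finally have "K3 * v powr (\<alpha> - 1) \<le> K3 * ?n" using K by (intro mult_left_mono) auto
          then show ?thesis using b2 by simp
        qed
      qed
      have "(\<integral>\<^sup>+v. ennreal \<bar>frac_integrand (r + h) v\<bar> * indicator {r<..r + h} v \<partial>lborel)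
        \<le> (\<integral>\<^sup>+v. ennreal (K3 * ?n) * indicator {r<..r + h} v \<partial>lborel)"
        using pt by (intro nn_integral_mono) (auto intro!: ennreal_leI split: split_indicator)
      also have "\<dots> = ennreal (K3 * ?n) * ennreal h"
        using h by (simp add: nn_integral_cmult)
      also have "\<dots> = ennreal (h * (K3 * ?n))"
        using h K by (simp add: ennreal_mult[symmetric] two_powers_nonneg mult_ac)
      finally show "(\<integral>\<^sup>+v. ennreal \<bar>frac_integrand (r + h) v\<bar> * indicator {r<..r + h} v \<partial>lborel) \<le> ennreal (h * (K3 * ?n))" .
    qed (use h K in \<open>auto intro!: mult_nonneg_nonneg two_powers_nonneg\<close>)
    have "\<bar>frac_remainder (r + h) - frac_remainder r\<bar> \<le> h * ((K1 + K2 + K3) * ?n) + h * (K3 * ?n)"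
      unfolding split by (rule order_trans[OF abs_triangle_ineq add_mono[OF first second]])
    then show ?thesis by (simp add: algebra_simps)
  qed
  show ?thesis by (rule that[OF _ main]) (use K in auto)
qed

end

section \<open>Kernels of the stochastic integrals\<close>

lemma pos_powr_measurable [measurable]: "(\<lambda>x. pos_powr x a) \<in> borel_measurable borel"
  unfolding pos_powr_def by measurable

lemma pos_powr_nonpos: "x \<le> 0 \<Longrightarrow> pos_powr x a = 0"
  by (simp add: pos_powr_def)

lemma pos_powr_pos: "0 \<le> x \<Longrightarrow> pos_powr x a = x powr a"
  by (simp add: pos_powr_def)

lemma pos_powr_nonneg: "0 \<le> pos_powr x a"
  by (simp add: pos_powr_def)

lemma square_integrable_translate:
  assumes "square_integrable f"
  shows "square_integrable (\<lambda>s. f (t + s))"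
  using square_integrable_reflect[OF square_integrable_reflect[OF assms, of 0], of "- t"]
  by (simp add: add.commute)

lemma powr_increment_bound:
  fixes a :: real
  assumes m: "0 < m" "m \<le> x" "m \<le> y" and a: "a \<le> 1"
  shows "\<bar>y powr a - x powr a\<bar> \<le> \<bar>y - x\<bar> * (\<bar>a\<bar> * m powr (a - 1))"
proof -
  have *: "\<bar>y powr a - x powr a\<bar> \<le> (y - x) * (\<bar>a\<bar> * m powr (a - 1))" if "m \<le> x" "x < y" for x y
  proof -
    have "\<exists>z. z > x \<and> z < y \<and> y powr a - x powr a = (y - x) * (a * z powr (a - 1))"
      using that m by (intro MVT2) (auto intro!: derivative_eq_intros)
    then obtain z where z: "z > x" "y powr a - x powr a = (y - x) * (a * z powr (a - 1))" by blast
    have "z powr (a - 1) \<le> m powr (a - 1)" using z that m a by (intro powr_mono2') auto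
    then show ?thesis using z that by (simp add: abs_mult mult_left_mono)
  qed
  show ?thesis
    using *[of x y] *[of y x] m by (cases x y rule: linorder_cases) (auto simp: abs_minus_commute)
qed

text \<open>Far in the past the two powers nearly cancel: their difference is of order \<open>\<bar>s\<bar>\<^sup>a\<^sup>-\<^sup>1\<close> by the mean value
theorem. On a bounded interval each of them is square integrable because \<open>a > -1/2\<close>.\<close>

lemma fractional_kernel_square_integrable:
  fixes a t :: real
  assumes a: "-1/2 < a" "a < 1/2"
  shows "square_integrable (\<lambda>s. indicator {..t} s * (pos_powr (t - s) a - pos_powr (- s) a))"
proof -
  define b where "b = 2 * \<bar>t\<bar> + 1"
  define g where "g x = indicator {0..t + b} (t + x) * (t + x) powr a + indicator {0..b} x * x powr a
    + (\<bar>t\<bar> * (\<bar>a\<bar> * 2 powr (1 - a))) * (indicator {b..} x * x powr (a - 1))" for x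
  have b: "b > 0" "t + b \<ge> 0" by (auto simp: b_def)
  have "square_integrable g"
    unfolding g_def using a b
    by (intro square_integrable_add square_integrable_cmult square_integrable_powr_inf
        square_integrable_powr_0 square_integrable_translate[of "\<lambda>x. indicator {0..t + b} x * x powr a"]) auto
  then have "square_integrable (\<lambda>x. indicator {- t..} x * (pos_powr (t + x) a - pos_powr x a))"
  proof (rule square_integrable_bound[where c=1])
    fix x
    have gx: "g x \<ge> 0" by (simp add: g_def)
    show "\<bar>indicator {- t..} x * (pos_powr (t + x) a - pos_powr x a)\<bar> \<le> 1 * \<bar>g x\<bar>"
    proof (cases "x \<le> b")
      case True
      have "pos_powr (t + x) a = indicator {0..t + b} (t + x) * (t + x) powr a"
        "pos_powr x a = indicator {0..b} x * x powr a"
        using True by (auto simp: pos_powr_def split: split_indicator)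
      then have "pos_powr (t + x) a + pos_powr x a \<le> g x" unfolding g_def by simp
      then show ?thesis
        using pos_powr_nonneg[of "t + x" a] pos_powr_nonneg[of x a] by (auto split: split_indicator)
    next
      case False
      then have x: "x > 0" "x / 2 \<le> x + t" "x \<ge> - t" unfolding b_def by linarith+
      have "\<bar>(t + x) powr a - x powr a\<bar> \<le> \<bar>(t + x) - x\<bar> * (\<bar>a\<bar> * (x / 2) powr (a - 1))"
        using x a by (intro powr_increment_bound) auto
      also have "(x / 2) powr (a - 1) = 2 powr (1 - a) * x powr (a - 1)"
        using x powr_minus[of 2 "a - 1"] by (simp add: powr_divide field_simps)
      finally have "\<bar>(t + x) powr a - x powr a\<bar> \<le> g x"
        using False by (simp add: g_def mult_ac add_increasing)
      then show ?thesis using x by (simp add: pos_powr_def)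
    qed
  qed measurable
  from square_integrable_reflect[OF this, of 0] show ?thesis
    by (rule square_integrable_bound[where c=1]) (auto split: split_indicator)
qed

context decaying_kernel
begin

lemma frac_kernel_deriv:
  assumes "s < u"
  shows "deriv (\<lambda>v. frac_kernel \<alpha> v s) u = \<alpha> * (u - s) powr (\<alpha> - 1)"
proof (rule DERIV_imp_deriv)
  have "((\<lambda>v. (v - s) powr \<alpha> - pos_powr (- s) \<alpha>) has_real_derivative \<alpha> * (u - s) powr (\<alpha> - 1)) (at u)"
    using assms by (auto intro!: derivative_eq_intros)
  then show "((\<lambda>v. frac_kernel \<alpha> v s) has_real_derivative \<alpha> * (u - s) powr (\<alpha> - 1)) (at u)"
    by (rule has_field_derivative_transform_within_open[where S="{s<..}"])
      (use assms in \<open>auto simp: frac_kernel_def pos_powr_def\<close>)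
qed

text \<open>The factor \<open>1 * v\<close> is the form required by the affine change of variables. At \<open>v = 0\<close>, where the kernel need
not be differentiable, both sides vanish because the increment of \<open>L\<close> does.\<close>

lemma increment_integrand_shift:
  "indicator {s..t} (s + 1 * v) *\<^sub>R kernel_increment_integrand (frac_kernel \<alpha>) (\<lambda>s. L (t - s)) s (s + 1 * v)
    = indicator {0..t - s} v *\<^sub>R frac_integrand (t - s) v"
proof (cases "v > 0")
  case True
  then show ?thesis
    using frac_kernel_deriv[of s "s + v"]
    by (auto simp: kernel_increment_integrand_def frac_integrand_def algebra_simps split: split_indicator)
next
  case False
  then show ?thesis
    by (cases "v = 0") (auto simp: kernel_increment_integrand_def frac_integrand_def split: split_indicator)
qed

lemma increment_integrand_integrable:
  "set_integrable lborel {s..t} (kernel_increment_integrand (frac_kernel \<alpha>) (\<lambda>s. L (t - s)) s)"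
  using frac_integrand_integrable[of "t - s"]
    lborel_integrable_real_affine_iff[of 1 "\<lambda>u. indicator {s..t} u *\<^sub>R
      kernel_increment_integrand (frac_kernel \<alpha>) (\<lambda>s. L (t - s)) s u" s]
  unfolding set_integrable_def increment_integrand_shift by simp

text \<open>The integral term depends on \<open>t - s\<close> only.\<close>

lemma kernel_transform_eq:
  "kernel_transform (frac_kernel \<alpha>) (\<lambda>s. L (t - s)) t s = L (t - s) * frac_kernel \<alpha> t s + frac_remainder (t - s)"
  using lborel_integral_real_affine[of 1 "\<lambda>u. indicator {s..t} u *\<^sub>R
      kernel_increment_integrand (frac_kernel \<alpha>) (\<lambda>s. L (t - s)) s u" s]
  unfolding kernel_transform_def frac_remainder_def set_lebesgue_integral_def increment_integrand_shift
  by simp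

text \<open>The point \<open>s = t\<close> is excluded because \<^const>\<open>frac_kernel\<close> vanishes there; so \<open>transform_kernel_eq\<close> below
holds at every point.\<close>

definition past_kernel :: "real \<Rightarrow> real \<Rightarrow> real" where
  "past_kernel t s = indicator {..<t} s * (L (t - s) * pos_powr (- s) \<alpha>)"

text \<open>The kernel of \<open>Y\<close>, as a function of \<open>t - s\<close>.\<close>

definition own_kernel :: "real \<Rightarrow> real" where
  "own_kernel r = indicator {0..} r * (L r * r powr \<alpha>)"

lemma past_kernel_measurable [measurable]: "past_kernel t \<in> borel_measurable borel"
proof -
  have "past_kernel t = (\<lambda>s. indicator {..<t} s * (Lext (t - s) * pos_powr (- s) \<alpha>))"
    by (auto simp: fun_eq_iff past_kernel_def Lext_eq split: split_indicator)
  then show ?thesis by simp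
qed

lemma past_kernel_square_integrable: "square_integrable (past_kernel t)"
proof -
  define b where "b = 2 * \<bar>t\<bar> + 1"
  have b: "b > 0" by (simp add: b_def)
  have "square_integrable (two_powers b \<alpha> (\<alpha> + 1 - \<zeta>))"
    using alpha zeta b by (intro square_integrable_two_powers) auto
  then have "square_integrable (\<lambda>x. past_kernel t (0 - x))"
  proof (rule square_integrable_bound[where c="C * 2 powr (\<zeta> - 1)"])
    fix x
    have two: "2 powr (\<zeta> - 1) \<ge> 1" using zeta_gt_1 by (intro ge_one_powr_ge_zero) auto
    consider "x \<le> 0 \<or> t + x \<le> 0" | "0 < x" "x \<le> b" "t + x > 0" | "x > b" "t + x > 0" by linarith
    then show "\<bar>past_kernel t (0 - x)\<bar> \<le> C * 2 powr (\<zeta> - 1) * \<bar>two_powers b \<alpha> (\<alpha> + 1 - \<zeta>) x\<bar>"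
    proof cases
      case 1
      then show ?thesis using C by (auto simp: past_kernel_def pos_powr_nonpos split: split_indicator)
    next
      case 2
      have "C * 1 \<le> C * 2 powr (\<zeta> - 1)" using two C by (intro mult_left_mono) auto
      then have "\<bar>L (t + x)\<bar> \<le> C * 2 powr (\<zeta> - 1)" using L_le[of "t + x"] 2 by linarith
      then have "\<bar>L (t + x)\<bar> * x powr \<alpha> \<le> C * 2 powr (\<zeta> - 1) * x powr \<alpha>"
        by (rule mult_right_mono) simp
      then show ?thesis using 2 by (simp add: past_kernel_def pos_powr_pos two_powers_def abs_mult)
    next
      case 3
      then have x: "x / 2 \<le> 1 + (t + x)" "x > 0" unfolding b_def by linarith+
      have "\<bar>L (t + x)\<bar> \<le> C * (1 + (t + x)) powr (1 - \<zeta>)" using 3 by (intro L_bound) auto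
      also have "\<dots> \<le> C * (x / 2) powr (1 - \<zeta>)"
        using x C zeta_gt_1 by (intro mult_left_mono powr_mono2') auto
      also have "\<dots> = C * 2 powr (\<zeta> - 1) * x powr (1 - \<zeta>)" using half_powr[of x "1 - \<zeta>"] x by simp
      finally have "\<bar>L (t + x)\<bar> * x powr \<alpha> \<le> C * 2 powr (\<zeta> - 1) * x powr (1 - \<zeta>) * x powr \<alpha>"
        by (intro mult_right_mono) auto
      also have "\<dots> = C * 2 powr (\<zeta> - 1) * x powr (\<alpha> + 1 - \<zeta>)"
        by (simp add: powr_add[symmetric] algebra_simps)
      finally show ?thesis using 3 x by (simp add: past_kernel_def pos_powr_pos two_powers_def abs_mult)
    qed
  qed measurable
  from square_integrable_reflect[OF this, of 0] show ?thesis by simp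
qed

lemma own_kernel_square_integrable:
  assumes L2: "set_integrable lborel {0..} (\<lambda>s. \<bar>L s * s powr \<alpha>\<bar>\<^sup>2)"
  shows "square_integrable own_kernel"
  unfolding square_integrable_def
proof
  have "own_kernel = (\<lambda>r. indicator {0..} r * (Lext r * r powr \<alpha>))"
    by (auto simp: fun_eq_iff own_kernel_def Lext_eq split: split_indicator)
  then show "own_kernel \<in> borel_measurable borel" by simp
  have "(\<integral>\<^sup>+s. ennreal (norm (indicator {0..} s *\<^sub>R \<bar>L s * s powr \<alpha>\<bar>\<^sup>2)) \<partial>lborel) < \<infinity>"
    using L2 unfolding set_integrable_def integrable_iff_bounded by blast
  also have "(\<integral>\<^sup>+s. ennreal (norm (indicator {0..} s *\<^sub>R \<bar>L s * s powr \<alpha>\<bar>\<^sup>2)) \<partial>lborel)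
    = (\<integral>\<^sup>+s. ennreal ((own_kernel s)\<^sup>2) \<partial>lborel)"
    by (intro nn_integral_cong) (auto simp: own_kernel_def split: split_indicator)
  finally show "(\<integral>\<^sup>+s. ennreal ((own_kernel s)\<^sup>2) \<partial>lborel) < \<infinity>" .
qed

text \<open>The kernel of \<open>Y\<^sup>X\<close>, supported by \<open>(-\<infinity>, t]\<close>.\<close>

definition transform_kernel :: "real \<Rightarrow> real \<Rightarrow> real" where
  "transform_kernel t s = indicator {..t} s * kernel_transform (frac_kernel \<alpha>) (\<lambda>s. L (t - s)) t s"

text \<open>This identity exhibits the cancellation: the kernel of \<open>Y\<close> splits off, and what remains is
\<open>difference_kernel\<close>.\<close>

lemma transform_kernel_eq: "transform_kernel t s = own_kernel (t - s) - past_kernel t s + frac_remainder (t - s)"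
proof -
  consider "s < t" | "s = t" | "s > t" by linarith
  then show ?thesis
  proof cases
    case 1
    then show ?thesis
      by (simp add: transform_kernel_def kernel_transform_eq own_kernel_def past_kernel_def frac_kernel_def
          pos_powr_pos algebra_simps)
  next
    case 2
    then show ?thesis
      by (simp add: transform_kernel_def kernel_transform_eq own_kernel_def past_kernel_def frac_kernel_def)
  next
    case 3
    then show ?thesis
      by (simp add: transform_kernel_def own_kernel_def past_kernel_def frac_remainder_nonpos)
  qed
qed

lemma transform_kernel_square_integrable:
  assumes "set_integrable lborel {0..} (\<lambda>s. \<bar>L s * s powr \<alpha>\<bar>\<^sup>2)"
  shows "square_integrable (transform_kernel t)"
proof -
  have "transform_kernel t = (\<lambda>s. own_kernel (t - s) - past_kernel t s + frac_remainder (t - s))"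
    by (simp add: fun_eq_iff transform_kernel_eq)
  then show ?thesis
    by (auto intro!: square_integrable_add square_integrable_diff past_kernel_square_integrable
        square_integrable_reflect own_kernel_square_integrable assms frac_remainder_square_integrable)
qed

theorem wiener_integrand:
  assumes "set_integrable lborel {0..} (\<lambda>s. \<bar>L s * s powr \<alpha>\<bar>\<^sup>2)"
  shows "(\<lambda>s. L (t - s)) \<in> wiener_integrands (frac_kernel \<alpha>) t"
proof -
  note sq = transform_kernel_square_integrable[OF assms, of t]
  have "(\<lambda>s. indicator {..t} s *\<^sub>R L (t - s)) = (\<lambda>s. indicator {..t} s * Lext (t - s))"
    by (auto simp: fun_eq_iff Lext_eq split: split_indicator)
  then have 1: "set_borel_measurable borel {..t} (\<lambda>s. L (t - s))"
    by (simp add: set_borel_measurable_def)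
  have tk: "(\<lambda>s. indicator {..t} s *\<^sub>R kernel_transform (frac_kernel \<alpha>) (\<lambda>s. L (t - s)) t s) = transform_kernel t"
    by (simp add: fun_eq_iff transform_kernel_def)
  have 2: "set_borel_measurable borel {..t} (kernel_transform (frac_kernel \<alpha>) (\<lambda>s. L (t - s)) t)"
    unfolding set_borel_measurable_def tk by (rule square_integrable_measurable[OF sq])
  have "integrable lborel (\<lambda>s. (transform_kernel t s)\<^sup>2)"
    using sq by (intro integrableI_bounded) (auto simp: square_integrable_def)
  moreover have "(\<lambda>s. indicator {..t} s *\<^sub>R (kernel_transform (frac_kernel \<alpha>) (\<lambda>s. L (t - s)) t s)\<^sup>2)
    = (\<lambda>s. (transform_kernel t s)\<^sup>2)"
    by (auto simp: fun_eq_iff transform_kernel_def split: split_indicator)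
  ultimately have 3: "set_integrable lborel {..t} (\<lambda>s. (kernel_transform (frac_kernel \<alpha>) (\<lambda>s. L (t - s)) t s)\<^sup>2)"
    by (simp add: set_integrable_def)
  show ?thesis
    unfolding wiener_integrands_def using 1 2 3 increment_integrand_integrable by simp
qed

definition difference_kernel :: "real \<Rightarrow> real \<Rightarrow> real" where
  "difference_kernel t s = frac_remainder (t - s) - past_kernel t s"

lemma difference_kernel_measurable [measurable]: "difference_kernel t \<in> borel_measurable borel"
  unfolding difference_kernel_def by measurable

lemma past_kernel_increment:
  assumes "0 \<le> u" "u \<le> t"
  shows "\<bar>past_kernel t s - past_kernel u s\<bar> \<le> (t - u) * (C * two_powers 1 \<alpha> (\<alpha> - \<zeta>) (- s))"
proof (cases "s < 0")
  case True
  have eq: "\<bar>past_kernel t s - past_kernel u s\<bar> = \<bar>L (t - s) - L (u - s)\<bar> * (- s) powr \<alpha>"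
    using True assms by (simp add: past_kernel_def pos_powr_pos abs_mult flip: left_diff_distrib)
  have "\<bar>L (t - s) - L (u - s)\<bar> \<le> (t - u) * (C * (1 + (u - s)) powr (- \<zeta>))"
    using L_increment[of "u - s" "t - s"] True assms by simp
  then have "\<bar>L (t - s) - L (u - s)\<bar> * (- s) powr \<alpha> \<le> (t - u) * (C * (1 + (u - s)) powr (- \<zeta>)) * (- s) powr \<alpha>"
    by (rule mult_right_mono) simp
  also have "\<dots> = (t - u) * (C * ((1 + (u - s)) powr (- \<zeta>) * (- s) powr \<alpha>))" by simp
  also have "\<dots> \<le> (t - u) * (C * two_powers 1 \<alpha> (\<alpha> - \<zeta>) (- s))"
  proof (intro mult_left_mono)
    show "(1 + (u - s)) powr (- \<zeta>) * (- s) powr \<alpha> \<le> two_powers 1 \<alpha> (\<alpha> - \<zeta>) (- s)"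
    proof (cases "- s \<le> 1")
      case le: True
      have "(1 + (u - s)) powr (- \<zeta>) \<le> 1" using True assms zeta_gt_1 by (intro powr_le_1) auto
      then have "(1 + (u - s)) powr (- \<zeta>) * (- s) powr \<alpha> \<le> 1 * (- s) powr \<alpha>" by (intro mult_right_mono) auto
      then show ?thesis using le True by (simp add: two_powers_def)
    next
      case False
      have "(1 + (u - s)) powr (- \<zeta>) \<le> (- s) powr (- \<zeta>)"
        using True assms zeta_gt_1 by (intro powr_mono2') auto
      then have "(1 + (u - s)) powr (- \<zeta>) * (- s) powr \<alpha> \<le> (- s) powr (- \<zeta>) * (- s) powr \<alpha>"
        by (intro mult_right_mono) auto
      also have "\<dots> = (- s) powr (\<alpha> - \<zeta>)" by (simp add: powr_add[symmetric])
      finally show ?thesis using False True by (simp add: two_powers_def)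
    qed
  qed (use assms C in auto)
  finally show ?thesis unfolding eq .
next
  case False
  then show ?thesis
    using assms C by (simp add: past_kernel_def pos_powr_nonpos two_powers_nonneg)
qed

text \<open>For \<open>s < u\<close> both parts of the kernel have increments bounded by \<open>h = t - u\<close> times a square-integrable
function whose norm does not depend on \<open>u\<close>. On \<open>[u, t]\<close> only the values of \<open>frac_remainder\<close> near 0 enter;
they are of order \<open>h\<^sup>\<alpha>\<^sup>+\<^sup>1\<close> on an interval of length \<open>h\<close>, and the resulting \<open>h\<^sup>2\<^sup>\<alpha>\<^sup>+\<^sup>3\<close> is
at most a multiple of \<open>h\<^sup>2\<close> for bounded \<open>h\<close>.\<close>

theorem difference_kernel_lipschitz:
  obtains K where "K \<ge> 0" "\<And>u t. 0 \<le> u \<Longrightarrow> u \<le> t \<Longrightarrow> t \<le> N \<Longrightarrow>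
    (\<integral>\<^sup>+s. ennreal ((difference_kernel t s - difference_kernel u s)\<^sup>2) \<partial>lborel) \<le> ennreal (K * (t - u)\<^sup>2)"
proof -
  obtain K1 where K1: "K1 \<ge> 0" "\<And>r h. r > 0 \<Longrightarrow> h > 0 \<Longrightarrow>
    \<bar>frac_remainder (r + h) - frac_remainder r\<bar> \<le> K1 * h * two_powers 1 (min \<alpha> 0) (\<alpha> - 1) r"
    by (rule frac_remainder_increment, rule that, assumption+)
  define n p where "n = two_powers 1 (min \<alpha> 0) (\<alpha> - 1)" and "p = two_powers 1 \<alpha> (\<alpha> - \<zeta>)"
  define D where "D = C * \<bar>\<alpha>\<bar> / (\<alpha> + 1)"
  have D: "D \<ge> 0" using C alpha by (simp add: D_def)
  have sq: "square_integrable (\<lambda>r. K1 * n r)" "square_integrable (\<lambda>r. C * p r)"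
    unfolding n_def p_def using alpha zeta
    by (auto intro!: square_integrable_cmult square_integrable_two_powers)
  note [measurable] = sq[THEN square_integrable_measurable]
  have "2 * ((\<integral>\<^sup>+s. ennreal ((K1 * n s)\<^sup>2) \<partial>lborel) + (\<integral>\<^sup>+s. ennreal ((C * p s)\<^sup>2) \<partial>lborel)) < \<infinity>"
    using sq by (simp add: square_integrable_def ennreal_mult_less_top)
  then obtain A where A: "A \<ge> 0"
    "2 * ((\<integral>\<^sup>+s. ennreal ((K1 * n s)\<^sup>2) \<partial>lborel) + (\<integral>\<^sup>+s. ennreal ((C * p s)\<^sup>2) \<partial>lborel)) = ennreal A"
    unfolding infinity_ennreal_def less_top_ennreal by blast
  define E where "E = D\<^sup>2 * (max N 1) powr (2 * \<alpha> + 1)"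
  have E: "E \<ge> 0" by (simp add: E_def)
  have main: "(\<integral>\<^sup>+s. ennreal ((difference_kernel t s - difference_kernel u s)\<^sup>2) \<partial>lborel) \<le> ennreal (2 * (A + E) * (t - u)\<^sup>2)"
    if ut: "0 \<le> u" "u \<le> t" "t \<le> N" for u t
  proof (cases "u = t")
    case True
    then show ?thesis by simp
  next
    case False
    define h where "h = t - u"
    have h: "h > 0" "h \<le> max N 1" using False ut by (auto simp: h_def)
    define g where "g s = K1 * n (u - s) + C * p (0 - s)" for s
    define k where "k s = D * h powr (\<alpha> + 1) * indicator {u..t} s" for s
    have gm[measurable]: "g \<in> borel_measurable borel" unfolding g_def by measurable
    have km[measurable]: "k \<in> borel_measurable borel" unfolding k_def by measurable
    have g0: "g s \<ge> 0" and k0: "k s \<ge> 0" for s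
      using K1 C D by (auto simp: g_def k_def n_def p_def two_powers_nonneg)
    have rem: "\<bar>frac_remainder (t - s) - frac_remainder (u - s)\<bar> \<le> h * (K1 * n (u - s)) + k s" for s
    proof -
      have n0: "h * (K1 * n (u - s)) \<ge> 0" using h K1 by (simp add: n_def two_powers_nonneg)
      consider "s < u" | "u \<le> s" "s \<le> t" | "s > t" by linarith
      then show ?thesis
      proof cases
        case 1
        then have "\<bar>frac_remainder ((u - s) + h) - frac_remainder (u - s)\<bar> \<le> K1 * h * n (u - s)"
          unfolding n_def using h by (intro K1(2)) auto
        moreover have "(u - s) + h = t - s" by (simp add: h_def)
        ultimately show ?thesis using k0[of s] by (simp add: mult_ac)
      next
        case 2
        have "\<bar>frac_remainder (t - s)\<bar> \<le> D * (t - s) powr (\<alpha> + 1)"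
          unfolding D_def using 2 by (intro frac_remainder_small) auto
        also have "\<dots> \<le> D * h powr (\<alpha> + 1)"
          using 2 alpha D by (intro mult_left_mono powr_mono2) (auto simp: h_def)
        finally show ?thesis using 2 n0 by (simp add: frac_remainder_nonpos k_def)
      next
        case 3
        then show ?thesis using ut n0 k0[of s] by (simp add: frac_remainder_nonpos)
      qed
    qed
    have pt: "\<bar>difference_kernel t s - difference_kernel u s\<bar> \<le> h * g s + k s" for s
    proof -
      have "\<bar>past_kernel t s - past_kernel u s\<bar> \<le> h * (C * p (- s))"
        unfolding h_def p_def by (rule past_kernel_increment[OF ut(1,2)])
      with rem[of s] show ?thesis
        unfolding difference_kernel_def g_def by (simp add: distrib_left)
    qed
    have "(\<integral>\<^sup>+s. ennreal ((difference_kernel t s - difference_kernel u s)\<^sup>2) \<partial>lborel)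
      \<le> (\<integral>\<^sup>+s. ennreal ((h * g s + k s)\<^sup>2) \<partial>lborel)"
    proof (intro nn_integral_mono ennreal_leI)
      fix s
      show "(difference_kernel t s - difference_kernel u s)\<^sup>2 \<le> (h * g s + k s)\<^sup>2"
        using power_mono[OF pt[of s], of 2] by simp
    qed
    also have "\<dots> \<le> 2 * ((\<integral>\<^sup>+s. ennreal ((h * g s)\<^sup>2) \<partial>lborel) + (\<integral>\<^sup>+s. ennreal ((k s)\<^sup>2) \<partial>lborel))"
      by (rule nn_integral_square_add_le) measurable
    also have "\<dots> \<le> 2 * (ennreal (h\<^sup>2 * A) + ennreal (h\<^sup>2 * E))"
    proof (intro mult_left_mono add_mono)
      have "(\<integral>\<^sup>+s. ennreal ((h * g s)\<^sup>2) \<partial>lborel) = ennreal (h\<^sup>2) * (\<integral>\<^sup>+s. ennreal ((g s)\<^sup>2) \<partial>lborel)"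
        unfolding power_mult_distrib by (subst nn_integral_cmult[symmetric]) (auto simp: ennreal_mult)
      also have "(\<integral>\<^sup>+s. ennreal ((g s)\<^sup>2) \<partial>lborel)
        \<le> 2 * ((\<integral>\<^sup>+s. ennreal ((K1 * n (u - s))\<^sup>2) \<partial>lborel) + (\<integral>\<^sup>+s. ennreal ((C * p (0 - s))\<^sup>2) \<partial>lborel))"
        unfolding g_def by (rule nn_integral_square_add_le) measurable
      also have "\<dots> = ennreal A"
        unfolding A(2)[symmetric]
        using nn_integral_reflect[of "\<lambda>s. ennreal ((K1 * n s)\<^sup>2)" u] nn_integral_reflect[of "\<lambda>s. ennreal ((C * p s)\<^sup>2)" 0]
        by simp
      finally show "(\<integral>\<^sup>+s. ennreal ((h * g s)\<^sup>2) \<partial>lborel) \<le> ennreal (h\<^sup>2 * A)"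
        using A(1) by (simp add: ennreal_mult mult_left_mono)
      have "(\<integral>\<^sup>+s. ennreal ((k s)\<^sup>2) \<partial>lborel) = (\<integral>\<^sup>+s. ennreal ((D * h powr (\<alpha> + 1))\<^sup>2) * indicator {u..t} s \<partial>lborel)"
        by (intro nn_integral_cong) (auto simp: k_def split: split_indicator)
      also have "\<dots> = ennreal ((D * h powr (\<alpha> + 1))\<^sup>2) * ennreal h"
        using ut by (simp add: nn_integral_cmult h_def)
      also have "\<dots> = ennreal ((D * h powr (\<alpha> + 1))\<^sup>2 * h)" using h by (simp add: ennreal_mult)
      also have "(D * h powr (\<alpha> + 1))\<^sup>2 * h = h\<^sup>2 * (D\<^sup>2 * h powr (2 * \<alpha> + 1))"
      proof -
        have "(h powr (\<alpha> + 1))\<^sup>2 * h = h powr (\<alpha> + 1) * h powr (\<alpha> + 1) * h powr 1"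
          using h by (simp add: power2_eq_square)
        also have "\<dots> = h powr 2 * h powr (2 * \<alpha> + 1)"
          by (simp only: powr_add[symmetric]) (simp add: algebra_simps)
        also have "h powr 2 = h\<^sup>2" using h by simp
        finally show ?thesis by (simp add: power_mult_distrib mult_ac)
      qed
      also have "\<dots> \<le> h\<^sup>2 * E"
        unfolding E_def using h alpha by (intro mult_left_mono powr_mono2) auto
      finally show "(\<integral>\<^sup>+s. ennreal ((k s)\<^sup>2) \<partial>lborel) \<le> ennreal (h\<^sup>2 * E)" by (simp add: ennreal_leI)
    qed auto
    also have "\<dots> = ennreal (2 * (A + E) * (t - u)\<^sup>2)"
    proof -
      have "2 * (ennreal (h\<^sup>2 * A) + ennreal (h\<^sup>2 * E)) = ennreal (2 * (h\<^sup>2 * A + h\<^sup>2 * E))"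
        using A(1) E by (subst ennreal_mult) auto
      then show ?thesis by (simp add: h_def algebra_simps)
    qed
    finally show ?thesis .
  qed
  show ?thesis by (rule that[OF _ main]) (use A(1) E in auto)
qed

end



section \<open>Decay of a square-integrable function with small derivative\<close>

text \<open>The right-hand side is the integral of \<open>C (1 + x)\<^sup>-\<^sup>\<zeta>\<close> over \<open>[y, \<infinity>)\<close>. Adding this tail to \<open>f\<close> gives
a nonincreasing function.\<close>

lemma tail_increment_bound:
  fixes f f' :: "real \<Rightarrow> real"
  assumes d: "\<And>s. 0 \<le> s \<Longrightarrow> (f has_real_derivative f' s) (at s within {0..})"
    and b: "\<And>s. 0 \<le> s \<Longrightarrow> f' s \<le> C * (1 + s) powr (- \<zeta>)" and \<zeta>: "\<zeta> > 1" and C: "C \<ge> 0"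
    and yz: "0 \<le> y" "y \<le> z"
  shows "f z - f y \<le> C / (\<zeta> - 1) * (1 + y) powr (1 - \<zeta>)"
proof (cases "y = z")
  case True
  then show ?thesis using C \<zeta> by simp
next
  case False
  define A where "A x = C / (\<zeta> - 1) * (1 + x) powr (1 - \<zeta>)" for x
  have dA: "((\<lambda>x. f x + A x) has_real_derivative f' s - C * (1 + s) powr (- \<zeta>)) (at s within {0..})"
    if s: "0 \<le> s" for s
  proof -
    have "((\<lambda>x. 1 + x) has_real_derivative 1) (at s)" by (auto intro!: derivative_eq_intros)
    from DERIV_fun_powr[OF this, of "1 - \<zeta>"] s
    have "((\<lambda>x. (1 + x) powr (1 - \<zeta>)) has_real_derivative (1 - \<zeta>) * (1 + s) powr (- \<zeta>)) (at s)" by simp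
    from DERIV_cmult[OF this, of "C / (\<zeta> - 1)"]
    have "(A has_real_derivative C / (\<zeta> - 1) * ((1 - \<zeta>) * (1 + s) powr (- \<zeta>))) (at s)"
      unfolding A_def .
    also have "C / (\<zeta> - 1) * ((1 - \<zeta>) * (1 + s) powr (- \<zeta>)) = - (C * (1 + s) powr (- \<zeta>))"
      using \<zeta> by (simp add: field_simps)
    finally show ?thesis
      using DERIV_add[OF d[OF s] has_field_derivative_at_within] by fastforce
  qed
  obtain x where x: "y < x" "(f z + A z) - (f y + A y) = (z - y) * (f' x - C * (1 + x) powr (- \<zeta>))"
    using mean_value_half_line[OF dA, of y z] yz False by (metis less_le)
  have "(z - y) * (f' x - C * (1 + x) powr (- \<zeta>)) \<le> 0"
    using b[of x] x yz by (intro mult_nonneg_nonpos) auto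
  moreover have "A z \<ge> 0" using C \<zeta> by (simp add: A_def)
  ultimately show ?thesis using x(2) by (simp add: A_def)
qed

text \<open>The function stays within its tail bound of \<open>f y\<close> on \<open>[y, \<infinity>)\<close>. If \<open>\<bar>f y\<bar>\<close> were larger than this bound,
\<open>\<bar>f\<bar>\<close> would be bounded away from 0, contradicting square integrability of \<open>f s\<^sup>a\<close>, since \<open>s\<^sup>2\<^sup>a\<close> dominates
\<open>1/s\<close> at infinity.\<close>

lemma decay_of_square_integrable:
  fixes f f' :: "real \<Rightarrow> real"
  assumes d: "\<And>s. 0 \<le> s \<Longrightarrow> (f has_real_derivative f' s) (at s within {0..})"
    and b: "\<And>s. 0 \<le> s \<Longrightarrow> \<bar>f' s\<bar> \<le> C * (1 + s) powr (- \<zeta>)" and \<zeta>: "\<zeta> > 1" and C: "C \<ge> 0"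
    and a: "a > -1/2" and sq: "set_integrable lborel {0..} (\<lambda>s. \<bar>f s * s powr a\<bar>\<^sup>2)" and y: "0 \<le> y"
  shows "\<bar>f y\<bar> \<le> C / (\<zeta> - 1) * (1 + y) powr (1 - \<zeta>)"
proof (rule ccontr)
  define A where "A = C / (\<zeta> - 1) * (1 + y) powr (1 - \<zeta>)"
  assume "\<not> ?thesis"
  then have c: "\<bar>f y\<bar> - A > 0" by (simp add: A_def)
  define c where "c = \<bar>f y\<bar> - A"
  have inc: "\<bar>f z - f y\<bar> \<le> A" if "y \<le> z" for z
  proof -
    have "f z - f y \<le> A"
      unfolding A_def using b by (intro tail_increment_bound[OF d _ \<zeta> C y that]) (auto simp: abs_le_iff)
    moreover have "- f z - - f y \<le> A"
      unfolding A_def using b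
      by (intro tail_increment_bound[where f="\<lambda>x. - f x" and f'="\<lambda>x. - f' x", OF DERIV_minus[OF d] _ \<zeta> C y that])
        (auto simp: abs_le_iff)
    ultimately show ?thesis by (simp add: abs_le_iff)
  qed
  have "(\<integral>\<^sup>+s. ennreal (norm (indicator {0..} s *\<^sub>R \<bar>f s * s powr a\<bar>\<^sup>2)) \<partial>lborel) < \<infinity>"
    using sq unfolding set_integrable_def integrable_iff_bounded by blast
  then obtain I where I: "I \<ge> 0"
    "(\<integral>\<^sup>+s. ennreal (norm (indicator {0..} s *\<^sub>R \<bar>f s * s powr a\<bar>\<^sup>2)) \<partial>lborel) = ennreal I"
    unfolding infinity_ennreal_def less_top_ennreal by blast
  define q where "q = max y 1"
  \<comment> \<open>Chosen such that the integral of \<open>c\<^sup>2 / s\<close> over \<open>[q, R]\<close> is \<open>I + c\<^sup>2\<close>.\<close>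
  define R where "R = q * exp (I / c\<^sup>2 + 1)"
  have c0: "c > 0" using c by (simp add: c_def)
  have q: "q \<ge> 1" "q \<ge> y" by (auto simp: q_def)
  have "1 \<le> exp (I / c\<^sup>2 + 1)" using I(1) by simp
  then have R: "q \<le> R" using q by (simp add: R_def)
  have "ennreal (c\<^sup>2) * ennreal (ln R - ln q) = ennreal (c\<^sup>2) * (\<integral>\<^sup>+s. ennreal (inverse s) * indicator {q..R} s \<partial>lborel)"
  proof (subst nn_integral_FTC_Icc[where F=ln])
    show "(\<lambda>s::real. inverse s) \<in> borel_measurable borel" by measurable
  qed (use q R in \<open>auto intro!: derivative_eq_intros simp: inverse_eq_divide\<close>)
  also have "\<dots> = (\<integral>\<^sup>+s. ennreal (c\<^sup>2) * (ennreal (inverse s) * indicator {q..R} s) \<partial>lborel)"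
    by (rule nn_integral_cmult[symmetric]) measurable
  also have "\<dots> \<le> (\<integral>\<^sup>+s. ennreal (norm (indicator {0..} s *\<^sub>R \<bar>f s * s powr a\<bar>\<^sup>2)) \<partial>lborel)"
  proof (rule nn_integral_mono)
    fix s
    show "ennreal (c\<^sup>2) * (ennreal (inverse s) * indicator {q..R} s)
      \<le> ennreal (norm (indicator {0..} s *\<^sub>R \<bar>f s * s powr a\<bar>\<^sup>2))"
    proof (cases "s \<in> {q..R}")
      case True
      then have s: "s \<ge> 1" "s \<ge> y" using q by auto
      have "c \<le> \<bar>f s\<bar>" using inc[OF s(2)] by (simp add: c_def)
      then have "c\<^sup>2 \<le> (f s)\<^sup>2" using c0 by (metis power_mono power2_abs less_imp_le)
      moreover have "inverse s \<le> (s powr a)\<^sup>2"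
      proof -
        have "inverse s = s powr (- 1)" using s by (simp add: powr_minus)
        also have "\<dots> \<le> s powr (2 * a)" using s a by (intro powr_mono) auto
        also have "\<dots> = (s powr a)\<^sup>2" by (simp add: power2_eq_square powr_add[symmetric])
        finally show ?thesis .
      qed
      ultimately have "c\<^sup>2 * inverse s \<le> (f s)\<^sup>2 * (s powr a)\<^sup>2" using s by (intro mult_mono) auto
      then show ?thesis
        using True s by (simp add: ennreal_mult[symmetric] power_mult_distrib ennreal_leI)
    qed simp
  qed
  also have "\<dots> = ennreal I" by (rule I(2))
  finally have "c\<^sup>2 * (ln R - ln q) \<le> I"
    using I(1) q R by (simp add: ennreal_mult[symmetric] ennreal_le_iff)
  moreover have "ln R - ln q = I / c\<^sup>2 + 1" using q by (simp add: R_def ln_mult)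
  moreover have "c\<^sup>2 * (I / c\<^sup>2 + 1) = I + c\<^sup>2" using c0 by (simp add: field_simps)
  ultimately show False using c0 by simp
qed

section \<open>Absolute continuity of the difference process\<close>

theorem theorem1:
  fixes M :: "'a measure" and F :: "real \<Rightarrow> 'a measure"
    and B \<sigma> X Y YX :: "real \<Rightarrow> 'a \<Rightarrow> real"
    and L L' L'' :: "real \<Rightarrow> real" and \<alpha> \<zeta>\<^sub>0 :: real
  assumes B: "two_sided_brownian_motion M F B"
    and \<alpha>: "\<alpha> \<in> {-1/2<..<0} \<union> {0<..<1/2}"
    and L': "\<And>s. 0 \<le> s \<Longrightarrow> (L has_real_derivative L' s) (at s within {0..})"
    and L'': "\<And>s. 0 \<le> s \<Longrightarrow> (L' has_real_derivative L'' s) (at s within {0..})"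
    and L''_cont: "continuous_on {0..} L''"
    and L_0: "L 0 \<noteq> 0"
    and L_square: "set_integrable lborel {0..} (\<lambda>s. \<bar>L s * s powr \<alpha>\<bar>\<^sup>2)"
    and \<zeta>\<^sub>0: "\<zeta>\<^sub>0 > \<alpha> + 3/2"
    and L'_decay: "L' \<in> O[at_top](\<lambda>s. s powr (- \<zeta>\<^sub>0))"
    and L''_decay: "L'' \<in> O[at_top](\<lambda>s. s powr (- (\<zeta>\<^sub>0 + 1)))"
    and \<sigma>_adapted: "adapted_process F \<sigma>"
    and \<sigma>_stationary: "stationary_process M \<sigma>"
    and \<sigma>_caglad: "caglad_process M \<sigma>"
    and \<sigma>_moment: "(SUP t. \<integral>\<^sup>+\<omega>. ennreal ((\<sigma> t \<omega>)\<^sup>2) \<partial>M) < \<infinity>"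
    and Y: "\<And>t. Y t = ito_integral_upto M F B t (\<lambda>s \<omega>. L (t - s) * (t - s) powr \<alpha> * \<sigma> s \<omega>)"
    and X: "\<And>t. X t = ito_integral_upto M F B t
              (\<lambda>s \<omega>. (pos_powr (t - s) \<alpha> - pos_powr (- s) \<alpha>) * \<sigma> s \<omega>)"
    and YX: "\<And>t. YX t = wiener_integral M F B (frac_kernel \<alpha>) \<sigma> t (\<lambda>s. L (t - s))"
  shows
    "(\<forall>t. (\<lambda>s. L (t - s)) \<in> wiener_integrands (frac_kernel \<alpha>) t) \<and>
     (\<forall>t. has_ito_integral_upto M F B t (\<lambda>s \<omega>. L (t - s) * (t - s) powr \<alpha> * \<sigma> s \<omega>) (Y t) \<and>
          has_ito_integral_upto M F B t
            (\<lambda>s \<omega>. (pos_powr (t - s) \<alpha> - pos_powr (- s) \<alpha>) * \<sigma> s \<omega>) (X t) \<and>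
          has_ito_integral_upto M F B t
            (\<lambda>s \<omega>. kernel_transform (frac_kernel \<alpha>) (\<lambda>s. L (t - s)) t s * \<sigma> s \<omega>) (YX t)) \<and>
     (\<exists>V. (\<forall>t\<ge>0. AE \<omega> in M. V t \<omega> = YX t \<omega> - Y t \<omega>) \<and>
          (AE \<omega> in M. \<forall>T\<ge>0. absolutely_continuous_on_interval 0 T (\<lambda>t. V t \<omega>)))"
proof -
  interpret two_sided_brownian_motion M F B by (rule B)
  have a: "-1/2 < \<alpha>" "\<alpha> < 1/2" using \<alpha> by auto
  \<comment> \<open>The second term is the midpoint of \<open>\<alpha> + 3/2\<close> and 2.\<close>
  define \<zeta> where "\<zeta> = min \<zeta>\<^sub>0 ((\<alpha> + 7/2) / 2)"
  have \<zeta>: "\<alpha> + 3/2 < \<zeta>" "\<zeta> < 2" "\<zeta> \<le> \<zeta>\<^sub>0" "\<zeta> > 1"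
    using a \<zeta>\<^sub>0 by (auto simp: \<zeta>_def min_def)
  have L'_cont: "continuous_on {0..} L'"
    using L'' by (auto intro!: DERIV_continuous simp: continuous_on_eq_continuous_within)
  obtain C1 where C1: "C1 > 0" "\<And>y. y \<ge> 0 \<Longrightarrow> \<bar>L' y\<bar> \<le> C1 * (1 + y) powr (- \<zeta>)"
    using bigo_powr_bound[OF L'_cont L'_decay, of \<zeta>] \<zeta> by auto
  obtain C2 where C2: "C2 > 0" "\<And>y. y \<ge> 0 \<Longrightarrow> \<bar>L'' y\<bar> \<le> C2 * (1 + y) powr (- (\<zeta> + 1))"
    using bigo_powr_bound[OF L''_cont L''_decay, of "\<zeta> + 1"] \<zeta> by auto
  have L_decay: "\<bar>L y\<bar> \<le> C1 / (\<zeta> - 1) * (1 + y) powr (1 - \<zeta>)" if "y \<ge> 0" for y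
    by (rule decay_of_square_integrable[OF L' C1(2) \<zeta>(4) _ a(1) L_square that]) (use C1(1) in auto)
  define C where "C = C1 + C2 + C1 / (\<zeta> - 1)"
  have C: "C > 0" "C1 \<le> C" "C2 \<le> C" "C1 / (\<zeta> - 1) \<le> C"
    using C1(1) C2(1) \<zeta> by (auto simp: C_def add_pos_nonneg)
  interpret K: decaying_kernel \<alpha> \<zeta> C L L' L''
  proof
    show "\<bar>L y\<bar> \<le> C * (1 + y) powr (1 - \<zeta>)" if "0 \<le> y" for y
      by (rule order_trans[OF L_decay[OF that] mult_right_mono[OF C(4)]]) simp
    show "\<bar>L' y\<bar> \<le> C * (1 + y) powr (- \<zeta>)" if "0 \<le> y" for y
      by (rule order_trans[OF C1(2)[OF that] mult_right_mono[OF C(2)]]) simp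
    show "\<bar>L'' y\<bar> \<le> C * (1 + y) powr (- (\<zeta> + 1))" if "0 \<le> y" for y
      by (rule order_trans[OF C2(2)[OF that] mult_right_mono[OF C(3)]]) simp
  qed (use a \<zeta> C L' L'' in auto)
  have \<sigma>: "predictable_process M F \<sigma>"
    by (rule adapted_caglad_predictable[OF \<sigma>_adapted \<sigma>_caglad])
  obtain m where m: "m \<ge> 0" "(SUP t. \<integral>\<^sup>+\<omega>. ennreal ((\<sigma> t \<omega>)\<^sup>2) \<partial>M) = ennreal m"
    using \<sigma>_moment unfolding infinity_ennreal_def less_top_ennreal by blast
  have mom: "(\<integral>\<^sup>+\<omega>. ennreal ((\<sigma> t \<omega>)\<^sup>2) \<partial>M) \<le> ennreal m" for t
    unfolding m(2)[symmetric] by (rule SUP_upper) simp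
  have ito: "has_ito_integral M F B (\<lambda>s \<omega>. k s * \<sigma> s \<omega>) (ito_integral M F B (\<lambda>s \<omega>. k s * \<sigma> s \<omega>))"
    if "square_integrable k" for k
    using that unfolding square_integrable_def
    by (elim conjE kernel_ito_exists[OF \<sigma> _ mom] ito_integral_I)
  have eqY: "(\<lambda>s \<omega>. indicator {..t} s * (L (t - s) * (t - s) powr \<alpha> * \<sigma> s \<omega>)) = (\<lambda>s \<omega>. K.own_kernel (t - s) * \<sigma> s \<omega>)" for t
    by (auto simp: fun_eq_iff K.own_kernel_def split: split_indicator)
  have eqX: "(\<lambda>s \<omega>. indicator {..t} s * ((pos_powr (t - s) \<alpha> - pos_powr (- s) \<alpha>) * \<sigma> s \<omega>))
      = (\<lambda>s \<omega>. (indicator {..t} s * (pos_powr (t - s) \<alpha> - pos_powr (- s) \<alpha>)) * \<sigma> s \<omega>)" for t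
    by (simp add: fun_eq_iff)
  have eqYX: "(\<lambda>s \<omega>. indicator {..t} s * (kernel_transform (frac_kernel \<alpha>) (\<lambda>s. L (t - s)) t s * \<sigma> s \<omega>))
      = (\<lambda>s \<omega>. K.transform_kernel t s * \<sigma> s \<omega>)" for t
    by (simp add: fun_eq_iff K.transform_kernel_def)
  have hY: "has_ito_integral M F B (\<lambda>s \<omega>. K.own_kernel (t - s) * \<sigma> s \<omega>) (Y t)" for t
    unfolding Y ito_integral_upto_def eqY
    by (intro ito square_integrable_reflect K.own_kernel_square_integrable L_square)
  have hX: "has_ito_integral M F B
      (\<lambda>s \<omega>. (indicator {..t} s * (pos_powr (t - s) \<alpha> - pos_powr (- s) \<alpha>)) * \<sigma> s \<omega>) (X t)" for t
    unfolding X ito_integral_upto_def eqX by (intro ito fractional_kernel_square_integrable a)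
  have hYX: "has_ito_integral M F B (\<lambda>s \<omega>. K.transform_kernel t s * \<sigma> s \<omega>) (YX t)" for t
    unfolding YX wiener_integral_def ito_integral_upto_def eqYX
    by (intro ito K.transform_kernel_square_integrable L_square)
  define W where "W t \<omega> = YX t \<omega> - Y t \<omega>" for t \<omega>
  have hW: "has_ito_integral M F B (\<lambda>s \<omega>. K.difference_kernel t s * \<sigma> s \<omega>) (W t)" for t
  proof -
    have "(\<lambda>s \<omega>. K.transform_kernel t s * \<sigma> s \<omega> - K.own_kernel (t - s) * \<sigma> s \<omega>)
        = (\<lambda>s \<omega>. K.difference_kernel t s * \<sigma> s \<omega>)"
      by (simp add: fun_eq_iff K.transform_kernel_eq K.difference_kernel_def algebra_simps)
    then show ?thesis using has_ito_integral_diff[OF hYX[of t] hY[of t]] by (simp add: W_def[abs_def])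
  qed
  have W_measurable: "W t \<in> borel_measurable M" for t
    using hW[of t] by (simp add: has_ito_integral_def)
  have lip: "\<exists>D\<ge>0. \<forall>u t. 0 \<le> u \<and> u \<le> t \<and> t \<le> real N \<longrightarrow>
      (\<integral>\<^sup>+\<omega>. ennreal ((W t \<omega> - W u \<omega>)\<^sup>2) \<partial>M) \<le> ennreal (D * (t - u)\<^sup>2)" for N :: nat
  proof -
    obtain D where D: "D \<ge> 0" "\<And>u t. 0 \<le> u \<Longrightarrow> u \<le> t \<Longrightarrow> t \<le> real N \<Longrightarrow>
      (\<integral>\<^sup>+s. ennreal ((K.difference_kernel t s - K.difference_kernel u s)\<^sup>2) \<partial>lborel) \<le> ennreal (D * (t - u)\<^sup>2)"
      by (rule K.difference_kernel_lipschitz[of "real N"], rule that, assumption+)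
    have "(\<integral>\<^sup>+\<omega>. ennreal ((W t \<omega> - W u \<omega>)\<^sup>2) \<partial>M) \<le> ennreal (2 * m * D * (t - u)\<^sup>2)"
      if ut: "0 \<le> u" "u \<le> t" "t \<le> real N" for u t
    proof -
      define k where "k s = K.difference_kernel t s - K.difference_kernel u s" for s
      have k: "k \<in> borel_measurable borel" unfolding k_def by measurable
      have k2: "(\<integral>\<^sup>+s. ennreal ((k s)\<^sup>2) \<partial>lborel) \<le> ennreal (D * (t - u)\<^sup>2)"
        unfolding k_def by (rule D(2)[OF ut])
      have "(\<integral>\<^sup>+s. ennreal ((k s)\<^sup>2) \<partial>lborel) < \<infinity>" using k2 by (auto intro: le_less_trans)
      then obtain I where I: "has_ito_integral M F B (\<lambda>s \<omega>. k s * \<sigma> s \<omega>) I"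
        "(\<integral>\<^sup>+\<omega>. ennreal ((I \<omega>)\<^sup>2) \<partial>M) \<le> 2 * (ennreal m * (\<integral>\<^sup>+s. ennreal ((k s)\<^sup>2) \<partial>lborel))"
        by (rule kernel_ito_exists[OF \<sigma> k mom])
      have "has_ito_integral M F B (\<lambda>s \<omega>. k s * \<sigma> s \<omega>) (\<lambda>\<omega>. W t \<omega> - W u \<omega>)"
        using has_ito_integral_diff[OF hW[of t] hW[of u]] by (simp add: k_def left_diff_distrib)
      from has_ito_integral_unique[OF this I(1)]
      have "AE \<omega> in M. ennreal ((W t \<omega> - W u \<omega>)\<^sup>2) = ennreal ((I \<omega>)\<^sup>2)"
        by eventually_elim simp
      then have "(\<integral>\<^sup>+\<omega>. ennreal ((W t \<omega> - W u \<omega>)\<^sup>2) \<partial>M) = (\<integral>\<^sup>+\<omega>. ennreal ((I \<omega>)\<^sup>2) \<partial>M)"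
        by (rule nn_integral_cong_AE)
      also have "\<dots> \<le> 2 * (ennreal m * (\<integral>\<^sup>+s. ennreal ((k s)\<^sup>2) \<partial>lborel))" by (rule I(2))
      also have "\<dots> \<le> 2 * (ennreal m * ennreal (D * (t - u)\<^sup>2))" by (intro mult_left_mono k2) auto
      also have "\<dots> = ennreal (2 * m * D * (t - u)\<^sup>2)"
      proof -
        have "ennreal (2 * (m * (D * (t - u)\<^sup>2))) = 2 * (ennreal m * ennreal (D * (t - u)\<^sup>2))"
          using m(1) D(1) by (subst ennreal_mult) (auto simp: ennreal_mult)
        then show ?thesis by (simp add: mult.assoc)
      qed
      finally show ?thesis .
    qed
    then show ?thesis using m(1) D(1) by (intro exI[of _ "2 * m * D"]) auto
  qed
  obtain V where V: "\<And>t. t \<ge> 0 \<Longrightarrow> AE \<omega> in M. V t \<omega> = W t \<omega>"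
    "AE \<omega> in M. \<forall>T\<ge>0. absolutely_continuous_on_interval 0 T (\<lambda>t. V t \<omega>)"
    by (rule absolutely_continuous_modification[OF W_measurable lip], rule that, assumption+)
  show ?thesis
    unfolding has_ito_integral_upto_def eqY eqX eqYX
    using K.wiener_integrand[OF L_square] hY hX hYX V unfolding W_def by blast
qed

end
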